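(* Consider a downlink cellular network whose base stations form a homogeneous Poisson point process of intensity $\lambda$ in $\mathbb{R}^2$. The user at the origin is served by its nearest base station, the path-loss exponent is $\eta$, the transmit power is $P$ and the noise power is $N_o$. Let the fading coefficient $g_0$ of the desired link be generalized two-ray (GTR) with parameters $\{K_o,\Delta_o,\sigma_o^2,f_{\alpha_o}\}$. Let the fading coefficients $g_i$, $i\ge 1$, of the interfering links be i.i.d. GTR with parameters $\{K,\Delta,\sigma^2,f_\alpha\}$. All fading coefficients are mutually independent and independent of the base station locations. Then the average spectral efficiency $\bar{\mathcal{A}}=\mathbb{E}[\ln(1+\mathrm{SINR})]$ is given by $$\bar{\mathcal{A}}=\int_0^\infty\int_0^\infty \mathcal{L}_{\mathcal{I}(r)}\!\left(\frac{z}{N_o}\right)\left(1-\mathcal{L}_{\mathcal{S}(r)}\!\left(\frac{z}{N_o}\right)\right)\frac{e^{-z}}{z}\,f_{r_0}(r)\,dr\,dz,\qquad f_{r_0}(r)=2\pi\lambda r e^{-\pi\lambda r^2},$$ where $\mathcal{L}_{\mathcal{S}(r)}$ and $\mathcal{L}_{\mathcal{I}(r)}$ are the Laplace transforms of the desired signal power and of the aggregate interference conditioned on $r_0=r$. Here $\mathcal{L}_{\mathcal{I}(r)}(s)$ is as follows, with $y_o=y_o(s)=\frac{2\sigma^2sP}{r^\eta+2\sigma^2sP}$. (i) For general $K$ it is given by $$\mathcal{L}_{\mathcal{I}(r)}(s)=\exp\Bigg(\pi\lambda\left(\frac{2\sigma^2sP(1-y_o)}{y_o}\right)^{\frac2\eta}\big(1-(1-y_o)\zeta_1(Ky_o)\big)-\pi\lambda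 \left(2\sigma^2sP\right)^{\frac2\eta}\left[\int_0^{y_o}\frac{(1-y)^{\frac2\eta+1}}{y^{\frac2\eta}}\zeta_1'(Ky)\,dy+\int_0^{y_o}\frac{(1-y)^{\frac2\eta}\zeta_1(Ky)}{y^{\frac2\eta}}\,dy\right]\Bigg).$$ (ii) It is lower bounded by $$\exp\Bigg(\pi\lambda\left(\frac{2\sigma^2sP(1-y_o)}{y_o}\right)^{\frac2\eta}\big(1-(1-y_o)\zeta_1(Ky_o)\big)-\frac{2\pi^2}{\eta}\zeta_2\lambda\csc\!\left(\frac{2\pi}{\eta}\right)\left(2\sigma^2sP\right)^{\frac2\eta}\Bigg).$$ (iii) When $K\to\infty$ (and $\sigma^2\to0$ such that $\Omega=(K+1)2\sigma^2$ is constant) it reduces to $$\exp\Big(\pi\lambda\big(r^2\,\zeta_1(sP\Omega r^{-\eta})-(sP)^{\frac2\eta}\,\zeta_3(sP\Omega r^{-\eta})\big)\Big).$$ The functions and constants appearing in (i)-(iii) are $$\zeta_1(x)=\int_0^{2\pi}e^{-x(1+\Delta\cos\alpha)}f_\alpha(\alpha)\,d\alpha,\qquad \zeta_1'(Ky)=\frac{d\,\zeta_1(Ky)}{dy},$$ $$\zeta_2=\int_0^{2\pi}f_\alpha(\alpha)\Big[{}_1F_1\big(1-\tfrac2\eta;2;-K(1+\Delta\cos\alpha)\big)+K(1+\Delta\cos\alpha)\tfrac{\eta+2}{2\eta}\,{}_1F_1\big(1-\tfrac2\eta;3;-K(1+\Delta\cos\alpha)\big)\Big]d\alpha,$$ 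$$\zeta_3(x)=\int_0^{2\pi}\gamma\big(1-\tfrac2\eta,\,x(1+\Delta\cos\alpha)\big)f_\alpha(\alpha)\,d\alpha.$$
   Context: Network: $\Psi\subset\mathbb{R}^2$ is a homogeneous Poisson point process of intensity $\lambda$. The ordered distances from the origin to its points are $r_0<r_1<r_2<\dots$. The serving base station is the one at distance $r_0$, whose density is $f_{r_0}(r)=2\pi\lambda r e^{-\pi\lambda r^2}$, $r\ge0$, and all other base stations interfere. Signal power decays with distance $r$ as $r^{-\eta}$, where $\eta$ is the path-loss exponent. The SINR is $\mathrm{SINR}=\frac{\mathcal{S}(r_0)}{\mathcal{I}(r_0)+N_o}$ with $\mathcal{S}(r_0)=P|g_0|^2r_0^{-\eta}$ and $\mathcal{I}(r_0)=\sum_{i\ge1}P|g_i|^2r_i^{-\eta}$. For a random variable $X\geq 0$, its Laplace transform is $\mathcal{L}_X(s)=\mathbb{E}[e^{-sX}]$. The transforms $\mathcal{L}_{\mathcal{S}(r)},\mathcal{L}_{\mathcal{I}(r)}$ are taken conditionally on $r_0=r$. GTR fading: a complex random variable $g$ is GTR with parameters $K$, $\Delta$, $\sigma^2$ and $f_\alpha$ (a probability density on $[0,2\pi]$) if $g=V_1e^{j\phi_1}+V_2e^{j\phi_2}+X+jY$. Here $V_1,V_2\ge0$ are constant amplitudes, $X,Y\sim\mathcal{N}(0,\sigma^2)$ are independent of each other and of $(\phi_1,\phi_2)$, the phase difference $\alpha=\phi_1-\phi_2$ (mod $2\pi$) has density $f_\alpha$, $K=\frac{V_1^2+V_2^2}{2\sigma^2}$,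 and $\Delta=\frac{2V_1V_2}{V_1^2+V_2^2}$. ${}_1F_1$ is the confluent hypergeometric function and $\gamma(\cdot,\cdot)$ is the lower incomplete gamma function.
   Formalization: In (i) the ζ₁′ integral carries a minus sign; in (iii) ζ₁ is replaced by 1−ζ₁, (sP)^{2/η} by (sPΩ)^{2/η}, and ζ₃ gets the weight (1+Δcosα)^{2/η}, since the printed formulas are false (e.g. (iii) tends to exp(πλr²)>1 as s→0); η>2 is made explicit. *)

theory Defs
  imports "HOL-Probability.Probability" "HOL-Library.Real_Mod"
begin

section \<open>Poisson point processes in the plane\<close>

text \<open>The sigma-algebra on point configurations generated by the counts of points in bounded
  Borel sets.\<close>

definition config_space :: "(real^2) set measure" where
  "config_space = sigma UNIV {{S. card (S \<inter> B) = n} | B n. B \<in> sets borel \<and> bounded B}"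

text \<open>Local finiteness is required at every sample point, so that \<^const>\<open>card\<close> is a genuine count.
  The probabilities are written out because the library's Poisson distribution
  does not include the rate 0, which occurs for Lebesgue null sets.\<close>

definition poisson_point_process ::
    "'w measure \<Rightarrow> real \<Rightarrow> ('w \<Rightarrow> (real^2) set) \<Rightarrow> bool" where
  "poisson_point_process M lam \<Psi> \<longleftrightarrow>
     (\<forall>\<omega>\<in>space M. \<forall>B. bounded B \<longrightarrow> finite (\<Psi> \<omega> \<inter> B)) \<and>
     (\<forall>B\<in>sets borel. bounded B \<longrightarrow>
        (\<lambda>\<omega>. card (\<Psi> \<omega> \<inter> B)) \<in> measurable M (count_space UNIV) \<and>
        (\<forall>n. measure M {\<omega>\<in>space M. card (\<Psi> \<omega> \<inter> B) = n} =
               (lam * measure lborel B) ^ n / fact n * exp (- (lam * measure lborel B)))) \<and>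
     (\<forall>(B :: nat \<Rightarrow> (real^2) set) m.
        (\<forall>i<m. B i \<in> sets borel \<and> bounded (B i)) \<and> disjoint_family_on B {..<m} \<longrightarrow>
        prob_space.indep_vars M (\<lambda>_. count_space UNIV) (\<lambda>i \<omega>. card (\<Psi> \<omega> \<inter> B i)) {..<m})"

text \<open>The distance from the origin to the \<open>n\<close>-th nearest point (counting from 0), i.e. the least
  radius of a disc around the origin that contains more than \<open>n\<close> points.\<close>

definition ordered_dist :: "(real^2) set \<Rightarrow> nat \<Rightarrow> real" where
  "ordered_dist S n = Inf {t. 0 \<le> t \<and> n < card (S \<inter> cball 0 t)}"

section \<open>Generalized two-ray fading\<close>

text \<open>\<open>\<sigma>\<close> is the standard deviation of the diffuse components. Only the values of \<open>f\<close> on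
  \<open>[0, 2\<pi>]\<close> matter. If both specular amplitudes vanish then \<open>K = 0\<close> and, by the convention
  for division by zero, \<open>\<Delta> = 0\<close>.\<close>

definition gtr_fading ::
    "'w measure \<Rightarrow> real \<Rightarrow> real \<Rightarrow> real \<Rightarrow> (real \<Rightarrow> real) \<Rightarrow> ('w \<Rightarrow> complex) \<Rightarrow> bool" where
  "gtr_fading M K \<Delta> \<sigma> f g \<longleftrightarrow>
     g \<in> borel_measurable M \<and> 0 < \<sigma> \<and> (\<forall>a\<in>{0..2*pi}. 0 \<le> f a) \<and>
     (\<exists>V1 V2 \<phi>1 \<phi>2 X Y.
        0 \<le> V1 \<and> 0 \<le> V2 \<and>
        K = (V1\<^sup>2 + V2\<^sup>2) / (2 * \<sigma>\<^sup>2) \<and>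
        \<Delta> = 2 * V1 * V2 / (V1\<^sup>2 + V2\<^sup>2) \<and>
        \<phi>1 \<in> borel_measurable M \<and> \<phi>2 \<in> borel_measurable M \<and>
        distributed M lborel X (\<lambda>x. ennreal (normal_density 0 \<sigma> x)) \<and>
        distributed M lborel Y (\<lambda>x. ennreal (normal_density 0 \<sigma> x)) \<and>
        prob_space.indep_var M borel X borel Y \<and>
        prob_space.indep_var M borel (\<lambda>\<omega>. (X \<omega>, Y \<omega>)) borel (\<lambda>\<omega>. (\<phi>1 \<omega>, \<phi>2 \<omega>)) \<and>
        distributed M lborel (\<lambda>\<omega>. (\<phi>1 \<omega> - \<phi>2 \<omega>) rmod (2*pi))
          (\<lambda>a. ennreal (f a) * indicator {0..2*pi} a) \<and>
        (AE \<omega> in M. g \<omega> = of_real V1 * exp (\<i> * of_real (\<phi>1 \<omega>))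
           + of_real V2 * exp (\<i> * of_real (\<phi>2 \<omega>)) + Complex (X \<omega>) (Y \<omega>)))"

section \<open>The downlink network\<close>

locale downlink_network = prob_space M for M :: "'w measure" +
  fixes \<Psi> :: "'w \<Rightarrow> (real^2) set"
    and g :: "nat \<Rightarrow> 'w \<Rightarrow> complex"
    and lam \<eta> P N\<^sub>o :: real
    and K\<^sub>o \<Delta>\<^sub>o \<sigma>\<^sub>o :: real and f\<^sub>o :: "real \<Rightarrow> real"
    and K \<Delta> \<sigma> :: real and f :: "real \<Rightarrow> real"
  assumes lam_pos: "0 < lam" and path_loss: "2 < \<eta>" and P_pos: "0 < P" and noise_pos: "0 < N\<^sub>o"
    and ppp: "poisson_point_process M lam \<Psi>"
    and desired_gtr: "gtr_fading M K\<^sub>o \<Delta>\<^sub>o \<sigma>\<^sub>o f\<^sub>o (g 0)"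
    and interferer_gtr: "\<And>i. 1 \<le> i \<Longrightarrow> gtr_fading M K \<Delta> \<sigma> f (g i)"
    and interferer_ident: "\<And>i. 1 \<le> i \<Longrightarrow> distr M borel (g i) = distr M borel (g 1)"
    and fading_indep: "indep_vars (\<lambda>_. borel) g UNIV"
    and fading_indep_locations:
      "indep_set (sets (vimage_algebra (space M) \<Psi> config_space))
         (sets (vimage_algebra (space M) (\<lambda>\<omega> i. g i \<omega>) (Pi\<^sub>M UNIV (\<lambda>_::nat. borel))))"

definition serving_dist :: "('w \<Rightarrow> (real^2) set) \<Rightarrow> 'w \<Rightarrow> real" where
  "serving_dist \<Psi> \<omega> = ordered_dist (\<Psi> \<omega>) 0"

definition signal_power ::
    "('w \<Rightarrow> (real^2) set) \<Rightarrow> (nat \<Rightarrow> 'w \<Rightarrow> complex) \<Rightarrow> real \<Rightarrow> real \<Rightarrow> 'w \<Rightarrow> real" where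
  "signal_power \<Psi> g \<eta> P \<omega> = P * (cmod (g 0 \<omega>))\<^sup>2 * ordered_dist (\<Psi> \<omega>) 0 powr (-\<eta>)"

definition interference ::
    "('w \<Rightarrow> (real^2) set) \<Rightarrow> (nat \<Rightarrow> 'w \<Rightarrow> complex) \<Rightarrow> real \<Rightarrow> real \<Rightarrow> 'w \<Rightarrow> real" where
  "interference \<Psi> g \<eta> P \<omega> =
     (\<Sum>i. P * (cmod (g (Suc i) \<omega>))\<^sup>2 * ordered_dist (\<Psi> \<omega>) (Suc i) powr (-\<eta>))"

definition sinr ::
    "('w \<Rightarrow> (real^2) set) \<Rightarrow> (nat \<Rightarrow> 'w \<Rightarrow> complex) \<Rightarrow> real \<Rightarrow> real \<Rightarrow> real \<Rightarrow> 'w \<Rightarrow> real" where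
  "sinr \<Psi> g \<eta> P N\<^sub>o \<omega> = signal_power \<Psi> g \<eta> P \<omega> / (interference \<Psi> g \<eta> P \<omega> + N\<^sub>o)"

definition avg_spectral_efficiency ::
    "'w measure \<Rightarrow> ('w \<Rightarrow> (real^2) set) \<Rightarrow> (nat \<Rightarrow> 'w \<Rightarrow> complex) \<Rightarrow> real \<Rightarrow> real \<Rightarrow> real \<Rightarrow> real" where
  "avg_spectral_efficiency M \<Psi> g \<eta> P N\<^sub>o = (LINT \<omega>|M. ln (1 + sinr \<Psi> g \<eta> P N\<^sub>o \<omega>))"

definition serving_density :: "real \<Rightarrow> real \<Rightarrow> real" where
  "serving_density lam r = 2 * pi * lam * r * exp (- pi * lam * r\<^sup>2)"

section \<open>Conditional laws and Laplace transforms\<close>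

text \<open>\<open>\<kappa> r\<close> is a regular version of the conditional law of \<open>X\<close> given \<open>R = r\<close>. It is unique
  up to a null set of the law of \<open>R\<close>.\<close>

definition conditional_law ::
    "'w measure \<Rightarrow> ('w \<Rightarrow> real) \<Rightarrow> ('w \<Rightarrow> real) \<Rightarrow> (real \<Rightarrow> real measure) \<Rightarrow> bool" where
  "conditional_law M R X \<kappa> \<longleftrightarrow>
     \<kappa> \<in> measurable borel (prob_algebra borel) \<and>
     (\<forall>A\<in>sets borel. \<forall>B\<in>sets borel.
        emeasure M {\<omega>\<in>space M. R \<omega> \<in> A \<and> X \<omega> \<in> B} =
          (\<integral>\<^sup>+ r\<in>A. emeasure (\<kappa> r) B \<partial>(distr M borel R)))"

definition laplace :: "real measure \<Rightarrow> real \<Rightarrow> real" where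
  "laplace \<mu> s = (LINT x|\<mu>. exp (- s * x))"

section \<open>Special functions\<close>

definition hyp1F1 :: "real \<Rightarrow> real \<Rightarrow> real \<Rightarrow> real" where
  "hyp1F1 a b z = (\<Sum>n. pochhammer a n / pochhammer b n * z ^ n / fact n)"

definition lower_gamma :: "real \<Rightarrow> real \<Rightarrow> real" where
  "lower_gamma a x = (LBINT t:{0..x}. t powr (a - 1) * exp (-t))"

definition zeta1 :: "real \<Rightarrow> (real \<Rightarrow> real) \<Rightarrow> real \<Rightarrow> real" where
  "zeta1 \<Delta> f x = (LBINT \<alpha>:{0..2*pi}. exp (- x * (1 + \<Delta> * cos \<alpha>)) * f \<alpha>)"

definition zeta2 :: "real \<Rightarrow> real \<Rightarrow> real \<Rightarrow> (real \<Rightarrow> real) \<Rightarrow> real" where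
  "zeta2 \<eta> K \<Delta> f = (LBINT \<alpha>:{0..2*pi}. f \<alpha> *
     (hyp1F1 (1 - 2/\<eta>) 2 (- K * (1 + \<Delta> * cos \<alpha>))
      + K * (1 + \<Delta> * cos \<alpha>) * ((\<eta> + 2) / (2 * \<eta>))
        * hyp1F1 (1 - 2/\<eta>) 3 (- K * (1 + \<Delta> * cos \<alpha>))))"

text \<open>The weight \<open>(1 + \<Delta> cos \<alpha>) powr (2/\<eta>)\<close> comes from substituting
  \<open>u = x (1 + \<Delta> cos \<alpha>) (r/v) powr \<eta>\<close> in the integral of \<open>v\<^sup>2\<close> against the \<open>v\<close>-derivative of
  \<open>exp (-u)\<close> over \<open>v > r\<close>, for each fixed phase difference.\<close>

definition zeta3 :: "real \<Rightarrow> real \<Rightarrow> (real \<Rightarrow> real) \<Rightarrow> real \<Rightarrow> real" where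
  "zeta3 \<eta> \<Delta> f x = (LBINT \<alpha>:{0..2*pi}.
     (1 + \<Delta> * cos \<alpha>) powr (2/\<eta>) * lower_gamma (1 - 2/\<eta>) (x * (1 + \<Delta> * cos \<alpha>)) * f \<alpha>)"

definition y_zero :: "real \<Rightarrow> real \<Rightarrow> real \<Rightarrow> real \<Rightarrow> real \<Rightarrow> real" where
  "y_zero \<eta> P \<sigma> r s = 2 * \<sigma>\<^sup>2 * s * P / (r powr \<eta> + 2 * \<sigma>\<^sup>2 * s * P)"

end

theory Submission
  imports Defs
begin

text \<open>Let \<open>q(v)\<close> be the Laplace transform of an interferer's received power at distance \<open>v\<close>, as a
  function of the distance. The count of points in concentric rings is independent Poisson, so
  for a right-continuous weight \<open>u\<close> the product of \<open>u(r\<^sub>i)\<close> over the points in a disc has mean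
  \<open>exp (-\<lambda> \<integral> 2\<pi>v (1 - u(v)) dv)\<close>. Choosing \<open>u = q\<close> beyond \<open>a\<close> and \<open>0\<close> before \<open>a\<close> gives the mean of
  \<open>\<Prod>q(r\<^sub>i)\<close> on the event \<open>a \<le> r\<^sub>0\<close>; differentiating in \<open>a\<close> and dividing by \<open>q(r\<^sub>0)\<close> yields the law of
  \<open>r\<^sub>0\<close> together with the conditional transform \<open>exp (-\<lambda> \<integral>\<^bsub>v>r\<^esub> 2\<pi>v (1 - q(v)) dv)\<close> of the
  interference. The spectral efficiency follows from the Frullani-type identity
  \<open>ln (1 + x/(1 + y)) = \<integral> (1 - e\<^sup>-\<^sup>x\<^sup>z) e\<^sup>-\<^sup>y\<^sup>z e\<^sup>-\<^sup>z/z dz\<close>.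

  For two-ray fading \<open>1 - q(v)\<close> is the integral from \<open>0\<close> to \<open>y(v)\<close> of the derivative of
  \<open>1 - (1 - y) \<zeta>\<^sub>1(Ky)\<close>; exchanging this integral with the one over \<open>v\<close> produces (i), extending its
  range to \<open>[0, 1]\<close> and recognising Kummer's integral produces (ii), and the limit of the integrand,
  treated in the same way, produces (iii).\<close>

text \<open>Two default values shape the proof. The interference is a \<open>suminf\<close>,
  meaningful only where the series converges, which is not known at the start. So transforms are
  computed for partial sums, with exp(-infinity) = 0 in the divergent case, and almost sure
  convergence is read off afterwards by letting s tend to 0. The conditional laws are arbitrary
  versions, so identities for them hold only up to a null set of distances; to obtain one null set
  for all s, rational s come first and continuity in s does the rest. Dividing out the nearest point
  works because its weight is positive for r0 > 0 and occurs explicitly in the law obtained by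
  differentiation. On signs: the derivative of 1 - (1 - y) zeta1(K y) is zeta1(K y) - (1 - y) d/dy
  zeta1(K y), so the derivative integral enters the bracket of (i) with a minus sign. The boundary
  term in (iii) is r^2 (1 - zeta1), which vanishes as s tends to 0, as the logarithm of a Laplace
  transform must.\<close>

section \<open>Ordered distances of a locally finite configuration\<close>

text \<open>Local finiteness makes the infimum attained: only finitely many points have norm between
  t and t + 1, so a count of at most n at radius t persists a little beyond t. The hypothesis
  \<open>ex\<close> excludes the infimum of the empty set, an unspecified real.\<close>

lemma ordered_dist_le_iff:
  assumes fin: "\<And>B. bounded B \<Longrightarrow> finite (S \<inter> B)"
    and ex: "n < card (S \<inter> cball 0 t')" and "0 \<le> t"
  shows "ordered_dist S n \<le> t \<longleftrightarrow> n < card (S \<inter> cball 0 t)"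
proof
  have bdd: "bdd_below {t. 0 \<le> t \<and> n < card (S \<inter> cball 0 t)}"
    by (rule bdd_belowI[of _ 0]) auto
  show "ordered_dist S n \<le> t" if "n < card (S \<inter> cball 0 t)"
    unfolding ordered_dist_def using that assms(3) bdd by (intro cInf_lower) auto
  show "n < card (S \<inter> cball 0 t)" if le: "ordered_dist S n \<le> t"
  proof (rule ccontr)
    assume neg: "\<not> n < card (S \<inter> cball 0 t)"
    have t': "0 \<le> t'"
    proof (rule ccontr)
      assume "\<not> 0 \<le> t'"
      then have "cball 0 t' = ({}::(real^2) set)" by simp
      then show False using ex by simp
    qed
    \<comment> \<open>\<open>t + 1\<close> caps the window and keeps \<open>F\<close> nonempty; a
      ball of radius below \<open>Min F\<close> contains no more points than the ball of radius
      \<open>t\<close>.\<close>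
    define F where "F = insert (t + 1) (norm ` (S \<inter> cball 0 (t + 1) - cball 0 t))"
    have F: "finite F" "F \<noteq> {}" unfolding F_def using fin[OF bounded_cball, of 0 "t+1"] by auto
    have "t < Min F"
      using F by (subst Min_gr_iff) (auto simp: F_def)
    moreover have "Min F \<le> ordered_dist S n" unfolding ordered_dist_def
    proof (rule cInf_greatest)
      show "{t. 0 \<le> t \<and> n < card (S \<inter> cball 0 t)} \<noteq> {}" using ex t' by auto
      fix s assume s: "s \<in> {t. 0 \<le> t \<and> n < card (S \<inter> cball 0 t)}"
      show "Min F \<le> s"
      proof (rule ccontr)
        assume sF: "\<not> Min F \<le> s"
        have "S \<inter> cball 0 s \<subseteq> S \<inter> cball 0 t"
        proof
          fix x assume x: "x \<in> S \<inter> cball 0 s"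
          have "Min F \<le> t + 1" using F(1) by (intro Min_le) (auto simp: F_def)
          then have "norm x \<le> t + 1" using x sF by auto
          moreover have "norm x \<notin> F"
          proof
            assume "norm x \<in> F"
            then have "Min F \<le> norm x" using F(1) by (intro Min_le)
            then show False using x sF by auto
          qed
          ultimately show "x \<in> S \<inter> cball 0 t" using x by (auto simp: F_def image_iff)
        qed
        then have "card (S \<inter> cball 0 s) \<le> card (S \<inter> cball 0 t)"
          by (intro card_mono fin bounded_cball)
        then show False using s neg by auto
      qed
    qed
    ultimately show False using le by linarith
  qed
qed

lemma card_cball_mono:
  assumes fin: "\<And>B. bounded B \<Longrightarrow> finite (S \<inter> B)" and "s \<le> t"
  shows "card (S \<inter> cball (0::real^2) s) \<le> card (S \<inter> cball 0 t)"
  using assms(2) by (intro card_mono fin bounded_cball) auto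

lemma ordered_dist_nonneg:
  assumes ex: "n < card (S \<inter> cball 0 t')"
  shows "0 \<le> ordered_dist S n"
proof -
  have t': "0 \<le> t'"
  proof (rule ccontr)
    assume "\<not> 0 \<le> t'"
    then have "cball 0 t' = ({}::(real^2) set)" by simp
    then show False using ex by simp
  qed
  show ?thesis unfolding ordered_dist_def
    by (rule cInf_greatest) (use ex t' in auto)
qed

lemma ordered_dist_mono:
  assumes fin: "\<And>B. bounded B \<Longrightarrow> finite (S \<inter> B)"
    and ex: "n < card (S \<inter> cball 0 t')" and "m \<le> n"
  shows "ordered_dist S m \<le> ordered_dist S n"
proof -
  have "0 \<le> ordered_dist S n" by (rule ordered_dist_nonneg[OF ex])
  moreover from this have "n < card (S \<inter> cball 0 (ordered_dist S n))"
    using ordered_dist_le_iff[OF fin ex] by blast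
  ultimately show ?thesis
    using ordered_dist_le_iff[OF fin, of m t' "ordered_dist S n"] ex assms(3) by auto
qed

lemma card_ring:
  assumes fin: "\<And>B. bounded B \<Longrightarrow> finite (S \<inter> B)" and "s \<le> t"
  shows "card (S \<inter> (cball (0::real^2) t - cball 0 s)) = card (S \<inter> cball 0 t) - card (S \<inter> cball 0 s)"
proof -
  have "S \<inter> (cball 0 t - cball 0 s) = (S \<inter> cball 0 t) - (S \<inter> cball 0 s)" by auto
  moreover have "S \<inter> cball 0 s \<subseteq> S \<inter> cball 0 t" using assms(2) by auto
  ultimately show ?thesis using card_Diff_subset[OF fin[OF bounded_cball]] by metis
qed

text \<open>Rounding the distances up to the grid \<open>h\<nat>\<close> turns a product over points into a product over
  rings.\<close>

lemma prod_rounded_dist: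
  fixes u :: "real \<Rightarrow> real" and h :: real
  assumes fin: "\<And>B. bounded B \<Longrightarrow> finite (S \<inter> B)" and "0 < h"
    and N0: "card (S \<inter> cball (0::real^2) 0) = 0"
  shows "(\<Prod>i<card (S \<inter> cball 0 (real m * h)). u (\<lceil>ordered_dist S i / h\<rceil> * h)) =
    (\<Prod>j<m. u (real (Suc j) * h) ^ card (S \<inter> (cball 0 (real (Suc j) * h) - cball 0 (real j * h))))"
proof (induction m)
  case 0
  \<comment> \<open>A point at the origin would be rounded to 0 and lie in no ring;
    \<open>N0\<close> excludes it.\<close>
  then show ?case using N0 by simp
next
  case (Suc m)
  define N where "N j = card (S \<inter> cball (0::real^2) (real j * h))" for j
  have le: "real m * h \<le> real (Suc m) * h" using \<open>0 < h\<close> by simp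
  have N: "N m \<le> N (Suc m)" unfolding N_def using le by (intro card_cball_mono fin)
  have "{..<N (Suc m)} = {..<N m} \<union> {N m..<N (Suc m)}" using N by auto
  moreover have "{..<N m} \<inter> {N m..<N (Suc m)} = {}" by auto
  ultimately have "(\<Prod>i<N (Suc m). u (\<lceil>ordered_dist S i / h\<rceil> * h)) =
      (\<Prod>i<N m. u (\<lceil>ordered_dist S i / h\<rceil> * h)) * (\<Prod>i\<in>{N m..<N (Suc m)}. u (\<lceil>ordered_dist S i / h\<rceil> * h))"
    by (metis prod.union_disjoint finite_lessThan finite_atLeastLessThan)
  also have "(\<Prod>i\<in>{N m..<N (Suc m)}. u (\<lceil>ordered_dist S i / h\<rceil> * h)) =
      (\<Prod>i\<in>{N m..<N (Suc m)}. u (real (Suc m) * h))"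
  proof (rule prod.cong)
    fix i assume i: "i \<in> {N m..<N (Suc m)}"
    have ex: "i < card (S \<inter> cball 0 (real (Suc m) * h))" using i by (auto simp: N_def)
    have 1: "ordered_dist S i \<le> real (Suc m) * h"
      using ex ordered_dist_le_iff[OF fin ex, of "real (Suc m) * h"] \<open>0 < h\<close> by simp
    have 2: "\<not> ordered_dist S i \<le> real m * h"
      using ordered_dist_le_iff[OF fin ex, of "real m * h"] \<open>0 < h\<close> i by (auto simp: N_def)
    \<comment> \<open>An index in this range has its distance in (m h, (m + 1) h], whose upper end
      is the rounded value.\<close>
    have "\<lceil>ordered_dist S i / h\<rceil> = int (Suc m)"
      using 1 2 \<open>0 < h\<close> by (intro ceiling_unique) (auto simp: field_simps)
    then show "u (\<lceil>ordered_dist S i / h\<rceil> * h) = u (real (Suc m) * h)" by simp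
  qed simp
  also have "\<dots> = u (real (Suc m) * h) ^ card (S \<inter> (cball 0 (real (Suc m) * h) - cball 0 (real m * h)))"
    by (simp only: prod_constant card_atLeastLessThan card_ring[OF fin le] N_def)
  finally show ?case using Suc.IH unfolding N_def by simp
qed

section \<open>The probability generating functional\<close>

locale poisson_network = prob_space M for M :: "'w measure" +
  fixes \<Psi> :: "'w \<Rightarrow> (real^2) set" and lam :: real
  assumes lam_pos: "0 < lam" and ppp: "poisson_point_process M lam \<Psi>"
begin

lemma fin: "\<omega> \<in> space M \<Longrightarrow> bounded B \<Longrightarrow> finite (\<Psi> \<omega> \<inter> B)"
  using ppp unfolding poisson_point_process_def by blast

lemma count_measurable:
  "B \<in> sets borel \<Longrightarrow> bounded B \<Longrightarrow> (\<lambda>\<omega>. card (\<Psi> \<omega> \<inter> B)) \<in> measurable M (count_space UNIV)"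
  using ppp unfolding poisson_point_process_def by blast

lemma count_prob:
  "B \<in> sets borel \<Longrightarrow> bounded B \<Longrightarrow> prob {\<omega>\<in>space M. card (\<Psi> \<omega> \<inter> B) = n} =
     (lam * measure lborel B) ^ n / fact n * exp (- (lam * measure lborel B))"
  using ppp unfolding poisson_point_process_def by blast

lemma count_indep:
  fixes B :: "nat \<Rightarrow> (real^2) set"
  assumes "\<And>i. i < m \<Longrightarrow> B i \<in> sets borel \<and> bounded (B i)" "disjoint_family_on B {..<m}"
  shows "indep_vars (\<lambda>_. count_space UNIV) (\<lambda>i \<omega>. card (\<Psi> \<omega> \<inter> B i)) {..<m}"
proof -
  have *: "(\<forall>i<m. B i \<in> sets borel \<and> bounded (B i)) \<and> disjoint_family_on B {..<m}"
    using assms by simp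
  have "\<forall>(B :: nat \<Rightarrow> (real^2) set) m.
        (\<forall>i<m. B i \<in> sets borel \<and> bounded (B i)) \<and> disjoint_family_on B {..<m} \<longrightarrow>
        indep_vars (\<lambda>_. count_space UNIV) (\<lambda>i \<omega>. card (\<Psi> \<omega> \<inter> B i)) {..<m}"
    using ppp unfolding poisson_point_process_def by (elim conjE)
  from mp[OF spec[OF spec[OF this, of B], of m] *] show ?thesis .
qed

lemma count_pgf:
  assumes B: "B \<in> sets borel" "bounded B" and c: "0 \<le> c"
  shows "(\<integral>\<^sup>+\<omega>. ennreal (c ^ card (\<Psi> \<omega> \<inter> B)) \<partial>M) = ennreal (exp (- (lam * measure lborel B * (1 - c))))"
proof -
  define \<mu> where "\<mu> = lam * measure lborel B"
  have \<mu>: "0 \<le> \<mu>" unfolding \<mu>_def using lam_pos by simp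
  note [measurable] = count_measurable[OF B]
  have "(\<integral>\<^sup>+\<omega>. ennreal (c ^ card (\<Psi> \<omega> \<inter> B)) \<partial>M) =
      (\<integral>\<^sup>+\<omega>. (\<Sum>n. ennreal (c ^ n) * indicator {\<omega>\<in>space M. card (\<Psi> \<omega> \<inter> B) = n} \<omega>) \<partial>M)"
  proof (intro nn_integral_cong)
    fix \<omega> assume \<omega>: "\<omega> \<in> space M"
    have "(\<Sum>n. ennreal (c ^ n) * indicator {\<omega>\<in>space M. card (\<Psi> \<omega> \<inter> B) = n} \<omega>) =
      (\<Sum>n\<in>{card (\<Psi> \<omega> \<inter> B)}. ennreal (c ^ n) * indicator {\<omega>\<in>space M. card (\<Psi> \<omega> \<inter> B) = n} \<omega>)"
      by (intro suminf_finite) (auto simp: indicator_def)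
    then show "ennreal (c ^ card (\<Psi> \<omega> \<inter> B)) = (\<Sum>n. ennreal (c ^ n) * indicator {\<omega>\<in>space M. card (\<Psi> \<omega> \<inter> B) = n} \<omega>)"
      using \<omega> by simp
  qed
  also have "\<dots> = (\<Sum>n. \<integral>\<^sup>+\<omega>. ennreal (c ^ n) * indicator {\<omega>\<in>space M. card (\<Psi> \<omega> \<inter> B) = n} \<omega> \<partial>M)"
    by (intro nn_integral_suminf) measurable
  also have "\<dots> = (\<Sum>n. ennreal (c ^ n * (\<mu> ^ n / fact n * exp (- \<mu>))))"
  proof (intro suminf_cong)
    fix n
    have "(\<integral>\<^sup>+\<omega>. ennreal (c ^ n) * indicator {\<omega>\<in>space M. card (\<Psi> \<omega> \<inter> B) = n} \<omega> \<partial>M)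
       = ennreal (c ^ n) * emeasure M {\<omega>\<in>space M. card (\<Psi> \<omega> \<inter> B) = n}"
      by (intro nn_integral_cmult_indicator) measurable
    also have "\<dots> = ennreal (c ^ n * (\<mu> ^ n / fact n * exp (- \<mu>)))"
      using c \<mu> by (simp add: emeasure_eq_measure count_prob[OF B] flip: \<mu>_def ennreal_mult)
    finally show "(\<integral>\<^sup>+\<omega>. ennreal (c ^ n) * indicator {\<omega>\<in>space M. card (\<Psi> \<omega> \<inter> B) = n} \<omega> \<partial>M) = \<dots>" .
  qed
  also have "\<dots> = ennreal (exp (- (\<mu> * (1 - c))))"
  proof -
    have "(\<lambda>n. ((c * \<mu>) ^ n /\<^sub>R fact n) * exp (- \<mu>)) sums (exp (c * \<mu>) * exp (- \<mu>))"
      by (intro sums_mult2 exp_converges)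
    moreover have "((c * \<mu>) ^ n /\<^sub>R fact n) * exp (- \<mu>) = c ^ n * (\<mu> ^ n / fact n * exp (- \<mu>))" for n
      by (simp add: power_mult_distrib field_simps)
    moreover have "exp (c * \<mu>) * exp (- \<mu>) = exp (- (\<mu> * (1 - c)))"
      by (simp add: algebra_simps flip: exp_add)
    ultimately have "(\<lambda>n. c ^ n * (\<mu> ^ n / fact n * exp (- \<mu>))) sums (exp (- (\<mu> * (1 - c))))" by simp
    then show ?thesis using c \<mu> by (intro suminf_ennreal_eq) auto
  qed
  finally show ?thesis unfolding \<mu>_def .
qed

lemma content_cball_plane: "0 \<le> t \<Longrightarrow> measure lborel (cball (0::real^2) t) = pi * t\<^sup>2"
  by (simp add: content_cball unit_ball_vol_2)

lemma AE_no_point_at_origin: "AE \<omega> in M. card (\<Psi> \<omega> \<inter> cball 0 0) = 0"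
proof -
  note [measurable] = count_measurable[of "cball 0 0"]
  have "prob {\<omega>\<in>space M. card (\<Psi> \<omega> \<inter> cball 0 0) = 0} = 1"
    by (subst count_prob) (auto simp: content_cball_plane)
  from AE_prob_1[OF this] show ?thesis by (simp only: cball_trivial mem_Collect_eq) (auto elim: eventually_mono)
qed

text \<open>For fixed n the probability of at most n points in the ball of radius k is a polynomial
  in the mean times exp of minus the mean, and the mean lam pi k^2 is unbounded. Hence every
  \<open>ordered_dist\<close> is almost surely a genuine infimum.\<close>

lemma AE_count_unbounded: "AE \<omega> in M. \<forall>n. \<exists>k. n < card (\<Psi> \<omega> \<inter> cball 0 (real k))"
proof (subst AE_all_countable, intro allI)
  fix n
  have [measurable]: "(\<lambda>\<omega>. card (\<Psi> \<omega> \<inter> cball 0 (real k))) \<in> measurable M (count_space UNIV)" for k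
    by (intro count_measurable) auto
  let ?A = "{\<omega>\<in>space M. \<forall>k. card (\<Psi> \<omega> \<inter> cball 0 (real k)) \<le> n}"
  let ?b = "\<lambda>k. \<Sum>j\<le>n. (lam * (pi * (real k)\<^sup>2)) ^ j / fact j * exp (- (lam * (pi * (real k)\<^sup>2)))"
  have le: "prob ?A \<le> ?b k" for k
  proof -
    have "prob ?A \<le> prob (\<Union>j\<le>n. {\<omega>\<in>space M. card (\<Psi> \<omega> \<inter> cball 0 (real k)) = j})"
      by (intro finite_measure_mono) auto
    also have "\<dots> \<le> (\<Sum>j\<le>n. prob {\<omega>\<in>space M. card (\<Psi> \<omega> \<inter> cball 0 (real k)) = j})"
      by (intro finite_measure_subadditive_finite) auto
    also have "\<dots> = ?b k" by (intro sum.cong refl, subst count_prob) (auto simp: content_cball_plane)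
    finally show ?thesis .
  qed
  have lp: "0 < lam * pi" using lam_pos by simp
  have lim: "filterlim (\<lambda>k. lam * (pi * (real k)\<^sup>2)) at_top sequentially"
  proof -
    have "filterlim (\<lambda>k. lam * pi * (real k)\<^sup>2) at_top sequentially"
      by (intro filterlim_tendsto_pos_mult_at_top[OF tendsto_const lp] filterlim_pow_at_top filterlim_real_sequentially) simp
    then show ?thesis by (simp add: mult.assoc)
  qed
  have "?b \<longlonglongrightarrow> (\<Sum>j\<le>n. 0)"
  proof (intro tendsto_sum)
    fix j
    have "((\<lambda>x. x ^ j * exp (- x)) \<longlongrightarrow> (0::real)) at_top"
      using tendsto_power_div_exp_0[of j] by (simp add: exp_minus field_simps)
    from tendsto_mult_right[OF filterlim_compose[OF this lim], of "1 / fact j"]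
    show "(\<lambda>k. (lam * (pi * (real k)\<^sup>2)) ^ j / fact j * exp (- (lam * (pi * (real k)\<^sup>2)))) \<longlonglongrightarrow> 0"
      by (simp add: field_simps)
  qed
  then have "prob ?A \<le> 0" using le by (intro LIMSEQ_le_const[of ?b]) auto
  then have "emeasure M ?A = 0" using measure_nonneg[of M ?A] by (simp add: emeasure_eq_measure)
  then have "AE \<omega> in M. \<not> (\<forall>k. card (\<Psi> \<omega> \<inter> cball 0 (real k)) \<le> n)"
    by (subst AE_iff_measurable) auto
  then show "AE \<omega> in M. \<exists>k. n < card (\<Psi> \<omega> \<inter> cball 0 (real k))"
    by (auto simp: not_le)
qed

end

text \<open>The weighted means are computed only on tails [a, infinity) with a > 0. An open tail
  from x \<ge> 0 is the increasing union of the closed tails from x + 1/(n + 1), which reaches x =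
  0; for negative x the half-line without mass makes up the difference.\<close>

lemma measure_eqI_atLeast_pos:
  fixes M N :: "real measure"
  assumes sets: "sets M = sets borel" "sets N = sets borel"
    and M0: "emeasure M {..0} = 0" and N0: "emeasure N {..0} = 0"
    and eq: "\<And>a. 0 < a \<Longrightarrow> emeasure M {a..} = emeasure N {a..}"
    and fin: "\<And>a. 0 < a \<Longrightarrow> emeasure M {a..} \<le> 1"
  shows "M = N"
proof -
  have pos: "emeasure M {x<..} = emeasure N {x<..} \<and> emeasure M {x<..} \<le> 1" if "0 \<le> x" for x
  proof -
    have inc: "incseq (\<lambda>n. {x + 1 / real (Suc n)..})"
      by (rule incseq_SucI) (auto simp: frac_le elim!: order_trans[rotated])
    have U: "{x<..} = (\<Union>n. {x + 1 / real (Suc n)..})"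
    proof (intro set_eqI iffI)
      fix y assume "y \<in> {x<..}"
      then obtain n where "1 / real (Suc n) < y - x"
        using reals_Archimedean[of "y - x"] by (auto simp: inverse_eq_divide)
      then show "y \<in> (\<Union>n. {x + 1 / real (Suc n)..})" by (auto intro!: exI[of _ n])
    next
      fix y assume "y \<in> (\<Union>n. {x + 1 / real (Suc n)..})"
      then obtain n where "x + 1 / real (Suc n) \<le> y" by auto
      moreover have "0 < 1 / real (Suc n)" by simp
      ultimately have "x < y" by linarith
      then show "y \<in> {x<..}" by simp
    qed
    have p: "0 < x + 1 / real (Suc n)" for n using that by (simp add: add_nonneg_pos)
    have 1: "emeasure M {x<..} = (SUP n. emeasure M {x + 1 / real (Suc n)..})"
      unfolding U by (rule SUP_emeasure_incseq[symmetric, OF _ inc]) (auto simp: sets)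
    have 2: "emeasure N {x<..} = (SUP n. emeasure N {x + 1 / real (Suc n)..})"
      unfolding U by (rule SUP_emeasure_incseq[symmetric, OF _ inc]) (auto simp: sets)
    have "emeasure M {x + 1 / real (Suc n)..} = emeasure N {x + 1 / real (Suc n)..}" for n
      using eq p by blast
    then have "emeasure M {x<..} = emeasure N {x<..}" unfolding 1 2 by simp
    moreover have "emeasure M {x<..} \<le> 1" unfolding 1 by (rule SUP_least) (use fin p in blast)
    ultimately show ?thesis by simp
  qed
  have all: "emeasure M {x<..} = emeasure M {max 0 x<..} \<and> emeasure N {x<..} = emeasure N {max 0 x<..}" for x
  proof (cases "0 \<le> x")
    case False
    have "{x<..} = {0<..} \<union> {x<..0}" using False by auto
    moreover have "emeasure L ({0<..} \<union> {x<..0}) = emeasure L {0<..}"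
      if L: "sets L = sets borel" "emeasure L {..0} = 0" for L :: "real measure"
    proof (rule emeasure_Un_null_set)
      have "emeasure L {x<..0} \<le> emeasure L {..0}" by (rule emeasure_mono) (auto simp: L)
      then show "{x<..0} \<in> null_sets L" using L by (auto simp: null_sets_def)
    qed (auto simp: L)
    ultimately show ?thesis using False sets M0 N0 by (simp add: max_def)
  qed (simp add: max_def)
  show ?thesis
  proof (rule measure_eqI_lessThan[OF sets])
    fix x
    have "emeasure M {x<..} \<le> 1" using all[of x] pos[of "max 0 x"] by (metis max.cobounded1)
    then show "emeasure M {x<..} < \<infinity>" using ennreal_one_less_top by (metis order_le_less_trans infinity_ennreal_def)
    show "emeasure M {x<..} = emeasure N {x<..}" using all[of x] pos[of "max 0 x"] by simp
  qed
qed

text \<open>With \<open>c = lam * pi\<close> this is the mean number of points in the ring between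
  the radii a and b.\<close>

lemma LBINT_affine_ring:
  fixes c :: real
  assumes "a \<le> b"
  shows "(LBINT v:{a<..b}. 2 * c * v) = c * (b\<^sup>2 - a\<^sup>2)"
proof -
  have "(LBINT v:{a<..b}. 2 * c * v) = (LBINT v. (2 * c * v) * indicator {a..b} v)"
    unfolding set_lebesgue_integral_def
  proof (rule integral_cong_AE)
    show "AE v in lborel. indicat_real {a<..b} v *\<^sub>R (2 * c * v) = (2 * c * v) * indicator {a..b} v"
      using AE_lborel_singleton[of a] by eventually_elim (auto simp: indicator_def)
  qed auto
  also have "\<dots> = c * b\<^sup>2 - c * a\<^sup>2"
    by (rule integral_FTC_Icc_real[OF assms]) (auto intro!: derivative_eq_intros)
  finally show ?thesis by (simp add: algebra_simps)
qed

lemma set_integrable_bounded_Ioc: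
  fixes f :: "real \<Rightarrow> real"
  assumes [measurable]: "f \<in> borel_measurable borel" and "\<And>x. a < x \<Longrightarrow> x \<le> b \<Longrightarrow> \<bar>f x\<bar> \<le> B"
  shows "set_integrable lborel {a<..b} f"
  unfolding set_integrable_def
proof (rule integrableI_bounded_set[where A="{a<..b}" and B=B])
  show "AE x\<in>{a<..b} in lborel. norm (indicat_real {a<..b} x *\<^sub>R f x) \<le> B"
    using assms(2) by (auto simp: indicator_def)
  show "emeasure lborel {a<..b} < \<infinity>" by (cases "a \<le> b") auto
qed (auto simp: indicator_def)

text \<open>On each ring the rounded weight is constant, so the sum of ring exponents is exactly the
  integral of the rounded weight and not an approximation to it. The passage to mesh 0 is then
  dominated convergence on both sides of one identity.\<close>

lemma LBINT_rounded:
  fixes u :: "real \<Rightarrow> real" and h c :: real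
  assumes [measurable]: "u \<in> borel_measurable borel" and u: "\<And>v. 0 \<le> u v" "\<And>v. u v \<le> 1" and h: "0 < h"
  shows "(LBINT v:{0<..real m * h}. 2 * c * v * (1 - u (\<lceil>v / h\<rceil> * h))) =
    (\<Sum>j<m. c * ((real (Suc j) * h)\<^sup>2 - (real j * h)\<^sup>2) * (1 - u (real (Suc j) * h)))"
proof (induction m)
  case (Suc m)
  let ?F = "\<lambda>v. 2 * c * v * (1 - u (\<lceil>v / h\<rceil> * h))"
  have le: "real m * h \<le> real (Suc m) * h" using h by simp
  have bd: "\<bar>?F v\<bar> \<le> 2 * \<bar>c\<bar> * (real (Suc m) * h)" if "0 < v" "v \<le> real (Suc m) * h" for v
  proof -
    have "\<bar>?F v\<bar> = 2 * \<bar>c\<bar> * (v * (1 - u (\<lceil>v / h\<rceil> * h)))"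
      using u[of "\<lceil>v / h\<rceil> * h"] that by (simp add: abs_mult)
    also have "\<dots> \<le> 2 * \<bar>c\<bar> * (real (Suc m) * h * 1)"
      using u[of "\<lceil>v / h\<rceil> * h"] that by (intro mult_left_mono mult_mono) auto
    finally show ?thesis by simp
  qed
  have un: "{0<..real (Suc m) * h} = {0<..real m * h} \<union> {real m * h<..real (Suc m) * h}"
    using le h by (intro ivl_disj_un_two(6)[symmetric]) auto
  have "(LBINT v:{0<..real (Suc m) * h}. ?F v) =
      (LBINT v:{0<..real m * h}. ?F v) + (LBINT v:{real m * h<..real (Suc m) * h}. ?F v)"
    unfolding un
  proof (rule set_integral_Un)
    show "set_integrable lborel {0<..real m * h} ?F"
      by (rule set_integrable_bounded_Ioc[OF _ bd]) (use le in auto)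
    show "set_integrable lborel {real m * h<..real (Suc m) * h} ?F"
      using h by (intro set_integrable_bounded_Ioc[OF _ bd]) (auto elim: le_less_trans[rotated])
  qed auto
  also have "(LBINT v:{real m * h<..real (Suc m) * h}. ?F v) =
      (LBINT v:{real m * h<..real (Suc m) * h}. 2 * (c * (1 - u (real (Suc m) * h))) * v)"
  proof (rule set_lebesgue_integral_cong)
    show "\<forall>v. v \<in> {real m * h<..real (Suc m) * h} \<longrightarrow> ?F v = 2 * (c * (1 - u (real (Suc m) * h))) * v"
    proof (intro allI impI)
      fix v assume v: "v \<in> {real m * h<..real (Suc m) * h}"
      have "\<lceil>v / h\<rceil> = int (Suc m)" using v h by (intro ceiling_unique) (auto simp: field_simps)
      then show "?F v = 2 * (c * (1 - u (real (Suc m) * h))) * v" by simp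
    qed
  qed simp
  also have "\<dots> = c * (1 - u (real (Suc m) * h)) * ((real (Suc m) * h)\<^sup>2 - (real m * h)\<^sup>2)"
    by (rule LBINT_affine_ring[OF le])
  finally show ?case using Suc.IH by (simp only: sum.lessThan_Suc mult_ac)
qed (simp add: set_lebesgue_integral_def)

text \<open>Rounding up approaches v from the right, so right-continuity is enough. This admits a
  weight that jumps from 0 to \<open>q\<close> at the cutoff.\<close>

lemma rounding_tendsto:
  fixes u :: "real \<Rightarrow> real"
  assumes "continuous (at v within {v..}) u"
  shows "(\<lambda>n. u (\<lceil>v / (1 / real (Suc n))\<rceil> * (1 / real (Suc n)))) \<longlonglongrightarrow> u v"
proof -
  let ?s = "\<lambda>n. \<lceil>v / (1 / real (Suc n))\<rceil> * (1 / real (Suc n))"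
  have lo: "v \<le> ?s n" for n
  proof -
    have "v = v / (1 / real (Suc n)) * (1 / real (Suc n))" by simp
    also have "\<dots> \<le> ?s n" by (rule mult_right_mono[OF le_of_int_ceiling]) simp
    finally show ?thesis .
  qed
  have hi: "?s n \<le> v + 1 / real (Suc n)" for n
  proof -
    have "?s n \<le> (v / (1 / real (Suc n)) + 1) * (1 / real (Suc n))"
      by (rule mult_right_mono[OF of_int_ceiling_le_add_one]) simp
    then show ?thesis by (simp add: field_simps)
  qed
  have lim: "?s \<longlonglongrightarrow> v"
  proof (rule tendsto_sandwich)
    show "\<forall>\<^sub>F n in sequentially. v \<le> ?s n" by (intro always_eventually allI lo)
    show "\<forall>\<^sub>F n in sequentially. ?s n \<le> v + 1 / real (Suc n)" by (intro always_eventually allI hi)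
    show "(\<lambda>n. v + 1 / real (Suc n)) \<longlonglongrightarrow> v"
      using tendsto_add[OF tendsto_const lim_1_over_n[THEN LIMSEQ_Suc], of v] by simp
  qed simp
  have "\<forall>\<^sub>F n in sequentially. ?s n \<in> {v..}" using lo by auto
  from continuous_within_tendsto_compose[OF assms this lim] show ?thesis .
qed

section \<open>Measurability of the distances and the generating functional of the process\<close>

context poisson_network begin

text \<open>The sigma-algebra \<open>W\<close> is left open because it is also taken to be the one
  generated by \<Psi>, where independence of the fading is assumed. Where fewer than n + 1 points
  exist, the distance is the constant \<open>Inf {}\<close>, which the second disjunct
  handles.\<close>

lemma ordered_dist_measurable_wrt:
  assumes sp: "space W = space M"
    and cnt: "\<And>B. B \<in> sets borel \<Longrightarrow> bounded B \<Longrightarrow> (\<lambda>\<omega>. card (\<Psi> \<omega> \<inter> B)) \<in> measurable W (count_space UNIV)"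
  shows "(\<lambda>\<omega>. ordered_dist (\<Psi> \<omega>) n) \<in> borel_measurable W"
proof (rule borel_measurableI_le)
  fix a :: real
  note [measurable] = cnt[of "cball 0 t" for t, simplified]
  have eq: "ordered_dist (\<Psi> \<omega>) n \<le> a \<longleftrightarrow>
     (((\<exists>k::nat. n < card (\<Psi> \<omega> \<inter> cball 0 (real k))) \<and> 0 \<le> a \<and> n < card (\<Psi> \<omega> \<inter> cball 0 a)) \<or>
       (\<forall>k::nat. \<not> n < card (\<Psi> \<omega> \<inter> cball 0 (real k))) \<and> Inf {} \<le> a)" if \<omega>: "\<omega> \<in> space W" for \<omega>
  proof (cases "\<exists>k::nat. n < card (\<Psi> \<omega> \<inter> cball 0 (real k))")
    case True
    then obtain k where k: "n < card (\<Psi> \<omega> \<inter> cball 0 (real k))" by blast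
    show ?thesis
    proof (cases "0 \<le> a")
      case True
      then show ?thesis using ordered_dist_le_iff[OF fin k True] k \<omega> sp by auto
    next
      case False
      then show ?thesis using ordered_dist_nonneg[OF k] k by auto
    qed
  next
    case False
    have "{t. 0 \<le> t \<and> n < card (\<Psi> \<omega> \<inter> cball 0 t)} = {}"
    proof (rule ccontr)
      assume "{t. 0 \<le> t \<and> n < card (\<Psi> \<omega> \<inter> cball 0 t)} \<noteq> {}"
      then obtain t where t: "n < card (\<Psi> \<omega> \<inter> cball 0 t)" by auto
      have "t \<le> real (nat \<lceil>t\<rceil>)" by linarith
      then have "n < card (\<Psi> \<omega> \<inter> cball 0 (real (nat \<lceil>t\<rceil>)))"
        using \<omega> sp by (intro order_less_le_trans[OF t card_cball_mono] fin) auto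
      then show False using False by blast
    qed
    then have "ordered_dist (\<Psi> \<omega>) n = Inf {}" unfolding ordered_dist_def by (rule arg_cong)
    then show ?thesis using False by (simp only:) blast
  qed
  have "{\<omega> \<in> space W. ordered_dist (\<Psi> \<omega>) n \<le> a} = {\<omega>\<in>space W.
     (((\<exists>k::nat. n < card (\<Psi> \<omega> \<inter> cball 0 (real k))) \<and> 0 \<le> a \<and> n < card (\<Psi> \<omega> \<inter> cball 0 a)) \<or>
       (\<forall>k::nat. \<not> n < card (\<Psi> \<omega> \<inter> cball 0 (real k))) \<and> Inf {} \<le> a)}"
    using eq by blast
  also have "\<dots> \<in> sets W" by measurable
  finally show "{\<omega> \<in> space W. ordered_dist (\<Psi> \<omega>) n \<le> a} \<in> sets W" .
qed

lemma ordered_dist_measurable [measurable]: "(\<lambda>\<omega>. ordered_dist (\<Psi> \<omega>) n) \<in> borel_measurable M"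
  by (rule ordered_dist_measurable_wrt[OF refl count_measurable])

lemma count_cball_measurable [measurable]:
  "(\<lambda>\<omega>. card (\<Psi> \<omega> \<inter> cball 0 t)) \<in> measurable M (count_space UNIV)"
  by (rule count_measurable) auto

lemma AE_ordered_dist:
  "AE \<omega> in M. (\<forall>n. 0 < ordered_dist (\<Psi> \<omega>) n \<and> ordered_dist (\<Psi> \<omega>) 0 \<le> ordered_dist (\<Psi> \<omega>) n)"
  using AE_count_unbounded AE_no_point_at_origin AE_space
proof eventually_elim
  case (elim \<omega>)
  show ?case
  proof
    fix n
    obtain k :: nat where k: "n < card (\<Psi> \<omega> \<inter> cball 0 (real k))" using elim by blast
    have "\<not> ordered_dist (\<Psi> \<omega>) n \<le> 0"
      using ordered_dist_le_iff[OF fin k, of 0] elim by auto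
    then show "0 < ordered_dist (\<Psi> \<omega>) n \<and> ordered_dist (\<Psi> \<omega>) 0 \<le> ordered_dist (\<Psi> \<omega>) n"
      using ordered_dist_mono[OF fin k, of 0] elim by auto
  qed
qed

text \<open>At mesh h nothing is approximated: the ring counts are independent, each contributes a
  factor from \<open>count_pgf\<close>, and the exponents add up by
  \<open>LBINT_rounded\<close>.\<close>

lemma pgfl_rounded:
  fixes u :: "real \<Rightarrow> real" and h :: real
  assumes um [measurable]: "u \<in> borel_measurable borel" and u: "\<And>v. 0 \<le> u v" "\<And>v. u v \<le> 1" and h: "0 < h"
  shows "(\<integral>\<^sup>+\<omega>. ennreal (\<Prod>i<card (\<Psi> \<omega> \<inter> cball 0 (real m * h)). u (\<lceil>ordered_dist (\<Psi> \<omega>) i / h\<rceil> * h)) \<partial>M) =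
    ennreal (exp (- (LBINT v:{0<..real m * h}. 2 * (lam * pi) * v * (1 - u (\<lceil>v / h\<rceil> * h)))))"
proof -
  define B :: "nat \<Rightarrow> (real^2) set" where "B j = cball 0 (real (Suc j) * h) - cball 0 (real j * h)" for j
  define c where "c j = u (real (Suc j) * h)" for j
  have B: "B j \<in> sets borel" "bounded (B j)" for j
    unfolding B_def by (auto intro: bounded_subset[OF bounded_cball])
  have mono: "real i * h \<le> real j * h" if "i \<le> j" for i j using that h by simp
  have disj: "B i \<inter> B j = {}" if "i < j" for i j
    using mono[of "Suc i" j] that unfolding B_def by force
  have disjB: "disjoint_family_on B {..<m}"
    unfolding disjoint_family_on_def using disj by (metis Int_commute linorder_neqE_nat)
  have vol: "measure lborel (B j) = pi * ((real (Suc j) * h)\<^sup>2 - (real j * h)\<^sup>2)" for j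
  proof -
    have "measure lborel (B j) = measure lborel (cball (0::real^2) (real (Suc j) * h)) - measure lborel (cball (0::real^2) (real j * h))"
      unfolding B_def
    proof (rule measure_Diff)
      show "cball (0::real^2) (real j * h) \<subseteq> cball 0 (real (Suc j) * h)"
        using mono[of j "Suc j"] by (intro subset_cball) simp
      show "emeasure lborel (cball (0::real^2) (real (Suc j) * h)) \<noteq> \<infinity>"
        using emeasure_lborel_cball_finite[of "0::real^2" "real (Suc j) * h"] by (metis less_irrefl)
    qed auto
    then show ?thesis using h by (simp add: content_cball_plane algebra_simps del: of_nat_Suc)
  qed
  have "(\<integral>\<^sup>+\<omega>. ennreal (\<Prod>i<card (\<Psi> \<omega> \<inter> cball 0 (real m * h)). u (\<lceil>ordered_dist (\<Psi> \<omega>) i / h\<rceil> * h)) \<partial>M)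
      = (\<integral>\<^sup>+\<omega>. (\<Prod>j<m. ennreal (c j ^ card (\<Psi> \<omega> \<inter> B j))) \<partial>M)"
  proof (rule nn_integral_cong_AE)
    show "AE \<omega> in M. ennreal (\<Prod>i<card (\<Psi> \<omega> \<inter> cball 0 (real m * h)). u (\<lceil>ordered_dist (\<Psi> \<omega>) i / h\<rceil> * h)) =
        (\<Prod>j<m. ennreal (c j ^ card (\<Psi> \<omega> \<inter> B j)))"
    using AE_no_point_at_origin AE_space
  proof eventually_elim
    case (elim \<omega>)
    show ?case
      unfolding c_def B_def using prod_rounded_dist[OF fin h, where m=m and u=u] elim u(1)
      by (subst prod_ennreal) (auto simp del: of_nat_Suc)
  qed
  qed
  also have "\<dots> = (\<Prod>j<m. \<integral>\<^sup>+\<omega>. ennreal (c j ^ card (\<Psi> \<omega> \<inter> B j)) \<partial>M)"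
    by (intro indep_vars_nn_integral indep_vars_compose2[OF count_indep[of m B]])
      (use B disjB in auto)
  also have "\<dots> = (\<Prod>j<m. ennreal (exp (- (lam * measure lborel (B j) * (1 - c j)))))"
    by (intro prod.cong refl count_pgf B) (simp add: c_def u)
  also have "\<dots> = ennreal (exp (- (\<Sum>j<m. lam * measure lborel (B j) * (1 - c j))))"
    by (subst prod_ennreal) (auto simp: exp_sum sum_negf[symmetric])
  also have "(\<Sum>j<m. lam * measure lborel (B j) * (1 - c j)) =
     (LBINT v:{0<..real m * h}. 2 * (lam * pi) * v * (1 - u (\<lceil>v / h\<rceil> * h)))"
    by (subst LBINT_rounded[OF um u h]) (simp_all only: vol c_def mult_ac)
  finally show ?thesis .
qed

lemma measurable_prod_count [measurable]:
  fixes u :: "nat \<Rightarrow> real \<Rightarrow> real"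
  assumes [measurable]: "\<And>i. u i \<in> borel_measurable borel"
  shows "(\<lambda>\<omega>. \<Prod>i<card (\<Psi> \<omega> \<inter> cball 0 t). u i (ordered_dist (\<Psi> \<omega>) i)) \<in> borel_measurable M"
  by (rule measurable_compose_countable[where g="\<lambda>\<omega>. card (\<Psi> \<omega> \<inter> cball 0 t)"]) auto

lemma pgfl:
  fixes u :: "real \<Rightarrow> real" and k :: nat
  assumes um [measurable]: "u \<in> borel_measurable borel" and u: "\<And>v. 0 \<le> u v" "\<And>v. u v \<le> 1"
    and rc: "\<And>v. 0 < v \<Longrightarrow> continuous (at v within {v..}) u"
  shows "(\<integral>\<^sup>+\<omega>. ennreal (\<Prod>i<card (\<Psi> \<omega> \<inter> cball 0 (real k)). u (ordered_dist (\<Psi> \<omega>) i)) \<partial>M) =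
    ennreal (exp (- (LBINT v:{0<..real k}. 2 * (lam * pi) * v * (1 - u v))))"
proof -
  define s where "s n v = u (\<lceil>v / (1 / real (Suc n))\<rceil> * (1 / real (Suc n)))" for n v
  have sm [measurable]: "s n \<in> borel_measurable borel" for n unfolding s_def by measurable
  have s: "0 \<le> s n v" "s n v \<le> 1" for n v unfolding s_def by (rule u)+
  have lim: "(\<lambda>n. s n v) \<longlonglongrightarrow> u v" if "0 < v" for v
    unfolding s_def by (rule rounding_tendsto[OF rc[OF that]])
  have eq: "(\<integral>\<^sup>+\<omega>. ennreal (\<Prod>i<card (\<Psi> \<omega> \<inter> cball 0 (real k)). s n (ordered_dist (\<Psi> \<omega>) i)) \<partial>M) =
    ennreal (exp (- (LBINT v:{0<..real k}. 2 * (lam * pi) * v * (1 - s n v))))" for n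
  proof -
    \<comment> \<open>The mesh 1/(n + 1) divides every natural number, so the disc of radius k
      consists of exactly k (n + 1) rings for each n.\<close>
    have "real (k * Suc n) * (1 / real (Suc n)) = real k" by (simp add: field_simps)
    from pgfl_rounded[OF um u, of "1 / real (Suc n)" "k * Suc n", unfolded this]
    show ?thesis unfolding s_def by simp
  qed
  have 1: "(\<lambda>n. \<integral>\<^sup>+\<omega>. ennreal (\<Prod>i<card (\<Psi> \<omega> \<inter> cball 0 (real k)). s n (ordered_dist (\<Psi> \<omega>) i)) \<partial>M)
     \<longlonglongrightarrow> (\<integral>\<^sup>+\<omega>. ennreal (\<Prod>i<card (\<Psi> \<omega> \<inter> cball 0 (real k)). u (ordered_dist (\<Psi> \<omega>) i)) \<partial>M)"
  proof (rule nn_integral_dominated_convergence[where w="\<lambda>_. 1"])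
    fix n
    show "AE \<omega> in M. ennreal (\<Prod>i<card (\<Psi> \<omega> \<inter> cball 0 (real k)). s n (ordered_dist (\<Psi> \<omega>) i)) \<le> 1"
      using s by (auto intro!: prod_le_1 simp: ennreal_le_1)
  next
    show "AE \<omega> in M. (\<lambda>n. ennreal (\<Prod>i<card (\<Psi> \<omega> \<inter> cball 0 (real k)). s n (ordered_dist (\<Psi> \<omega>) i)))
       \<longlonglongrightarrow> ennreal (\<Prod>i<card (\<Psi> \<omega> \<inter> cball 0 (real k)). u (ordered_dist (\<Psi> \<omega>) i))"
      using AE_ordered_dist by eventually_elim (auto intro!: tendsto_ennrealI tendsto_prod lim)
  qed (auto simp: emeasure_space_1)
  have 2: "(\<lambda>n. LBINT v:{0<..real k}. 2 * (lam * pi) * v * (1 - s n v)) \<longlonglongrightarrow>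
     (LBINT v:{0<..real k}. 2 * (lam * pi) * v * (1 - u v))"
    unfolding set_lebesgue_integral_def
  proof (rule integral_dominated_convergence[where w="\<lambda>v. indicator {0<..real k} v *\<^sub>R (2 * (lam * pi) * real k)"])
    show "integrable lborel (\<lambda>v. indicator {0<..real k} v *\<^sub>R (2 * (lam * pi) * real k))"
      using set_integrable_bounded_Ioc[of "\<lambda>_. 2 * (lam * pi) * real k" 0 k "\<bar>2 * (lam * pi) * real k\<bar>"]
      unfolding set_integrable_def by simp
    show "AE v in lborel. (\<lambda>n. indicator {0<..real k} v *\<^sub>R (2 * (lam * pi) * v * (1 - s n v))) \<longlonglongrightarrow>
       indicator {0<..real k} v *\<^sub>R (2 * (lam * pi) * v * (1 - u v))"
      by (auto intro!: tendsto_intros lim split: split_indicator)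
    fix n
    show "AE v in lborel. norm (indicat_real {0<..real k} v *\<^sub>R (2 * (lam * pi) * v * (1 - s n v)))
       \<le> indicator {0<..real k} v *\<^sub>R (2 * (lam * pi) * real k)"
    proof (intro AE_I2)
      fix v
      have "v * (1 - s n v) \<le> real k * 1" if "0 < v" "v \<le> real k"
        using that s[of n v] by (intro mult_mono) auto
      then have "lam * pi * 2 * (v * (1 - s n v)) \<le> lam * pi * 2 * (real k * 1)" if "0 < v" "v \<le> real k"
        using that lam_pos by (intro mult_left_mono) auto
      then show "norm (indicat_real {0<..real k} v *\<^sub>R (2 * (lam * pi) * v * (1 - s n v)))
         \<le> indicator {0<..real k} v *\<^sub>R (2 * (lam * pi) * real k)"
        using s[of n v] lam_pos by (auto simp: indicator_def abs_mult algebra_simps)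
    qed
  qed auto
  have "(\<lambda>n. ennreal (exp (- (LBINT v:{0<..real k}. 2 * (lam * pi) * v * (1 - s n v)))))
     \<longlonglongrightarrow> ennreal (exp (- (LBINT v:{0<..real k}. 2 * (lam * pi) * v * (1 - u v))))"
    by (intro tendsto_intros 2)
  with 1[unfolded eq] show ?thesis by (rule LIMSEQ_unique)
qed

end

section \<open>Product weights and the law of the nearest distance\<close>

definition interference_exponent :: "real \<Rightarrow> (real \<Rightarrow> real) \<Rightarrow> real \<Rightarrow> real" where
  "interference_exponent lam q r = (LBINT v:{r..}. 2 * pi * lam * v * (1 - q v))"

lemma measurable_interference_exponent [measurable]:
  assumes [measurable]: "q \<in> borel_measurable borel"
  shows "interference_exponent lam q \<in> borel_measurable borel"
proof -
  have "(\<lambda>(r, v). (if r \<le> v then 2 * pi * lam * v * (1 - q v) else 0)) \<in> borel_measurable (borel \<Otimes>\<^sub>M lborel)"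
    by measurable
  from lborel.borel_measurable_lebesgue_integral[OF this]
  have "(\<lambda>r. LBINT v. (if r \<le> v then 2 * pi * lam * v * (1 - q v) else 0)) \<in> borel_measurable borel"
    by simp
  also have "(\<lambda>r. LBINT v. (if r \<le> v then 2 * pi * lam * v * (1 - q v) else 0)) = interference_exponent lam q"
    by (auto simp: interference_exponent_def set_lebesgue_integral_def fun_eq_iff intro!: Bochner_Integration.integral_cong split: split_indicator)
  finally show ?thesis .
qed

text \<open>\<open>q v\<close> is the weight of a point at distance \<open>v\<close>.\<close>

locale point_weight =
  fixes lam :: real and q :: "real \<Rightarrow> real"
  assumes lam_pos': "0 < lam"
    and q_measurable [measurable]: "q \<in> borel_measurable borel"
    and q_nonneg: "\<And>v. 0 \<le> q v" and q_le_1: "\<And>v. q v \<le> 1"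
    and q_pos: "\<And>v. 0 < v \<Longrightarrow> 0 < q v"
    and q_cont: "\<And>v. 0 < v \<Longrightarrow> isCont q v"
    and q_tail: "\<And>a. 0 < a \<Longrightarrow> set_integrable lborel {a..} (\<lambda>v. v * (1 - q v))"
begin

abbreviation "ring_rate v \<equiv> 2 * pi * lam * v * (1 - q v)"

lemma ring_rate_integrable: "0 < a \<Longrightarrow> set_integrable lborel {a..} ring_rate"
  using set_integrable_mult_right[of "2 * pi * lam", OF q_tail] by (simp only: mult.assoc)

lemma ring_rate_nonneg: "0 \<le> v \<Longrightarrow> 0 \<le> ring_rate v"
  using q_le_1[of v] lam_pos' by simp

lemma interference_exponent_nonneg: "0 \<le> r \<Longrightarrow> 0 \<le> interference_exponent lam q r"
  unfolding interference_exponent_def set_lebesgue_integral_def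
  using ring_rate_nonneg by (intro integral_nonneg_AE AE_I2) (auto simp: indicator_def)

lemma interference_exponent_deriv:
  assumes a: "0 < a"
  shows "(interference_exponent lam q has_real_derivative - ring_rate a) (at a)"
proof -
  let ?L = "interference_exponent lam q"
  \<comment> \<open>The tail integral is anchored at a/2: this stays away from 0, where nothing is
    known about continuity of \<open>q\<close>, and puts a in the interior of [a/2, 2a].\<close>
  let ?I = "\<lambda>x. integral {a / 2..x} ring_rate"
  have cont: "continuous_on {a / 2..2 * a} ring_rate"
    using q_cont a by (intro continuous_at_imp_continuous_on ballI continuous_intros) auto
  have "(?I has_real_derivative ring_rate a) (at a within {a / 2..2 * a})"
    using a by (intro integral_has_real_derivative cont) auto
  then have "(?I has_real_derivative ring_rate a) (at a)"
    using a by (simp add: at_within_Icc_at)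
  then have "((\<lambda>x. ?L (a / 2) - ?I x) has_real_derivative - ring_rate a) (at a)"
    by (auto intro!: derivative_eq_intros)
  then show ?thesis
  proof (rule DERIV_cong_ev[OF refl _ refl, THEN iffD1, rotated])
    have ev: "\<forall>\<^sub>F x in nhds a. x \<in> {a / 2<..}" using a by (intro eventually_nhds_in_open) auto
    then show "\<forall>\<^sub>F x in nhds a. ?L (a / 2) - ?I x = ?L x"
    proof eventually_elim
      fix x assume x: "x \<in> {a / 2<..}"
      have un: "{a / 2..} = {a / 2..<x} \<union> {x..}" using x by auto
      have i1: "set_integrable lborel {a / 2..} ring_rate" using a by (intro ring_rate_integrable) auto
      have "?L (a / 2) = (LBINT v:{a / 2..<x}. ring_rate v) + ?L x"
        unfolding interference_exponent_def un
        by (rule set_integral_Un) (use x in \<open>auto intro: set_integrable_subset[OF i1]\<close>)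
      also have "(LBINT v:{a / 2..<x}. ring_rate v) = (LBINT v:{a / 2..x}. ring_rate v)"
        unfolding set_lebesgue_integral_def
      proof (rule integral_cong_AE)
        show "AE v in lborel. indicat_real {a / 2..<x} v *\<^sub>R ring_rate v = indicat_real {a / 2..x} v *\<^sub>R ring_rate v"
          using AE_lborel_singleton[of x] by eventually_elim (auto simp: indicator_def)
      qed auto
      also have "\<dots> = ?I x"
        by (intro set_borel_integral_eq_integral(2) set_integrable_subset[OF i1]) auto
      finally show "?L (a / 2) - ?I x = ?L x" by simp
    qed
  qed
qed

end

locale weighted_poisson_network = poisson_network M \<Psi> lam + point_weight lam q
  for M :: "'w measure" and \<Psi> lam q
begin

text \<open>The infinite product of the weights. It is a limit of decreasing partial products
  because the value 0 must be allowed, and a product tending to 0 does not count as a convergent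
  infinite product.\<close>

definition total_weight :: "'w \<Rightarrow> real" where
  "total_weight \<omega> = lim (\<lambda>n. \<Prod>i<n. q (ordered_dist (\<Psi> \<omega>) i))"

lemma partial_weight_tendsto: "(\<lambda>n. \<Prod>i<n. q (ordered_dist (\<Psi> \<omega>) i)) \<longlonglongrightarrow> total_weight \<omega>"
proof -
  have "decseq (\<lambda>n. \<Prod>i<n. q (ordered_dist (\<Psi> \<omega>) i))"
    using q_nonneg q_le_1 by (intro decseq_SucI) (auto intro!: mult_left_le prod_nonneg)
  then have "convergent (\<lambda>n. \<Prod>i<n. q (ordered_dist (\<Psi> \<omega>) i))"
    using q_nonneg by (elim decseq_convergent[where B=0]) (auto simp: convergent_def intro!: prod_nonneg)
  then show ?thesis unfolding total_weight_def by (simp add: convergent_LIMSEQ_iff)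
qed

lemma total_weight_measurable [measurable]: "total_weight \<in> borel_measurable M"
  by (rule borel_measurable_LIMSEQ_real[OF partial_weight_tendsto]) measurable

lemma total_weight_nonneg: "0 \<le> total_weight \<omega>"
  by (rule LIMSEQ_le_const[OF partial_weight_tendsto]) (auto intro!: prod_nonneg q_nonneg)

lemma count_tendsto_infinity:
  "AE \<omega> in M. filterlim (\<lambda>k. card (\<Psi> \<omega> \<inter> cball 0 (real k))) at_top sequentially"
  using AE_count_unbounded AE_space
proof eventually_elim
  case (elim \<omega>)
  show ?case unfolding filterlim_at_top
  proof
    fix Z
    obtain k where k: "Z < card (\<Psi> \<omega> \<inter> cball 0 (real k))" using elim by blast
    have "Z \<le> card (\<Psi> \<omega> \<inter> cball 0 (real j))" if "k \<le> j" for j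
      using k card_cball_mono[of "\<Psi> \<omega>" "real k" "real j"] fin[OF elim(2)] that by fastforce
    then show "\<forall>\<^sub>F j in sequentially. Z \<le> card (\<Psi> \<omega> \<inter> cball 0 (real j))"
      by (auto simp: eventually_sequentially)
  qed
qed

text \<open>The event \<open>a \<le> r\<^sub>0\<close> is encoded by giving weight 0 to the points closer than \<open>a\<close>.\<close>

lemma nn_integral_total_weight_tail:
  assumes a: "0 < a"
  shows "(\<integral>\<^sup>+\<omega>. indicator {a..} (ordered_dist (\<Psi> \<omega>) 0) * ennreal (total_weight \<omega>) \<partial>M) =
    ennreal (exp (- (pi * lam * a\<^sup>2 + interference_exponent lam q a)))"
proof -
  define u where "u v = indicator {a..} v * q v" for v
  have u_le [measurable]: "u \<in> borel_measurable borel" unfolding u_def by measurable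
  have u: "0 \<le> u v" "u v \<le> 1" for v using q_nonneg q_le_1 by (auto simp: u_def indicator_def)
  \<comment> \<open>The cutoff keeps the point a itself, so the jump of \<open>u\<close> at a is
    continuous from the right.\<close>
  have rc: "continuous (at v within {v..}) u" if v: "0 < v" for v
  proof (cases "a \<le> v")
    case True
    have "continuous (at v within {v..}) q" using q_cont[OF v] by (rule continuous_at_imp_continuous_at_within)
    then show ?thesis
      by (rule continuous_transform_within[where \<delta>=1]) (use True in \<open>auto simp: u_def\<close>)
  next
    case False
    have "continuous (at v within {v..}) (\<lambda>_. 0::real)" by simp
    then show ?thesis
      by (rule continuous_transform_within[where \<delta>="a - v"])
        (use False in \<open>auto simp: u_def indicator_def dist_real_def\<close>)
  qed
  let ?F = "\<lambda>v. 2 * (lam * pi) * v * (1 - u v)"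
  have un: "{0<..} = {0<..<a} \<union> {a..}" using a by auto
  have F1: "set_integrable lborel {0<..<a} ?F"
  proof (rule set_integrable_subset)
    show "set_integrable lborel {0<..a} ?F"
    proof (rule set_integrable_bounded_Ioc[where B="2 * (lam * pi) * a"])
      fix v assume v: "0 < v" "v \<le> a"
      have "v * (1 - u v) \<le> a * 1" using v u[of v] by (intro mult_mono) auto
      then have "2 * (lam * pi) * (v * (1 - u v)) \<le> 2 * (lam * pi) * (a * 1)"
        using lam_pos by (intro mult_left_mono) auto
      then show "\<bar>?F v\<bar> \<le> 2 * (lam * pi) * a" using v u[of v] lam_pos by (simp add: abs_mult mult.assoc)
    qed auto
  qed auto
  have F2: "set_integrable lborel {a..} ?F"
    using ring_rate_integrable[OF a]
    by (rule set_integrable_cong[OF refl refl, THEN iffD1, rotated]) (auto simp: u_def)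
  have F: "set_integrable lborel {0<..} ?F" unfolding un by (intro set_integrable_Un F1 F2) auto
  \<comment> \<open>Below a the weight is 0 and the integral is the mean count pi lam a^2, the
    exponent of the void probability; beyond a it is the exponent of the interference.\<close>
  have IF: "(LBINT v:{0<..}. ?F v) = pi * lam * a\<^sup>2 + interference_exponent lam q a"
  proof -
    have "(LBINT v:{0<..}. ?F v) = (LBINT v:{0<..<a}. ?F v) + (LBINT v:{a..}. ?F v)"
      unfolding un by (rule set_integral_Un[OF _ F1 F2]) auto
    also have "(LBINT v:{a..}. ?F v) = interference_exponent lam q a"
      unfolding interference_exponent_def by (rule set_lebesgue_integral_cong) (auto simp: u_def)
    also have "(LBINT v:{0<..<a}. ?F v) = (LBINT v:{0<..a}. 2 * (lam * pi) * v)"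
      unfolding set_lebesgue_integral_def
    proof (rule integral_cong_AE)
      show "AE v in lborel. indicat_real {0<..<a} v *\<^sub>R ?F v = indicat_real {0<..a} v *\<^sub>R (2 * (lam * pi) * v)"
        using AE_lborel_singleton[of a] by eventually_elim (auto simp: indicator_def u_def)
    qed auto
    also have "\<dots> = pi * lam * a\<^sup>2" using a by (subst LBINT_affine_ring) auto
    finally show ?thesis .
  qed
  have lim2: "(\<lambda>k. LBINT v:{0<..real k}. ?F v) \<longlonglongrightarrow> (LBINT v:{0<..}. ?F v)"
    unfolding set_lebesgue_integral_def
  proof (rule integral_dominated_convergence[where w="\<lambda>v. indicator {0<..} v *\<^sub>R ?F v"])
    show "integrable lborel (\<lambda>v. indicat_real {0<..} v *\<^sub>R ?F v)" using F by (simp add: set_integrable_def)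
    show "AE v in lborel. (\<lambda>k. indicat_real {0<..real k} v *\<^sub>R ?F v) \<longlonglongrightarrow> indicat_real {0<..} v *\<^sub>R ?F v"
    proof (intro AE_I2 tendsto_eventually)
      fix v :: real
      obtain n :: nat where "v \<le> real n" using real_arch_simple by blast
      then show "\<forall>\<^sub>F k in sequentially. indicat_real {0<..real k} v *\<^sub>R ?F v = indicat_real {0<..} v *\<^sub>R ?F v"
        by (intro eventually_sequentiallyI[of n]) (auto simp: indicator_def)
    qed
    fix k :: nat
    show "AE v in lborel. norm (indicat_real {0<..real k} v *\<^sub>R ?F v) \<le> indicat_real {0<..} v *\<^sub>R ?F v"
      using u lam_pos by (auto simp: indicator_def)
  qed auto
  have 1: "(\<lambda>k. \<integral>\<^sup>+\<omega>. ennreal (\<Prod>i<card (\<Psi> \<omega> \<inter> cball 0 (real k)). u (ordered_dist (\<Psi> \<omega>) i)) \<partial>M) \<longlonglongrightarrow>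
    (\<integral>\<^sup>+\<omega>. indicator {a..} (ordered_dist (\<Psi> \<omega>) 0) * ennreal (total_weight \<omega>) \<partial>M)"
  proof (rule nn_integral_dominated_convergence[where w="\<lambda>_. 1"])
    fix k :: nat
    show "AE \<omega> in M. ennreal (\<Prod>i<card (\<Psi> \<omega> \<inter> cball 0 (real k)). u (ordered_dist (\<Psi> \<omega>) i)) \<le> 1"
      using u by (auto intro!: prod_le_1 simp: ennreal_le_1)
  next
    show "AE \<omega> in M. (\<lambda>k. ennreal (\<Prod>i<card (\<Psi> \<omega> \<inter> cball 0 (real k)). u (ordered_dist (\<Psi> \<omega>) i))) \<longlonglongrightarrow>
      indicator {a..} (ordered_dist (\<Psi> \<omega>) 0) * ennreal (total_weight \<omega>)"
      using count_tendsto_infinity AE_ordered_dist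
    proof eventually_elim
      case (elim \<omega>)
      let ?r = "ordered_dist (\<Psi> \<omega>)"
      \<comment> \<open>The empty product is 1 whatever the cutoff says. With at least one factor,
        the nearest distance decides: if it is at least a, so are all others.\<close>
      have *: "(\<Prod>i<n. u (?r i)) = indicator {a..} (?r 0) * (\<Prod>i<n. q (?r i))" if "0 < n" for n
      proof (cases "a \<le> ?r 0")
        case True
        then have "a \<le> ?r i" for i using elim(2) order_trans by blast
        then show ?thesis by (simp add: u_def)
      next
        case False
        then have "u (?r 0) = 0" by (simp add: u_def)
        then have "(\<Prod>i<n. u (?r i)) = 0" using that by (intro prod_zero) auto
        then show ?thesis using False by simp
      qed
      have "(\<lambda>n. indicator {a..} (?r 0) * (\<Prod>i<n. q (?r i))) \<longlonglongrightarrow> indicator {a..} (?r 0) * total_weight \<omega>"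
        by (intro tendsto_intros partial_weight_tendsto)
      moreover have "\<forall>\<^sub>F n in sequentially. indicator {a..} (?r 0) * (\<Prod>i<n. q (?r i)) = (\<Prod>i<n. u (?r i))"
        using eventually_gt_at_top[of 0] by eventually_elim (simp add: *)
      ultimately have "(\<lambda>n. \<Prod>i<n. u (?r i)) \<longlonglongrightarrow> indicator {a..} (?r 0) * total_weight \<omega>"
        by (rule Lim_transform_eventually)
      from tendsto_ennrealI[OF filterlim_compose[OF this elim(1)]]
      show ?case by (simp add: ennreal_mult total_weight_nonneg ennreal_indicator)
    qed
  qed (auto simp: emeasure_space_1)
  have 2: "(\<lambda>k. ennreal (exp (- (LBINT v:{0<..real k}. ?F v)))) \<longlonglongrightarrow>
      ennreal (exp (- (pi * lam * a\<^sup>2 + interference_exponent lam q a)))"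
    unfolding IF[symmetric] by (intro tendsto_intros lim2)
  have "(\<integral>\<^sup>+\<omega>. ennreal (\<Prod>i<card (\<Psi> \<omega> \<inter> cball 0 (real k)). u (ordered_dist (\<Psi> \<omega>) i)) \<partial>M) =
      ennreal (exp (- (LBINT v:{0<..real k}. ?F v)))" for k
    by (rule pgfl[OF u_le u]) (rule rc)
  with 1 have "(\<lambda>k. ennreal (exp (- (LBINT v:{0<..real k}. ?F v)))) \<longlonglongrightarrow>
    (\<integral>\<^sup>+\<omega>. indicator {a..} (ordered_dist (\<Psi> \<omega>) 0) * ennreal (total_weight \<omega>) \<partial>M)" by simp
  from LIMSEQ_unique[OF this 2] show ?thesis .
qed

text \<open>The exponent pi lam r^2 plus the tail integral has derivative 2 pi lam r - 2 pi lam r (1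
  - q r) = 2 pi lam r q(r). So the integrand is minus the derivative of the claimed tail, which
  tends to 0.\<close>

lemma nn_integral_serving_density_tail:
  assumes a: "0 < a"
  shows "(\<integral>\<^sup>+r. ennreal (serving_density lam r * q r * exp (- interference_exponent lam q r)) * indicator {a..} r \<partial>lborel) =
    ennreal (exp (- (pi * lam * a\<^sup>2 + interference_exponent lam q a)))"
proof -
  let ?F = "\<lambda>r. - exp (- (pi * lam * r\<^sup>2 + interference_exponent lam q r))"
  have "(\<integral>\<^sup>+r. ennreal (serving_density lam r * q r * exp (- interference_exponent lam q r)) * indicator {a..} r \<partial>lborel)
     = ennreal (0 - ?F a)"
  proof (rule nn_integral_FTC_atLeast)
    show "(\<lambda>r. serving_density lam r * q r * exp (- interference_exponent lam q r)) \<in> borel_measurable borel"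
      unfolding serving_density_def by measurable
    fix r assume r: "a \<le> r"
    then have "0 < r" using a by simp
    from interference_exponent_deriv[OF this]
    show "(?F has_real_derivative serving_density lam r * q r * exp (- interference_exponent lam q r)) (at r)"
      by (auto intro!: derivative_eq_intros simp: serving_density_def algebra_simps simp flip: exp_add)
    show "0 \<le> serving_density lam r * q r * exp (- interference_exponent lam q r)"
      using \<open>0 < r\<close> q_nonneg lam_pos by (simp add: serving_density_def)
  next
    have "((\<lambda>r. exp (- (pi * lam * r\<^sup>2 + interference_exponent lam q r))) \<longlongrightarrow> 0) at_top"
    proof (rule tendsto_sandwich[where f="\<lambda>_. 0" and h="\<lambda>r. exp (- (pi * lam * r\<^sup>2))"])
      show "\<forall>\<^sub>F r in at_top. exp (- (pi * lam * r\<^sup>2 + interference_exponent lam q r)) \<le> exp (- (pi * lam * r\<^sup>2))"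
        using eventually_ge_at_top[of 0] by eventually_elim (simp add: interference_exponent_nonneg)
      have "filterlim (\<lambda>r. pi * lam * r\<^sup>2) at_top at_top"
        using lam_pos by (intro filterlim_tendsto_pos_mult_at_top[OF tendsto_const] filterlim_pow_at_top filterlim_ident) auto
      then show "((\<lambda>r. exp (- (pi * lam * r\<^sup>2))) \<longlongrightarrow> 0) at_top"
        by (intro filterlim_compose[OF exp_at_bot]) (simp add: filterlim_uminus_at_bot)
    qed auto
    from tendsto_minus[OF this] show "(?F \<longlongrightarrow> 0) at_top" by simp
  qed
  then show ?thesis by simp
qed

text \<open>Both sides, as measures in the nearest distance, have the same tails. The factor
  \<open>q r\<close> is the weight of the nearest point itself; a test function containing its
  reciprocal leaves the product over the interferers alone.\<close>

theorem nn_integral_total_weight: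
  assumes [measurable]: "h \<in> borel_measurable borel"
  shows "(\<integral>\<^sup>+\<omega>. h (ordered_dist (\<Psi> \<omega>) 0) * ennreal (total_weight \<omega>) \<partial>M) =
    (\<integral>\<^sup>+r\<in>{0<..}. h r * ennreal (serving_density lam r * q r * exp (- interference_exponent lam q r)) \<partial>lborel)"
proof -
  let ?D = "\<lambda>r. serving_density lam r * q r * exp (- interference_exponent lam q r)"
  have Dm [measurable]: "?D \<in> borel_measurable borel" unfolding serving_density_def by measurable
  let ?A = "distr (density M (\<lambda>\<omega>. ennreal (total_weight \<omega>))) borel (\<lambda>\<omega>. ordered_dist (\<Psi> \<omega>) 0)"
  let ?B = "density lborel (\<lambda>r. ennreal (?D r) * indicator {0<..} r)"
  have A: "emeasure ?A S = (\<integral>\<^sup>+\<omega>. indicator S (ordered_dist (\<Psi> \<omega>) 0) * ennreal (total_weight \<omega>) \<partial>M)"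
    if [measurable]: "S \<in> sets borel" for S
    by (simp add: emeasure_distr emeasure_density) (auto intro!: nn_integral_cong simp: indicator_def)
  have "?A = ?B"
  proof (rule measure_eqI_atLeast_pos)
    show "emeasure ?A {..0} = 0"
    proof (subst A)
      have "AE \<omega> in M. indicator {..0} (ordered_dist (\<Psi> \<omega>) 0) * ennreal (total_weight \<omega>) = 0"
        using AE_ordered_dist by eventually_elim (auto simp: indicator_def not_le)
      then show "(\<integral>\<^sup>+\<omega>. indicator {..0} (ordered_dist (\<Psi> \<omega>) 0) * ennreal (total_weight \<omega>) \<partial>M) = 0"
        by (subst nn_integral_0_iff_AE) auto
    qed simp
    show "emeasure ?B {..0} = 0"
      by (simp add: emeasure_density nn_integral_0_iff_AE indicator_def)
    fix a :: real assume a: "0 < a"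
    show "emeasure ?A {a..} = emeasure ?B {a..}"
    proof -
      have "emeasure ?B {a..} = (\<integral>\<^sup>+r. ennreal (?D r) * indicator {a..} r \<partial>lborel)"
        using a by (subst emeasure_density) (auto intro!: nn_integral_cong simp: indicator_def)
      then show ?thesis
        by (simp only: A[of "{a..}"] borel_closed closed_atLeast nn_integral_total_weight_tail[OF a] nn_integral_serving_density_tail[OF a])
    qed
    show "emeasure ?A {a..} \<le> 1"
    proof -
      have "0 \<le> pi * lam * a\<^sup>2 + interference_exponent lam q a"
        using a lam_pos interference_exponent_nonneg[of a] by simp
      then show ?thesis
        using a by (subst A) (auto simp: nn_integral_total_weight_tail)
    qed
  qed auto
  then have "integral\<^sup>N ?A h = integral\<^sup>N ?B h" by simp
  also have "integral\<^sup>N ?A h = (\<integral>\<^sup>+\<omega>. ennreal (total_weight \<omega>) * h (ordered_dist (\<Psi> \<omega>) 0) \<partial>M)"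
    by (simp add: nn_integral_distr nn_integral_density)
  also have "integral\<^sup>N ?B h = (\<integral>\<^sup>+r. (ennreal (?D r) * indicator {0<..} r) * h r \<partial>lborel)"
    by (rule nn_integral_density) auto
  finally show ?thesis by (simp only: mult_ac)
qed

end

section \<open>Conditional laws and Laplace transforms\<close>

text \<open>This links the abstract independence assumption, stated for \<open>config_space\<close>,
  to the counts and through them to the ordered distances.\<close>

lemma measurable_card_config_space:
  assumes "B \<in> sets borel" "bounded B"
  shows "(\<lambda>S. card (S \<inter> B)) \<in> measurable config_space (count_space UNIV)"
  unfolding config_space_def
proof (rule measurable_sigma_sets[where \<Omega>=UNIV and A="range (\<lambda>n::nat. {n})"])
  show "sets (count_space (UNIV::nat set)) = sigma_sets UNIV (range (\<lambda>n. {n}))"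
  proof -
    have "A \<in> sigma_sets UNIV (range (\<lambda>n::nat. {n}))" for A
    proof -
      have "A = (\<Union>n. if n \<in> A then {n} else {})" by (auto split: if_splits)
      also have "\<dots> \<in> sigma_sets UNIV (range (\<lambda>n::nat. {n}))"
        by (rule sigma_sets.Union) (auto intro: sigma_sets.Empty sigma_sets.Basic)
      finally show ?thesis .
    qed
    then show ?thesis by auto
  qed
  fix y assume "y \<in> range (\<lambda>n::nat. {n})"
  then obtain n where y: "y = {n}" by auto
  have "(\<lambda>S. card (S \<inter> B)) -` y \<inter> space (sigma UNIV {{S. card (S \<inter> B) = n} | B n. B \<in> sets borel \<and> bounded B}) =
    {S. card (S \<inter> B) = n}" unfolding y by (auto simp: space_measure_of_conv)
  then show "(\<lambda>S. card (S \<inter> B)) -` y \<inter> space (sigma UNIV {{S. card (S \<inter> B) = n} | B n. B \<in> sets borel \<and> bounded B})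
      \<in> sets (sigma UNIV {{S. card (S \<inter> B) = n} | B n. B \<in> sets borel \<and> bounded B})"
    using assms by (auto simp: sets_measure_of_conv intro!: sigma_sets.Basic)
qed auto

context prob_space begin

lemma laplace_transform_measurable [measurable]:
  fixes X :: "'a \<Rightarrow> real"
  assumes [measurable]: "X \<in> borel_measurable M"
  shows "(\<lambda>t. expectation (\<lambda>\<omega>. exp (- t * X \<omega>))) \<in> borel_measurable borel"
proof -
  have "(\<lambda>(t, \<omega>). exp (- t * X \<omega>)) \<in> borel_measurable (borel \<Otimes>\<^sub>M M)" by measurable
  from borel_measurable_lebesgue_integral[OF this] show ?thesis by simp
qed

lemma laplace_transform_integrable:
  fixes X :: "'a \<Rightarrow> real"
  assumes [measurable]: "X \<in> borel_measurable M" and X: "AE \<omega> in M. 0 \<le> X \<omega>" and t: "0 \<le> (t::real)"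
  shows "integrable M (\<lambda>\<omega>. exp (- t * X \<omega>))"
  by (rule integrable_const_bound[where B=1]) (use X t in \<open>auto elim!: eventually_mono\<close>)

lemma laplace_transform_bounds:
  fixes X :: "'a \<Rightarrow> real"
  assumes [measurable]: "X \<in> borel_measurable M" and X: "AE \<omega> in M. 0 \<le> X \<omega>" and t: "0 \<le> (t::real)"
  shows "0 < expectation (\<lambda>\<omega>. exp (- t * X \<omega>))" "expectation (\<lambda>\<omega>. exp (- t * X \<omega>)) \<le> 1"
proof -
  have i: "integrable M (\<lambda>\<omega>. exp (- t * X \<omega>))" by (rule laplace_transform_integrable[OF assms])
  have "expectation (\<lambda>\<omega>. exp (- t * X \<omega>)) \<noteq> 0"
    using integral_nonneg_eq_0_iff_AE[OF i] AE_False by auto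
  moreover have "0 \<le> expectation (\<lambda>\<omega>. exp (- t * X \<omega>))" by simp
  ultimately show "0 < expectation (\<lambda>\<omega>. exp (- t * X \<omega>))" by linarith
  have "expectation (\<lambda>\<omega>. exp (- t * X \<omega>)) \<le> expectation (\<lambda>_. 1)"
    by (rule integral_mono_AE[OF i]) (use X t in \<open>auto elim!: eventually_mono\<close>)
  then show "expectation (\<lambda>\<omega>. exp (- t * X \<omega>)) \<le> 1" by (simp add: prob_space)
qed

lemma laplace_transform_nn_integral:
  fixes X :: "'a \<Rightarrow> real"
  assumes [measurable]: "X \<in> borel_measurable M" and X: "AE \<omega> in M. 0 \<le> X \<omega>" and t: "0 \<le> (t::real)"
  shows "(\<integral>\<^sup>+\<omega>. ennreal (exp (- t * X \<omega>)) \<partial>M) = ennreal (expectation (\<lambda>\<omega>. exp (- t * X \<omega>)))"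
  by (rule nn_integral_eq_integral[OF laplace_transform_integrable[OF assms]]) auto

lemma laplace_transform_continuous:
  fixes X :: "'a \<Rightarrow> real"
  assumes [measurable]: "X \<in> borel_measurable M" and X: "AE \<omega> in M. 0 \<le> X \<omega>"
  shows "continuous_on {0..} (\<lambda>t. expectation (\<lambda>\<omega>. exp (- t * X \<omega>)))"
proof (rule continuous_on_sequentiallyI)
  fix u :: "nat \<Rightarrow> real" and a assume u: "\<forall>n. u n \<in> {0..}" "a \<in> {0..}" "u \<longlonglongrightarrow> a"
  show "(\<lambda>n. expectation (\<lambda>\<omega>. exp (- u n * X \<omega>))) \<longlonglongrightarrow> expectation (\<lambda>\<omega>. exp (- a * X \<omega>))"
  proof (rule integral_dominated_convergence[where w="\<lambda>_. 1"])
    show "AE \<omega> in M. (\<lambda>n. exp (- u n * X \<omega>)) \<longlonglongrightarrow> exp (- a * X \<omega>)"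
      by (intro AE_I2 tendsto_intros u)
    show "AE \<omega> in M. norm (exp (- u n * X \<omega>)) \<le> 1" for n
      using X u(1) by (auto elim!: eventually_mono)
  qed auto
qed

text \<open>The definition is the case of an indicator \<phi>; the general case is the usual
  induction over nonnegative measurable functions.\<close>

lemma conditional_law_nn_integral:
  assumes cl: "conditional_law M R X \<kappa>"
    and [measurable]: "R \<in> borel_measurable M" "X \<in> borel_measurable M" "\<phi> \<in> borel_measurable borel" "A \<in> sets borel"
  shows "(\<integral>\<^sup>+\<omega>. indicator A (R \<omega>) * \<phi> (X \<omega>) \<partial>M) = (\<integral>\<^sup>+r. indicator A r * (\<integral>\<^sup>+x. \<phi> x \<partial>\<kappa> r) \<partial>distr M borel R)"
proof -
  have \<kappa>: "\<kappa> \<in> measurable borel (prob_algebra borel)"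
    and cl: "\<And>A B. A \<in> sets borel \<Longrightarrow> B \<in> sets borel \<Longrightarrow> emeasure M {\<omega>\<in>space M. R \<omega> \<in> A \<and> X \<omega> \<in> B} =
          (\<integral>\<^sup>+ r\<in>A. emeasure (\<kappa> r) B \<partial>(distr M borel R))"
    using cl unfolding conditional_law_def by blast+
  have \<kappa>' [measurable]: "\<kappa> \<in> measurable borel (subprob_algebra borel)" by (rule measurable_prob_algebraD[OF \<kappa>])
  have sets: "sets (\<kappa> r) = sets borel" for r using measurable_space[OF \<kappa>, of r] by (simp add: space_prob_algebra)
  show ?thesis using \<open>\<phi> \<in> borel_measurable borel\<close>
  proof (induction \<phi> rule: borel_measurable_induct)
    case (cong f g)
    then show ?case by (simp cong: nn_integral_cong)
  next
    case (set B)
    note [measurable] = set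
    have "(\<integral>\<^sup>+\<omega>. indicator A (R \<omega>) * indicator B (X \<omega>) \<partial>M) = (\<integral>\<^sup>+\<omega>. indicator {\<omega>\<in>space M. R \<omega> \<in> A \<and> X \<omega> \<in> B} \<omega> \<partial>M)"
      by (rule nn_integral_cong) (auto simp: indicator_def)
    also have "\<dots> = emeasure M {\<omega>\<in>space M. R \<omega> \<in> A \<and> X \<omega> \<in> B}"
      using set by (intro nn_integral_indicator) measurable
    finally show ?case using set by (simp add: cl sets mult.commute)
  next
    case (mult u c)
    have [measurable]: "u \<in> borel_measurable borel" by fact
    have m: "u \<in> borel_measurable (\<kappa> r)" for r by (simp add: measurable_cong_sets[OF sets refl])
    have "(\<integral>\<^sup>+\<omega>. indicator A (R \<omega>) * (c * u (X \<omega>)) \<partial>M) = c * (\<integral>\<^sup>+\<omega>. indicator A (R \<omega>) * u (X \<omega>) \<partial>M)"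
      by (subst nn_integral_cmult[symmetric]) (auto simp: mult_ac)
    also have "\<dots> = (\<integral>\<^sup>+r. c * (indicator A r * (\<integral>\<^sup>+x. u x \<partial>\<kappa> r)) \<partial>distr M borel R)"
      unfolding mult.IH by (subst nn_integral_cmult) auto
    finally show ?case by (simp add: nn_integral_cmult[OF m] mult_ac)
  next
    case (add u v)
    have [measurable]: "u \<in> borel_measurable borel" "v \<in> borel_measurable borel" by fact+
    have m: "u \<in> borel_measurable (\<kappa> r)" "v \<in> borel_measurable (\<kappa> r)" for r by (simp_all add: measurable_cong_sets[OF sets refl])
    have "(\<integral>\<^sup>+\<omega>. indicator A (R \<omega>) * (v (X \<omega>) + u (X \<omega>)) \<partial>M) =
      (\<integral>\<^sup>+\<omega>. indicator A (R \<omega>) * v (X \<omega>) \<partial>M) + (\<integral>\<^sup>+\<omega>. indicator A (R \<omega>) * u (X \<omega>) \<partial>M)"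
      by (subst nn_integral_add[symmetric]) (auto simp: distrib_left)
    also have "\<dots> = (\<integral>\<^sup>+r. indicator A r * (\<integral>\<^sup>+x. v x \<partial>\<kappa> r) + indicator A r * (\<integral>\<^sup>+x. u x \<partial>\<kappa> r) \<partial>distr M borel R)"
      unfolding add.IH by (subst nn_integral_add) auto
    finally show ?case by (simp add: nn_integral_add[OF m(2,1)] distrib_left)
  next
    case (seq U)
    have [measurable]: "U i \<in> borel_measurable borel" for i by (rule seq)
    have m: "U i \<in> borel_measurable (\<kappa> r)" for r i by (simp add: measurable_cong_sets[OF sets refl])
    have inc: "incseq (\<lambda>i. f (U i))" if "\<And>x y. x \<le> y \<Longrightarrow> f x \<le> f y" for f :: "(real \<Rightarrow> ennreal) \<Rightarrow> ennreal"
      using seq(3) that by (auto simp: incseq_def)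
    have "(\<integral>\<^sup>+\<omega>. indicator A (R \<omega>) * (SUP i. U i) (X \<omega>) \<partial>M) = (\<integral>\<^sup>+\<omega>. (SUP i. indicator A (R \<omega>) * U i (X \<omega>)) \<partial>M)"
      by (simp add: SUP_mult_left_ennreal image_comp)
    also have "\<dots> = (SUP i. \<integral>\<^sup>+\<omega>. indicator A (R \<omega>) * U i (X \<omega>) \<partial>M)"
      using seq(3) by (intro nn_integral_monotone_convergence_SUP) (auto simp: incseq_def le_fun_def intro!: mult_left_mono)
    also have "\<dots> = (SUP i. \<integral>\<^sup>+r. indicator A r * (\<integral>\<^sup>+x. U i x \<partial>\<kappa> r) \<partial>distr M borel R)"
      by (simp add: seq.IH)
    also have "\<dots> = (\<integral>\<^sup>+r. (SUP i. indicator A r * (\<integral>\<^sup>+x. U i x \<partial>\<kappa> r)) \<partial>distr M borel R)"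
      using seq(3) by (intro nn_integral_monotone_convergence_SUP[symmetric])
        (auto simp: incseq_def le_fun_def intro!: mult_left_mono nn_integral_mono)
    also have "\<dots> = (\<integral>\<^sup>+r. indicator A r * (\<integral>\<^sup>+x. (SUP i. U i) x \<partial>\<kappa> r) \<partial>distr M borel R)"
    proof (rule nn_integral_cong)
      fix r
      have "(\<integral>\<^sup>+x. (SUP i. U i) x \<partial>\<kappa> r) = (\<integral>\<^sup>+x. (SUP i. U i x) \<partial>\<kappa> r)" by (simp add: image_comp)
      also have "\<dots> = (SUP i. \<integral>\<^sup>+x. U i x \<partial>\<kappa> r)"
        using seq(3) by (intro nn_integral_monotone_convergence_SUP m) auto
      finally show "(SUP i. indicator A r * (\<integral>\<^sup>+x. U i x \<partial>\<kappa> r)) = indicator A r * (\<integral>\<^sup>+x. (SUP i. U i) x \<partial>\<kappa> r)"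
        by (simp add: SUP_mult_left_ennreal)
    qed
    finally show ?case .
  qed
qed

end

section \<open>The network with fading\<close>

lemma powr_tail_integrable:
  fixes a e :: real
  assumes "0 < a" "e < -1"
  shows "set_integrable lborel {a..} (\<lambda>v. v powr e)"
  unfolding set_integrable_def
proof (rule integrableI_nonneg)
  have "((\<lambda>v. v powr e) has_integral -(a powr (e + 1)) / (e + 1)) {a..}"
    using has_integral_powr_to_inf[OF assms(2,1)] .
  then have "((\<lambda>v. indicator {a..} v *\<^sub>R v powr e) has_integral -(a powr (e + 1)) / (e + 1)) UNIV"
  proof (subst (asm) has_integral_restrict_UNIV[symmetric])
    have "(\<lambda>v. if v \<in> {a..} then v powr e else 0) = (\<lambda>v. indicator {a..} v *\<^sub>R v powr e)"
      by (auto simp: indicator_def fun_eq_iff)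
    then show "((\<lambda>v. if v \<in> {a..} then v powr e else 0) has_integral -(a powr (e + 1)) / (e + 1)) UNIV \<Longrightarrow> ?thesis"
      by simp
  qed
  from nn_integral_has_integral_lborel[OF _ _ this]
  have "(\<integral>\<^sup>+v. ennreal (indicat_real {a..} v *\<^sub>R v powr e) \<partial>lborel) = ennreal (-(a powr (e + 1)) / (e + 1))" by simp
  then show "(\<integral>\<^sup>+v. ennreal (indicat_real {a..} v *\<^sub>R v powr e) \<partial>lborel) < \<infinity>" by simp
qed auto

text \<open>For a divergent series \<open>suminf\<close> is a default value, whereas partial sums of
  nonnegative terms grow without bound and their exponentials tend to 0. A positive limit would
  bound the partial sums and force summability.\<close>

lemma exp_partial_sums_tendsto:
  fixes a :: "nat \<Rightarrow> real"
  assumes a: "\<And>i. 0 \<le> a i" and s: "0 < s"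
  shows "(\<lambda>n. exp (- s * (\<Sum>i<n. a i))) \<longlonglongrightarrow> (if summable a then exp (- s * suminf a) else 0)"
proof (cases "summable a")
  case True
  then show ?thesis by (auto intro!: tendsto_intros summable_LIMSEQ)
next
  case False
  let ?e = "\<lambda>n. exp (- s * (\<Sum>i<n. a i))"
  have "decseq ?e" using a s by (intro decseq_SucI) auto
  then obtain l where l: "?e \<longlonglongrightarrow> l" "\<forall>i. l \<le> ?e i"
    by (rule decseq_convergent[where B=0]) auto
  have "0 \<le> l" by (rule LIMSEQ_le_const[OF l(1)]) auto
  moreover have "\<not> 0 < l"
  proof
    assume "0 < l"
    have "(\<Sum>i<n. a i) \<le> - ln l / s" for n
    proof -
      have "ln l \<le> ln (?e n)" using l(2) \<open>0 < l\<close> by (subst ln_le_cancel_iff) auto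
      then show ?thesis using s by (simp add: field_simps)
    qed
    then have "summable a" using a by (intro summableI_nonneg_bounded)
    then show False using False by simp
  qed
  ultimately show ?thesis using l(1) False by simp
qed

text \<open>The law of the interfering powers enters only through \<open>power_bound\<close>, which
  holds for instance with the mean power as \<open>C\<close>. It makes v (1 - q(v)) of order v^(1 -
  eta), integrable at infinity because eta > 2.\<close>

locale fading_network = poisson_network M \<Psi> lam for M :: "'w measure" and \<Psi> lam +
  fixes g :: "nat \<Rightarrow> 'w \<Rightarrow> complex" and \<eta> P C :: real
  assumes path_loss: "2 < \<eta>" and P_pos: "0 < P"
    and interferer_ident: "\<And>i. 1 \<le> i \<Longrightarrow> distr M borel (g i) = distr M borel (g 1)"
    and fading_indep: "indep_vars (\<lambda>_. borel) g UNIV"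
    and fading_indep_locations:
      "indep_set (sets (vimage_algebra (space M) \<Psi> config_space))
         (sets (vimage_algebra (space M) (\<lambda>\<omega> i. g i \<omega>) (Pi\<^sub>M UNIV (\<lambda>_::nat. borel))))"
    and power_bound: "\<And>t. 0 \<le> t \<Longrightarrow> 1 - expectation (\<lambda>\<omega>. exp (- t * (cmod (g 1 \<omega>))\<^sup>2)) \<le> C * t"
begin

abbreviation "r i \<omega> \<equiv> ordered_dist (\<Psi> \<omega>) i"

lemma g_measurable [measurable]: "g i \<in> borel_measurable M"
  using fading_indep by (auto simp: indep_vars_def)

text \<open>The locations are embedded into the complex numbers because \<^const>\<open>prob_space.indep_var\<close>
  relates variables of the same type only.\<close>

lemma locations_indep_fading:
  "indep_var (Pi\<^sub>M UNIV (\<lambda>_. borel)) (\<lambda>\<omega> i. complex_of_real (r i \<omega>)) (Pi\<^sub>M UNIV (\<lambda>_. borel)) (\<lambda>\<omega> i. g i \<omega>)"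
proof -
  let ?V = "vimage_algebra (space M) \<Psi> config_space"
  let ?G = "vimage_algebra (space M) (\<lambda>\<omega> i. g i \<omega>) (Pi\<^sub>M UNIV (\<lambda>_::nat. borel :: complex measure))"
  have sp: "space config_space = UNIV" by (simp add: config_space_def space_measure_of_conv)
  have "(\<lambda>\<omega>. card (\<Psi> \<omega> \<inter> B)) \<in> measurable ?V (count_space UNIV)" if "B \<in> sets borel" "bounded B" for B
    using measurable_comp[OF measurable_vimage_algebra1[of \<Psi> "space M" config_space] measurable_card_config_space[OF that]]
    by (simp add: sp comp_def)
  then have "(\<lambda>\<omega>. r i \<omega>) \<in> borel_measurable ?V" for i
    by (intro ordered_dist_measurable_wrt) auto
  then have D: "(\<lambda>\<omega> i. complex_of_real (r i \<omega>)) \<in> measurable ?V (Pi\<^sub>M UNIV (\<lambda>_. borel))"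
    by (intro measurable_PiM_single') auto
  have G: "(\<lambda>\<omega> i. g i \<omega>) \<in> measurable ?G (Pi\<^sub>M UNIV (\<lambda>_. borel))"
    by (intro measurable_vimage_algebra1) (auto simp: space_PiM)
  show ?thesis unfolding indep_var_eq
  proof (intro conjI)
    show "(\<lambda>\<omega> i. complex_of_real (r i \<omega>)) \<in> measurable M (Pi\<^sub>M UNIV (\<lambda>_. borel))"
      by (intro measurable_PiM_single') auto
    show "(\<lambda>\<omega> i. g i \<omega>) \<in> measurable M (Pi\<^sub>M UNIV (\<lambda>_. borel))"
      by (intro measurable_PiM_single') auto
    have 1: "sigma_sets (space M) {(\<lambda>\<omega> i. complex_of_real (r i \<omega>)) -` A \<inter> space M |A. A \<in> sets (Pi\<^sub>M UNIV (\<lambda>_. borel))} \<subseteq> sets ?V"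
      using sets.sigma_sets_subset[of "{(\<lambda>\<omega> i. complex_of_real (r i \<omega>)) -` A \<inter> space M |A. A \<in> sets (Pi\<^sub>M UNIV (\<lambda>_. borel))}" ?V]
        measurable_sets[OF D] by auto
    have 2: "sigma_sets (space M) {(\<lambda>\<omega> i. g i \<omega>) -` A \<inter> space M |A. A \<in> sets (Pi\<^sub>M UNIV (\<lambda>_. borel))} \<subseteq> sets ?G"
      using sets.sigma_sets_subset[of "{(\<lambda>\<omega> i. g i \<omega>) -` A \<inter> space M |A. A \<in> sets (Pi\<^sub>M UNIV (\<lambda>_. borel))}" ?G]
        measurable_sets[OF G] by auto
    show "indep_set (sigma_sets (space M) {(\<lambda>\<omega> i. complex_of_real (r i \<omega>)) -` A \<inter> space M |A. A \<in> sets (Pi\<^sub>M UNIV (\<lambda>_. borel))})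
       (sigma_sets (space M) {(\<lambda>\<omega> i. g i \<omega>) -` A \<inter> space M |A. A \<in> sets (Pi\<^sub>M UNIV (\<lambda>_. borel))})"
      using fading_indep_locations unfolding indep_set_def
      by (rule indep_sets_mono_sets) (use 1 2 in \<open>auto split: bool.splits\<close>)
  qed
qed

text \<open>Independence makes the joint law of locations and fading a product, so Fubini freezes
  the locations. For frozen locations the factors are functions of independent coefficients and
  their mean factorises.\<close>

lemma decoupling:
  fixes \<phi> :: "nat \<Rightarrow> real \<times> complex \<Rightarrow> ennreal"
  assumes [measurable]: "\<And>i. \<phi> i \<in> borel_measurable (borel \<Otimes>\<^sub>M borel)"
    and h [measurable]: "h \<in> borel_measurable borel"
  shows "(\<integral>\<^sup>+\<omega>. h (r 0 \<omega>) * (\<Prod>i<n. \<phi> i (r i \<omega>, g i \<omega>)) \<partial>M) =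
    (\<integral>\<^sup>+\<omega>. h (r 0 \<omega>) * (\<Prod>i<n. \<integral>\<^sup>+\<omega>'. \<phi> i (r i \<omega>, g i \<omega>') \<partial>M) \<partial>M)"
proof -
  let ?D = "\<lambda>\<omega> i. complex_of_real (r i \<omega>)" and ?G = "\<lambda>\<omega> i. g i \<omega>"
  let ?S = "Pi\<^sub>M UNIV (\<lambda>_::nat. borel :: complex measure)" and ?T = "Pi\<^sub>M UNIV (\<lambda>_::nat. borel :: complex measure)"
  have Dm [measurable]: "?D \<in> measurable M ?S" and Gm [measurable]: "?G \<in> measurable M ?T"
    using locations_indep_fading by (auto dest: indep_var_rv1 indep_var_rv2)
  interpret D: prob_space "distr M ?S ?D" by (rule prob_space_distr) measurable
  interpret G: prob_space "distr M ?T ?G" by (rule prob_space_distr) measurable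
  define H where "H = (\<lambda>(d, z). h (Re (d 0)) * (\<Prod>i<n. \<phi> i (Re (d i), z i)))"
  have Hm [measurable]: "H \<in> borel_measurable (?S \<Otimes>\<^sub>M ?T)" unfolding H_def case_prod_beta by measurable
  have "(\<integral>\<^sup>+\<omega>. h (r 0 \<omega>) * (\<Prod>i<n. \<phi> i (r i \<omega>, g i \<omega>)) \<partial>M) = (\<integral>\<^sup>+\<omega>. H (?D \<omega>, ?G \<omega>) \<partial>M)"
    by (simp add: H_def)
  also have "\<dots> = integral\<^sup>N (distr M (?S \<Otimes>\<^sub>M ?T) (\<lambda>\<omega>. (?D \<omega>, ?G \<omega>))) H"
    by (subst nn_integral_distr) auto
  also have "distr M (?S \<Otimes>\<^sub>M ?T) (\<lambda>\<omega>. (?D \<omega>, ?G \<omega>)) = distr M ?S ?D \<Otimes>\<^sub>M distr M ?T ?G"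
    using locations_indep_fading unfolding indep_var_distribution_eq by simp
  also have "integral\<^sup>N (distr M ?S ?D \<Otimes>\<^sub>M distr M ?T ?G) H = (\<integral>\<^sup>+d. \<integral>\<^sup>+z. H (d, z) \<partial>distr M ?T ?G \<partial>distr M ?S ?D)"
    by (rule G.nn_integral_fst[symmetric]) simp
  also have "\<dots> = (\<integral>\<^sup>+\<omega>. \<integral>\<^sup>+\<omega>'. H (?D \<omega>, ?G \<omega>') \<partial>M \<partial>M)"
  proof -
    have "(\<lambda>d. \<integral>\<^sup>+z. H (d, z) \<partial>distr M ?T ?G) \<in> borel_measurable ?S"
      by (rule G.borel_measurable_nn_integral_fst) simp
    then have "(\<integral>\<^sup>+d. \<integral>\<^sup>+z. H (d, z) \<partial>distr M ?T ?G \<partial>distr M ?S ?D) = (\<integral>\<^sup>+\<omega>. \<integral>\<^sup>+z. H (?D \<omega>, z) \<partial>distr M ?T ?G \<partial>M)"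
      by (subst nn_integral_distr) auto
    also have "\<dots> = (\<integral>\<^sup>+\<omega>. \<integral>\<^sup>+\<omega>'. H (?D \<omega>, ?G \<omega>') \<partial>M \<partial>M)"
    proof (rule nn_integral_cong)
      fix \<omega> assume "\<omega> \<in> space M"
      have "(\<lambda>z. H (?D \<omega>, z)) \<in> borel_measurable ?T"
        by (rule measurable_compose[OF _ Hm]) (auto simp: space_PiM)
      then show "(\<integral>\<^sup>+z. H (?D \<omega>, z) \<partial>distr M ?T ?G) = (\<integral>\<^sup>+\<omega>'. H (?D \<omega>, ?G \<omega>') \<partial>M)"
        by (subst nn_integral_distr) auto
    qed
    finally show ?thesis .
  qed
  also have "\<dots> = (\<integral>\<^sup>+\<omega>. h (r 0 \<omega>) * (\<Prod>i<n. \<integral>\<^sup>+\<omega>'. \<phi> i (r i \<omega>, g i \<omega>') \<partial>M) \<partial>M)"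
  proof (rule nn_integral_cong)
    fix \<omega>
    have "indep_vars (\<lambda>_. borel) g {..<n}" by (rule indep_vars_subset[OF fading_indep]) auto
    from indep_vars_nn_integral[OF _ indep_vars_compose2[OF this, where Y="\<lambda>i z. \<phi> i (r i \<omega>, z)" and N="\<lambda>_. borel"]]
    have "(\<integral>\<^sup>+\<omega>'. (\<Prod>i<n. \<phi> i (r i \<omega>, g i \<omega>')) \<partial>M) = (\<Prod>i<n. \<integral>\<^sup>+\<omega>'. \<phi> i (r i \<omega>, g i \<omega>') \<partial>M)" by simp
    then show "(\<integral>\<^sup>+\<omega>'. H (?D \<omega>, ?G \<omega>') \<partial>M) = h (r 0 \<omega>) * (\<Prod>i<n. \<integral>\<^sup>+\<omega>'. \<phi> i (r i \<omega>, g i \<omega>') \<partial>M)"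
      by (simp add: H_def nn_integral_cmult)
  qed
  finally show ?thesis .
qed

definition power_transform :: "nat \<Rightarrow> real \<Rightarrow> real" where
  "power_transform i t = expectation (\<lambda>\<omega>. exp (- t * (cmod (g i \<omega>))\<^sup>2))"

lemma power_transform_measurable [measurable]: "power_transform i \<in> borel_measurable borel"
  unfolding power_transform_def[abs_def] by measurable

lemma power_transform_bounds: "0 \<le> t \<Longrightarrow> 0 < power_transform i t" "0 \<le> t \<Longrightarrow> power_transform i t \<le> 1"
  unfolding power_transform_def by (rule laplace_transform_bounds; simp)+

lemma power_transform_nonneg: "0 \<le> power_transform i t"
  unfolding power_transform_def by simp

lemma power_transform_0 [simp]: "power_transform i 0 = 1"
  unfolding power_transform_def by (simp add: prob_space)

lemma power_transform_ident: "1 \<le> i \<Longrightarrow> power_transform i t = power_transform 1 t"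
proof -
  assume i: "1 \<le> i"
  have "power_transform i t = (LINT z|distr M borel (g i). exp (- t * (cmod z)\<^sup>2))" for i
    unfolding power_transform_def by (subst integral_distr) auto
  then show ?thesis using interferer_ident[OF i] by simp
qed

lemma C_nonneg: "0 \<le> C"
  using power_bound[of 1] power_transform_bounds(2)[of 1 1] unfolding power_transform_def by simp

definition weight :: "real \<Rightarrow> real \<Rightarrow> real" where
  "weight s v = power_transform 1 (s * P * v powr (-\<eta>))"

lemma weight_defect: "0 \<le> s \<Longrightarrow> 1 - weight s v \<le> s * (C * P * v powr (-\<eta>))"
  using power_bound[of "s * P * v powr (-\<eta>)"] P_pos
  unfolding weight_def power_transform_def by (simp add: mult_ac)

lemma weight_measurable [measurable]: "weight s \<in> borel_measurable borel"
  unfolding weight_def[abs_def] by measurable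

lemma ring_weight_integrable:
  assumes "0 < a"
  shows "set_integrable lborel {a..} (\<lambda>v. c * (v * v powr (-\<eta>)))"
proof (rule set_integrable_mult_right)
  have "set_integrable lborel {a..} (\<lambda>v. v powr (1 - \<eta>))"
    using assms path_loss by (intro powr_tail_integrable) auto
  then show "set_integrable lborel {a..} (\<lambda>v. v * v powr (-\<eta>))"
    by (rule set_integrable_cong[OF refl refl, THEN iffD1, rotated])
      (use assms in \<open>auto simp: powr_diff powr_minus field_simps\<close>)
qed

lemma point_weight: assumes s: "0 \<le> s" shows "point_weight lam (weight s)"
proof
  show "0 < lam" by (rule lam_pos)
  show "weight s \<in> borel_measurable borel" by simp
  have arg: "0 \<le> s * P * v powr (-\<eta>)" for v using s P_pos by simp
  show "0 \<le> weight s v" "weight s v \<le> 1" "0 < v \<Longrightarrow> 0 < weight s v" for v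
    unfolding weight_def by (rule power_transform_nonneg power_transform_bounds arg)+
  have "continuous_on {0<..} (weight s)"
    unfolding weight_def[abs_def]
  proof (rule continuous_on_compose2[where t="{0..}" and g="power_transform 1"])
    show "continuous_on {0..} (power_transform 1)"
      unfolding power_transform_def[abs_def] by (rule laplace_transform_continuous) auto
  qed (use arg in \<open>auto intro!: continuous_intros\<close>)
  then show "isCont (weight s) v" if "0 < v" for v
    using that by (simp add: continuous_on_eq_continuous_at)
  fix a :: real assume a: "0 < a"
  show "set_integrable lborel {a..} (\<lambda>v. v * (1 - weight s v))"
  proof (rule set_integrable_bound[OF ring_weight_integrable[OF a, of "s * C * P"]])
    show "set_borel_measurable lborel {a..} (\<lambda>v. v * (1 - weight s v))"
      unfolding set_borel_measurable_def by measurable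
    show "AE v in lborel. v \<in> {a..} \<longrightarrow> norm (v * (1 - weight s v)) \<le> norm (s * C * P * (v * v powr (-\<eta>)))"
    proof (intro AE_I2 impI)
      fix v assume "v \<in> {a..}"
      then have v: "0 < v" using a by simp
      have "v * (1 - weight s v) \<le> v * (s * (C * P * v powr (-\<eta>)))"
        using v s by (intro mult_left_mono weight_defect) auto
      then show "norm (v * (1 - weight s v)) \<le> norm (s * C * P * (v * v powr (-\<eta>)))"
        using v s C_nonneg P_pos \<open>weight s v \<le> 1\<close> by (simp add: abs_mult mult_ac)
    qed
  qed
qed

lemma weighted_poisson_network: "0 \<le> s \<Longrightarrow> weighted_poisson_network M \<Psi> lam (weight s)"
  by (intro weighted_poisson_network.intro poisson_network_axioms point_weight)

text \<open>At s = 0 all weights are 1, so the total weight is 1, the exponent is 0, and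
  \<open>nn_integral_total_weight\<close> becomes the law of the nearest distance.\<close>

lemma serving_dist_law:
  assumes [measurable]: "h \<in> borel_measurable borel"
  shows "(\<integral>\<^sup>+\<omega>. h (r 0 \<omega>) \<partial>M) = (\<integral>\<^sup>+x\<in>{0<..}. h x * ennreal (serving_density lam x) \<partial>lborel)"
proof -
  interpret W: weighted_poisson_network M \<Psi> lam "weight 0" by (rule weighted_poisson_network) simp
  have w: "weight 0 v = 1" for v by (simp add: weight_def)
  have "W.total_weight \<omega> = 1" for \<omega> by (simp add: W.total_weight_def w)
  moreover have "interference_exponent lam (weight 0) x = 0" for x
    by (simp add: interference_exponent_def w set_lebesgue_integral_def)
  ultimately show ?thesis using W.nn_integral_total_weight[OF assms] by (simp add: w)
qed

definition received :: "nat \<Rightarrow> 'w \<Rightarrow> real" where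
  "received i \<omega> = P * (cmod (g i \<omega>))\<^sup>2 * r i \<omega> powr (-\<eta>)"

lemma received_measurable [measurable]: "received i \<in> borel_measurable M"
  unfolding received_def by measurable

lemma received_nonneg: "0 \<le> received i \<omega>"
  unfolding received_def using P_pos by simp

lemma interference_eq: "interference \<Psi> g \<eta> P \<omega> = (\<Sum>i. received (Suc i) \<omega>)"
  by (simp add: interference_def received_def)

lemma signal_power_eq: "signal_power \<Psi> g \<eta> P \<omega> = received 0 \<omega>"
  by (simp add: signal_power_def received_def)

text \<open>The serving link has its own fading law and its own rate s0, so index 0 stays outside
  the product of weights. Only finitely many interferers occur, which keeps clear of the convergence
  of the series.\<close>

lemma partial_transform:
  assumes [measurable]: "h \<in> borel_measurable borel" and s: "0 \<le> s" "0 \<le> s0"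
  shows "(\<integral>\<^sup>+\<omega>. h (r 0 \<omega>) * (ennreal (exp (- s0 * received 0 \<omega>)) * ennreal (exp (- s * (\<Sum>i<n. received (Suc i) \<omega>)))) \<partial>M)
    = (\<integral>\<^sup>+\<omega>. h (r 0 \<omega>) * (ennreal (power_transform 0 (s0 * P * r 0 \<omega> powr (-\<eta>))) * ennreal (\<Prod>i<n. weight s (r (Suc i) \<omega>))) \<partial>M)"
proof -
  define \<sigma> where "\<sigma> i = (if i = 0 then s0 else s)" for i :: nat
  define \<phi> where "\<phi> i p = ennreal (exp (- \<sigma> i * (P * (cmod (snd p))\<^sup>2 * fst p powr (-\<eta>))))" for i and p :: "real \<times> complex"
  have \<sigma>: "0 \<le> \<sigma> i" for i using s by (simp add: \<sigma>_def)
  have m: "\<phi> i \<in> borel_measurable (borel \<Otimes>\<^sub>M borel)" for i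
    unfolding \<phi>_def[abs_def] by measurable
  have 1: "(\<integral>\<^sup>+\<omega>'. \<phi> i (x, g i \<omega>') \<partial>M) = ennreal (power_transform i (\<sigma> i * P * x powr (-\<eta>)))" for i x
  proof -
    have "(\<integral>\<^sup>+\<omega>'. \<phi> i (x, g i \<omega>') \<partial>M) = (\<integral>\<^sup>+\<omega>'. ennreal (exp (- (\<sigma> i * P * x powr (-\<eta>)) * (cmod (g i \<omega>'))\<^sup>2)) \<partial>M)"
      by (simp add: \<phi>_def mult_ac)
    also have "\<dots> = ennreal (power_transform i (\<sigma> i * P * x powr (-\<eta>)))"
      unfolding power_transform_def by (rule laplace_transform_nn_integral) (use \<sigma> P_pos in auto)
    finally show ?thesis .
  qed
  have 2: "(\<Prod>i<Suc n. \<phi> i (r i \<omega>, g i \<omega>)) =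
     ennreal (exp (- s0 * received 0 \<omega>)) * ennreal (exp (- s * (\<Sum>i<n. received (Suc i) \<omega>)))" for \<omega>
  proof -
    have "(\<Prod>i<Suc n. \<phi> i (r i \<omega>, g i \<omega>)) = \<phi> 0 (r 0 \<omega>, g 0 \<omega>) * (\<Prod>i<n. \<phi> (Suc i) (r (Suc i) \<omega>, g (Suc i) \<omega>))"
      by (rule prod.lessThan_Suc_shift)
    also have "(\<Prod>i<n. \<phi> (Suc i) (r (Suc i) \<omega>, g (Suc i) \<omega>)) = ennreal (\<Prod>i<n. exp (- s * received (Suc i) \<omega>))"
      by (simp add: \<phi>_def \<sigma>_def received_def prod_ennreal)
    also have "(\<Prod>i<n. exp (- s * received (Suc i) \<omega>)) = exp (- s * (\<Sum>i<n. received (Suc i) \<omega>))"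
      by (simp only: sum_distrib_left exp_sum finite_lessThan)
    also have "\<phi> 0 (r 0 \<omega>, g 0 \<omega>) = ennreal (exp (- s0 * received 0 \<omega>))"
      by (simp add: \<phi>_def \<sigma>_def received_def)
    finally show ?thesis .
  qed
  have 3: "(\<Prod>i<Suc n. \<integral>\<^sup>+\<omega>'. \<phi> i (r i \<omega>, g i \<omega>') \<partial>M) =
     ennreal (power_transform 0 (s0 * P * r 0 \<omega> powr (-\<eta>))) * ennreal (\<Prod>i<n. weight s (r (Suc i) \<omega>))" for \<omega>
  proof -
    have "power_transform (Suc i) (s * P * r (Suc i) \<omega> powr (-\<eta>)) = weight s (r (Suc i) \<omega>)" for i
      unfolding weight_def by (rule power_transform_ident) simp
    then show ?thesis
      unfolding prod.lessThan_Suc_shift 1 by (simp add: \<sigma>_def prod_ennreal weight_def power_transform_nonneg)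
  qed
  show ?thesis using decoupling[of \<phi> h "Suc n", OF m assms(1)] unfolding 2 3 .
qed

end

section \<open>Joint transform of signal and interference\<close>

context fading_network begin

abbreviation "\<Lambda> s \<equiv> interference_exponent lam (weight s)"

lemma exponent_nonneg: "0 \<le> s \<Longrightarrow> 0 \<le> x \<Longrightarrow> 0 \<le> \<Lambda> s x"
  by (rule point_weight.interference_exponent_nonneg[OF point_weight])

text \<open>This is exp(-s I) with the value 0 where the series diverges, in place of the
  exponential of the default value of \<open>suminf\<close>. It is the pointwise limit of the
  factors of the partial sums.\<close>

definition interference_factor :: "real \<Rightarrow> 'w \<Rightarrow> real" where
  "interference_factor s \<omega> =
    (if summable (\<lambda>i. received (Suc i) \<omega>) then exp (- s * interference \<Psi> g \<eta> P \<omega>) else 0)"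

lemma interference_factor_tendsto:
  "0 < s \<Longrightarrow> (\<lambda>n. exp (- s * (\<Sum>i<n. received (Suc i) \<omega>))) \<longlonglongrightarrow> interference_factor s \<omega>"
  unfolding interference_factor_def interference_eq
  by (rule exp_partial_sums_tendsto) (auto simp: received_nonneg)

lemma interference_factor_measurable [measurable]: "0 < s \<Longrightarrow> interference_factor s \<in> borel_measurable M"
  by (rule borel_measurable_LIMSEQ_real[OF interference_factor_tendsto]) auto

text \<open>Both sides of \<open>partial_transform\<close> pass to the limit of infinitely many
  interferers by domination by 1. On the side of the weights the limit is the total weight divided
  by that of the nearest point.\<close>

lemma joint_transform_factor:
  assumes [measurable]: "A \<in> sets borel" and s: "0 < s" and s0: "0 \<le> s0"
  shows "(\<integral>\<^sup>+\<omega>. indicator A (r 0 \<omega>) * (ennreal (exp (- s0 * received 0 \<omega>)) * ennreal (interference_factor s \<omega>)) \<partial>M)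
    = (\<integral>\<^sup>+x\<in>{0<..}. indicator A x * ennreal (power_transform 0 (s0 * P * x powr (-\<eta>))
         * (serving_density lam x * exp (- \<Lambda> s x))) \<partial>lborel)"
proof -
  have s': "0 \<le> s" using s by simp
  interpret W: weighted_poisson_network M \<Psi> lam "weight s" by (rule weighted_poisson_network[OF s'])
  let ?pt = "\<lambda>x. power_transform 0 (s0 * P * x powr (-\<eta>))"
  have pt: "0 \<le> ?pt x" "?pt x \<le> 1" for x
    using s0 P_pos by (auto intro!: power_transform_nonneg power_transform_bounds)
  let ?h = "indicator A :: real \<Rightarrow> ennreal"
  note [measurable] = interference_factor_measurable[OF s]
  have 1: "(\<lambda>n. \<integral>\<^sup>+\<omega>. ?h (r 0 \<omega>) * (ennreal (exp (- s0 * received 0 \<omega>)) * ennreal (exp (- s * (\<Sum>i<n. received (Suc i) \<omega>)))) \<partial>M)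
    \<longlonglongrightarrow> (\<integral>\<^sup>+\<omega>. ?h (r 0 \<omega>) * (ennreal (exp (- s0 * received 0 \<omega>)) * ennreal (interference_factor s \<omega>)) \<partial>M)"
  proof (rule nn_integral_dominated_convergence[where w="\<lambda>_. 1"])
    fix n
    have "exp (- s0 * received 0 \<omega>) * exp (- s * (\<Sum>i<n. received (Suc i) \<omega>)) \<le> 1 * 1" for \<omega>
      using s s0 by (intro mult_mono) (auto simp: received_nonneg sum_nonneg)
    then show "AE \<omega> in M. ?h (r 0 \<omega>) * (ennreal (exp (- s0 * received 0 \<omega>)) * ennreal (exp (- s * (\<Sum>i<n. received (Suc i) \<omega>)))) \<le> 1"
      by (auto simp: indicator_def ennreal_mult[symmetric])
  next
    show "AE \<omega> in M. (\<lambda>n. ?h (r 0 \<omega>) * (ennreal (exp (- s0 * received 0 \<omega>)) * ennreal (exp (- s * (\<Sum>i<n. received (Suc i) \<omega>)))))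
       \<longlonglongrightarrow> ?h (r 0 \<omega>) * (ennreal (exp (- s0 * received 0 \<omega>)) * ennreal (interference_factor s \<omega>))"
      by (intro AE_I2 ennreal_tendsto_cmult tendsto_ennrealI interference_factor_tendsto[OF s])
         (auto simp: indicator_def)
  qed (auto simp: emeasure_space_1)
  \<comment> \<open>Shifting the index removes the serving point; the division is legitimate since
    its weight is positive at positive distance.\<close>
  have lim: "(\<lambda>n. \<Prod>i<n. weight s (r (Suc i) \<omega>)) \<longlonglongrightarrow> W.total_weight \<omega> / weight s (r 0 \<omega>)" if "0 < r 0 \<omega>" for \<omega>
  proof -
    have "(\<Prod>i<n. weight s (r (Suc i) \<omega>)) = (\<Prod>i<Suc n. weight s (r i \<omega>)) / weight s (r 0 \<omega>)" for n
      unfolding prod.lessThan_Suc_shift using W.q_pos[OF that] by simp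
    then show ?thesis
      using LIMSEQ_Suc[OF W.partial_weight_tendsto, of \<omega>] W.q_pos[OF that] by (auto intro!: tendsto_divide)
  qed
  have 2: "(\<lambda>n. \<integral>\<^sup>+\<omega>. ?h (r 0 \<omega>) * (ennreal (?pt (r 0 \<omega>)) * ennreal (\<Prod>i<n. weight s (r (Suc i) \<omega>))) \<partial>M)
    \<longlonglongrightarrow> (\<integral>\<^sup>+\<omega>. ?h (r 0 \<omega>) * (ennreal (?pt (r 0 \<omega>)) * ennreal (W.total_weight \<omega> / weight s (r 0 \<omega>))) \<partial>M)"
  proof (rule nn_integral_dominated_convergence[where w="\<lambda>_. 1"])
    fix n
    have "?pt (r 0 \<omega>) * (\<Prod>i<n. weight s (r (Suc i) \<omega>)) \<le> 1 * 1" for \<omega>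
      using pt by (intro mult_mono prod_le_1 prod_nonneg) (auto simp: W.q_nonneg W.q_le_1)
    then show "AE \<omega> in M. ?h (r 0 \<omega>) * (ennreal (?pt (r 0 \<omega>)) * ennreal (\<Prod>i<n. weight s (r (Suc i) \<omega>))) \<le> 1"
      using pt by (auto simp: indicator_def ennreal_mult[symmetric] prod_nonneg W.q_nonneg)
  next
    show "AE \<omega> in M. (\<lambda>n. ?h (r 0 \<omega>) * (ennreal (?pt (r 0 \<omega>)) * ennreal (\<Prod>i<n. weight s (r (Suc i) \<omega>))))
       \<longlonglongrightarrow> ?h (r 0 \<omega>) * (ennreal (?pt (r 0 \<omega>)) * ennreal (W.total_weight \<omega> / weight s (r 0 \<omega>)))"
      using AE_ordered_dist
    proof eventually_elim
      case (elim \<omega>)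
      then show ?case
        by (intro ennreal_tendsto_cmult tendsto_ennrealI lim) (auto simp: indicator_def)
    qed
  qed (auto simp: emeasure_space_1)
  have "(\<integral>\<^sup>+\<omega>. ?h (r 0 \<omega>) * (ennreal (exp (- s0 * received 0 \<omega>)) * ennreal (interference_factor s \<omega>)) \<partial>M) =
     (\<integral>\<^sup>+\<omega>. ?h (r 0 \<omega>) * (ennreal (?pt (r 0 \<omega>)) * ennreal (W.total_weight \<omega> / weight s (r 0 \<omega>))) \<partial>M)"
    using LIMSEQ_unique[OF 1 2[folded partial_transform[OF borel_measurable_indicator[OF assms(1)] s' s0]]] .
  \<comment> \<open>The quotient goes into the test function, so that the weight of the nearest
    point cancels against the factor \<open>weight s x\<close> in the density.\<close>
  also have "\<dots> = (\<integral>\<^sup>+\<omega>. (?h (r 0 \<omega>) * ennreal (?pt (r 0 \<omega>) / weight s (r 0 \<omega>))) * ennreal (W.total_weight \<omega>) \<partial>M)"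
    using pt W.total_weight_nonneg W.q_nonneg
    by (intro nn_integral_cong) (auto simp: indicator_def ennreal_mult[symmetric])
  also have "\<dots> = (\<integral>\<^sup>+x\<in>{0<..}. (?h x * ennreal (?pt x / weight s x)) *
        ennreal (serving_density lam x * weight s x * exp (- \<Lambda> s x)) \<partial>lborel)"
    by (rule W.nn_integral_total_weight) measurable
  also have "\<dots> = (\<integral>\<^sup>+x\<in>{0<..}. ?h x * ennreal (?pt x * (serving_density lam x * exp (- \<Lambda> s x))) \<partial>lborel)"
  proof (intro nn_integral_cong)
    fix x :: real
    have "ennreal (?pt x / weight s x) * ennreal (serving_density lam x * weight s x * exp (- \<Lambda> s x)) =
        ennreal (?pt x * (serving_density lam x * exp (- \<Lambda> s x)))" if "0 < x"
      using W.q_pos[OF that] pt[of x] that lam_pos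
      by (subst ennreal_mult[symmetric]) (auto simp: serving_density_def)
    then show "?h x * ennreal (?pt x / weight s x) * ennreal (serving_density lam x * weight s x * exp (- \<Lambda> s x)) * indicator {0<..} x =
       ?h x * ennreal (?pt x * (serving_density lam x * exp (- \<Lambda> s x))) * indicator {0<..} x"
      by (auto simp: indicator_def)
  qed
  finally show ?thesis .
qed

text \<open>The bound is linear in s, so the exponent vanishes as s tends to 0 at each fixed
  distance x > 0.\<close>

lemma exponent_le:
  assumes "0 \<le> s" "0 < x"
  shows "\<Lambda> s x \<le> s * (LBINT v:{x..}. 2 * pi * lam * C * P * (v * v powr (-\<eta>)))"
proof -
  have "\<Lambda> s x \<le> (LBINT v:{x..}. s * (2 * pi * lam * C * P * (v * v powr (-\<eta>))))"
    unfolding interference_exponent_def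
  proof (rule set_integral_mono)
    show "set_integrable lborel {x..} (\<lambda>v. 2 * pi * lam * v * (1 - weight s v))"
      by (rule point_weight.ring_rate_integrable[OF point_weight[OF assms(1)] assms(2)])
    show "set_integrable lborel {x..} (\<lambda>v. s * (2 * pi * lam * C * P * (v * v powr (-\<eta>))))"
      by (rule set_integrable_mult_right[OF ring_weight_integrable[OF assms(2)]])
    fix v assume "v \<in> {x..}"
    then have "2 * pi * lam * v * (1 - weight s v) \<le> 2 * pi * lam * v * (s * (C * P * v powr (-\<eta>)))"
      using assms lam_pos by (intro mult_left_mono weight_defect) auto
    then show "2 * pi * lam * v * (1 - weight s v) \<le> s * (2 * pi * lam * C * P * (v * v powr (-\<eta>)))"
      by (simp add: mult_ac)
  qed
  then show ?thesis by simp
qed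

text \<open>For every s > 0 the mean of \<open>interference_factor s\<close> is at most the
  probability of convergence. As s tends to 0 this mean, written as an integral over the nearest
  distance, tends to the total mass 1 of the serving density.\<close>

lemma AE_interference_summable: "AE \<omega> in M. summable (\<lambda>i. received (Suc i) \<omega>)"
proof -
  let ?N = "{\<omega>\<in>space M. summable (\<lambda>i. received (Suc i) \<omega>)}"
  have N [measurable]: "?N \<in> sets M"
  proof -
    note [measurable] = interference_factor_measurable[of 1]
    \<comment> \<open>Convergence is an event because it is visible in the limit of the exponentials
      being nonzero.\<close>
    have "?N = {\<omega>\<in>space M. interference_factor 1 \<omega> \<noteq> 0}" by (auto simp: interference_factor_def)
    also have "\<dots> \<in> sets M" by measurable
    finally show ?thesis .
  qed
  let ?t = "\<lambda>n. 1 / real (Suc n)"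
  have le: "(\<integral>\<^sup>+x\<in>{0<..}. ennreal (serving_density lam x * exp (- \<Lambda> (?t n) x)) \<partial>lborel) \<le> emeasure M ?N" for n
  proof -
    have "(\<integral>\<^sup>+x\<in>{0<..}. ennreal (serving_density lam x * exp (- \<Lambda> (?t n) x)) \<partial>lborel) =
      (\<integral>\<^sup>+\<omega>. ennreal (interference_factor (?t n) \<omega>) \<partial>M)"
      using joint_transform_factor[of UNIV "?t n" 0] by simp
    also have "\<dots> \<le> (\<integral>\<^sup>+\<omega>. indicator ?N \<omega> \<partial>M)"
    proof (rule nn_integral_mono)
      fix \<omega> assume "\<omega> \<in> space M"
      have "0 \<le> interference \<Psi> g \<eta> P \<omega>" if "summable (\<lambda>i. received (Suc i) \<omega>)"
        unfolding interference_eq using that by (rule suminf_nonneg) (rule received_nonneg)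
      then show "ennreal (interference_factor (?t n) \<omega>) \<le> indicator ?N \<omega>"
        using \<open>\<omega> \<in> space M\<close> by (auto simp: interference_factor_def indicator_def)
    qed
    finally show ?thesis by simp
  qed
  have "(\<lambda>n. \<integral>\<^sup>+x\<in>{0<..}. ennreal (serving_density lam x * exp (- \<Lambda> (?t n) x)) \<partial>lborel)
     \<longlonglongrightarrow> (\<integral>\<^sup>+x\<in>{0<..}. ennreal (serving_density lam x) \<partial>lborel)"
  proof (rule nn_integral_dominated_convergence[where w="\<lambda>x. ennreal (serving_density lam x) * indicator {0<..} x"])
    have [measurable]: "serving_density lam \<in> borel_measurable borel"
      unfolding serving_density_def[abs_def] by measurable
    show "(\<lambda>x. ennreal (serving_density lam x) * indicator {0<..} x) \<in> borel_measurable lborel"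
      "(\<lambda>x. ennreal (serving_density lam x * exp (- \<Lambda> (?t n) x)) * indicator {0<..} x) \<in> borel_measurable lborel"
      "(\<lambda>x. ennreal (serving_density lam x) * indicator {0<..} x) \<in> borel_measurable lborel" for n
      by measurable
    show "(\<integral>\<^sup>+x. ennreal (serving_density lam x) * indicator {0<..} x \<partial>lborel) < \<infinity>"
      using serving_dist_law[of "\<lambda>_. 1"] by (simp add: emeasure_space_1)
    show "AE x in lborel. ennreal (serving_density lam x * exp (- \<Lambda> (?t n) x)) * indicator {0<..} x
       \<le> ennreal (serving_density lam x) * indicator {0<..} x" for n
    proof (intro AE_I2)
      fix x
      have "serving_density lam x * exp (- \<Lambda> (?t n) x) \<le> serving_density lam x" if "0 < x"
        using that lam_pos exponent_nonneg[of "?t n" x] by (intro mult_left_le) (auto simp: serving_density_def)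
      then show "ennreal (serving_density lam x * exp (- \<Lambda> (?t n) x)) * indicator {0<..} x
       \<le> ennreal (serving_density lam x) * indicator {0<..} x"
        by (auto simp: indicator_def intro: ennreal_leI)
    qed
    show "AE x in lborel. (\<lambda>n. ennreal (serving_density lam x * exp (- \<Lambda> (?t n) x)) * indicator {0<..} x)
      \<longlonglongrightarrow> ennreal (serving_density lam x) * indicator {0<..} x"
    proof (intro AE_I2)
      fix x :: real
      show "(\<lambda>n. ennreal (serving_density lam x * exp (- \<Lambda> (?t n) x)) * indicator {0<..} x)
        \<longlonglongrightarrow> ennreal (serving_density lam x) * indicator {0<..} x"
      proof (cases "0 < x")
        case True
        let ?B = "LBINT v:{x..}. 2 * pi * lam * C * P * (v * v powr (-\<eta>))"
        have "(\<lambda>n. \<Lambda> (?t n) x) \<longlonglongrightarrow> 0"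
        proof (rule tendsto_sandwich[where f="\<lambda>_. 0" and h="\<lambda>n. ?t n * ?B"])
          show "(\<lambda>n. ?t n * ?B) \<longlonglongrightarrow> 0"
            using tendsto_mult[OF lim_1_over_n[THEN LIMSEQ_Suc] tendsto_const, of ?B] by simp
          show "\<forall>\<^sub>F n in sequentially. 0 \<le> \<Lambda> (?t n) x"
            using True by (intro always_eventually allI exponent_nonneg) auto
          show "\<forall>\<^sub>F n in sequentially. \<Lambda> (?t n) x \<le> ?t n * ?B"
            using True by (intro always_eventually allI exponent_le) auto
        qed simp
        then have "(\<lambda>n. serving_density lam x * exp (- \<Lambda> (?t n) x)) \<longlonglongrightarrow> serving_density lam x * exp (- 0)"
          by (intro tendsto_intros)
        then show ?thesis using True by (auto intro!: tendsto_ennrealI)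
      qed simp
    qed
  qed
  moreover have "(\<integral>\<^sup>+x\<in>{0<..}. ennreal (serving_density lam x) \<partial>lborel) = 1"
    using serving_dist_law[of "\<lambda>_. 1"] by (simp add: emeasure_space_1)
  ultimately have "1 \<le> emeasure M ?N" using le by (auto intro!: LIMSEQ_le_const2)
  then have "prob ?N = 1" by (simp add: emeasure_eq_measure antisym)
  from AE_prob_1[OF this] show ?thesis by (rule eventually_mono) simp
qed

lemma interference_measurable [measurable]: "interference \<Psi> g \<eta> P \<in> borel_measurable M"
  unfolding interference_eq[abs_def] by measurable

lemma signal_power_measurable [measurable]: "signal_power \<Psi> g \<eta> P \<in> borel_measurable M"
  unfolding signal_power_eq[abs_def] by measurable

lemma signal_power_nonneg: "0 \<le> signal_power \<Psi> g \<eta> P \<omega>"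
  unfolding signal_power_eq by (rule received_nonneg)

lemma AE_interference_nonneg: "AE \<omega> in M. 0 \<le> interference \<Psi> g \<eta> P \<omega>"
  using AE_interference_summable
  by eventually_elim (auto simp: interference_eq intro!: suminf_nonneg received_nonneg)

lemma joint_transform:
  assumes A: "A \<in> sets borel" and s: "0 < s" and s0: "0 \<le> s0"
  shows "(\<integral>\<^sup>+\<omega>. indicator A (r 0 \<omega>) * ennreal (exp (- s0 * signal_power \<Psi> g \<eta> P \<omega>) * exp (- s * interference \<Psi> g \<eta> P \<omega>)) \<partial>M)
    = (\<integral>\<^sup>+x\<in>{0<..}. indicator A x * ennreal (power_transform 0 (s0 * P * x powr (-\<eta>))
         * (serving_density lam x * exp (- \<Lambda> s x))) \<partial>lborel)"
proof -
  have "(\<integral>\<^sup>+\<omega>. indicator A (r 0 \<omega>) * ennreal (exp (- s0 * signal_power \<Psi> g \<eta> P \<omega>) * exp (- s * interference \<Psi> g \<eta> P \<omega>)) \<partial>M)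
   = (\<integral>\<^sup>+\<omega>. indicator A (r 0 \<omega>) * (ennreal (exp (- s0 * received 0 \<omega>)) * ennreal (interference_factor s \<omega>)) \<partial>M)"
  proof (rule nn_integral_cong_AE)
    show "AE \<omega> in M. indicator A (r 0 \<omega>) * ennreal (exp (- s0 * signal_power \<Psi> g \<eta> P \<omega>) * exp (- s * interference \<Psi> g \<eta> P \<omega>)) =
      indicator A (r 0 \<omega>) * (ennreal (exp (- s0 * received 0 \<omega>)) * ennreal (interference_factor s \<omega>))"
      using AE_interference_summable
      by eventually_elim (simp add: interference_factor_def signal_power_eq ennreal_mult)
  qed
  then show ?thesis by (simp only: joint_transform_factor[OF assms])
qed

lemma signal_transform:
  assumes [measurable]: "A \<in> sets borel" and s0: "0 \<le> s0"
  shows "(\<integral>\<^sup>+\<omega>. indicator A (r 0 \<omega>) * ennreal (exp (- s0 * signal_power \<Psi> g \<eta> P \<omega>)) \<partial>M)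
    = (\<integral>\<^sup>+x\<in>{0<..}. indicator A x * ennreal (power_transform 0 (s0 * P * x powr (-\<eta>)) * serving_density lam x) \<partial>lborel)"
proof -
  have "(\<integral>\<^sup>+\<omega>. indicator A (r 0 \<omega>) * ennreal (exp (- s0 * signal_power \<Psi> g \<eta> P \<omega>)) \<partial>M) =
     (\<integral>\<^sup>+\<omega>. indicator A (r 0 \<omega>) * ennreal (power_transform 0 (s0 * P * r 0 \<omega> powr (-\<eta>))) \<partial>M)"
    using partial_transform[of "indicator A" 0 s0 0] s0 by (simp add: signal_power_eq)
  also have "\<dots> = (\<integral>\<^sup>+x\<in>{0<..}. indicator A x * ennreal (power_transform 0 (s0 * P * x powr (-\<eta>))) * ennreal (serving_density lam x) \<partial>lborel)"
    by (rule serving_dist_law) measurable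
  finally show ?thesis
    by (simp add: ennreal_mult' power_transform_nonneg mult.assoc)
qed

end

section \<open>Frullani's integral and uniqueness of conditional transforms\<close>

lemma nn_integral_Ioi_eq_Ici:
  fixes h :: "real \<Rightarrow> ennreal"
  shows "(\<integral>\<^sup>+x\<in>{a<..}. h x \<partial>lborel) = (\<integral>\<^sup>+x\<in>{a..}. h x \<partial>lborel)"
proof (rule nn_integral_cong_AE)
  show "AE x in lborel. h x * indicator {a<..} x = h x * indicator {a..} x"
    using AE_lborel_singleton[of a] by eventually_elim (auto simp: indicator_def)
qed

text \<open>The integrand is the integral of exp(-t z) over t in [a, b]. Exchanging the order leaves
  the integral of 1/t, which is ln b - ln a.\<close>

lemma nn_integral_frullani:
  fixes a b :: real
  assumes a: "0 < a" and ab: "a \<le> b"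
  shows "(\<integral>\<^sup>+z\<in>{0<..}. ennreal ((exp (- a * z) - exp (- b * z)) / z) \<partial>lborel) = ennreal (ln (b / a))"
proof -
  have 1: "ennreal ((exp (- a * z) - exp (- b * z)) / z) = (\<integral>\<^sup>+t. ennreal (exp (- t * z)) * indicator {a..b} t \<partial>lborel)"
    if z: "0 < z" for z
  proof -
    have "(\<integral>\<^sup>+t. ennreal (exp (- t * z)) * indicator {a..b} t \<partial>lborel) = ennreal (- exp (- b * z) / z - (- exp (- a * z) / z))"
      by (rule nn_integral_FTC_Icc[OF _ _ _ ab]) (use z in \<open>auto intro!: derivative_eq_intros\<close>)
    also have "- exp (- b * z) / z - (- exp (- a * z) / z) = (exp (- a * z) - exp (- b * z)) / z"
      by (simp add: diff_divide_distrib)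
    finally show ?thesis by simp
  qed
  have 2: "(\<integral>\<^sup>+z\<in>{0<..}. ennreal (exp (- t * z)) \<partial>lborel) = ennreal (1 / t)" if t: "0 < t" for t
  proof -
    have "(\<integral>\<^sup>+z\<in>{0..}. ennreal (exp (- t * z)) \<partial>lborel) = ennreal (0 - (- exp (- t * 0) / t))"
    proof (rule nn_integral_FTC_atLeast)
      have "((\<lambda>z. exp (- (t * z))) \<longlongrightarrow> 0) at_top"
        by (intro filterlim_compose[OF exp_at_bot]) (simp add: filterlim_uminus_at_bot filterlim_tendsto_pos_mult_at_top[OF tendsto_const t filterlim_ident])
      from tendsto_minus[OF tendsto_divide[OF this tendsto_const[of t]]]
      show "((\<lambda>z. - exp (- t * z) / t) \<longlongrightarrow> 0) at_top" using t by simp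
    qed (use t in \<open>auto intro!: derivative_eq_intros\<close>)
    then show ?thesis by (simp add: nn_integral_Ioi_eq_Ici)
  qed
  have "(\<integral>\<^sup>+z\<in>{0<..}. ennreal ((exp (- a * z) - exp (- b * z)) / z) \<partial>lborel) =
    (\<integral>\<^sup>+z. \<integral>\<^sup>+t. (ennreal (exp (- t * z)) * indicator {a..b} t) * indicator {0<..} z \<partial>lborel \<partial>lborel)"
  proof (rule nn_integral_cong)
    fix z :: real
    show "ennreal ((exp (- a * z) - exp (- b * z)) / z) * indicator {0<..} z =
      (\<integral>\<^sup>+t. (ennreal (exp (- t * z)) * indicator {a..b} t) * indicator {0<..} z \<partial>lborel)"
    proof (cases "0 < z")
      case True
      then have "indicator {0<..} z = (1::ennreal)" by simp
      then show ?thesis by (simp only: 1[OF True] mult_1_right)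
    qed simp
  qed
  also have "\<dots> = (\<integral>\<^sup>+t. \<integral>\<^sup>+z. (ennreal (exp (- t * z)) * indicator {a..b} t) * indicator {0<..} z \<partial>lborel \<partial>lborel)"
    by (rule lborel_pair.Fubini') measurable
  also have "\<dots> = (\<integral>\<^sup>+t. ennreal (1 / t) * indicator {a..b} t \<partial>lborel)"
  proof (rule nn_integral_cong)
    fix t
    show "(\<integral>\<^sup>+z. (ennreal (exp (- t * z)) * indicator {a..b} t) * indicator {0<..} z \<partial>lborel) =
      ennreal (1 / t) * indicator {a..b} t"
      using a 2[of t] by (cases "t \<in> {a..b}") simp_all
  qed
  also have "\<dots> = ennreal (ln b - ln a)"
    by (rule nn_integral_FTC_Icc[OF _ _ _ ab]) (use a in \<open>auto intro!: derivative_eq_intros\<close>)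
  finally show ?thesis using a ab by (simp add: ln_div)
qed

text \<open>The two candidates, each multiplied by the density \<open>f\<close> of \<open>R\<close>,
  are densities of the same measure and hence agree almost everywhere; positivity of
  \<open>f\<close> allows it to be cancelled. This also turns null sets of the law of
  \<open>R\<close> into Lebesgue null sets of positive distances.\<close>

lemma (in prob_space) AE_conditional_nn_integral:
  assumes cl: "conditional_law M R X \<kappa>"
    and [measurable]: "R \<in> borel_measurable M" "X \<in> borel_measurable M" "\<phi> \<in> borel_measurable borel"
      "f \<in> borel_measurable borel" "T \<in> borel_measurable borel"
    and law: "\<And>h. h \<in> borel_measurable borel \<Longrightarrow> (\<integral>\<^sup>+\<omega>. h (R \<omega>) \<partial>M) = (\<integral>\<^sup>+x\<in>{0<..}. h x * ennreal (f x) \<partial>lborel)"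
    and f: "\<And>x. 0 < x \<Longrightarrow> 0 < f x" and T: "\<And>x. 0 \<le> T x"
    and eq: "\<And>A. A \<in> sets borel \<Longrightarrow>
      (\<integral>\<^sup>+\<omega>. indicator A (R \<omega>) * \<phi> (X \<omega>) \<partial>M) = (\<integral>\<^sup>+x\<in>{0<..}. indicator A x * ennreal (T x * f x) \<partial>lborel)"
  shows "AE x in lborel. 0 < x \<longrightarrow> (\<integral>\<^sup>+y. \<phi> y \<partial>\<kappa> x) = ennreal (T x)"
proof -
  have [measurable]: "\<kappa> \<in> measurable borel (subprob_algebra borel)"
    using cl unfolding conditional_law_def by (auto intro: measurable_prob_algebraD)
  let ?L = "\<lambda>x. (\<integral>\<^sup>+y. \<phi> y \<partial>\<kappa> x) * ennreal (f x) * indicator {0<..} x"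
  let ?R = "\<lambda>x. ennreal (T x * f x) * indicator {0<..} x"
  have "density lborel ?L = density lborel ?R"
  proof (rule measure_eqI)
    fix A assume "A \<in> sets (density lborel ?L)"
    then have A [measurable]: "A \<in> sets borel" by simp
    have "emeasure (density lborel ?L) A = (\<integral>\<^sup>+x\<in>{0<..}. (indicator A x * (\<integral>\<^sup>+y. \<phi> y \<partial>\<kappa> x)) * ennreal (f x) \<partial>lborel)"
      by (subst emeasure_density) (auto intro!: nn_integral_cong simp: mult_ac)
    also have "\<dots> = (\<integral>\<^sup>+\<omega>. indicator A (R \<omega>) * (\<integral>\<^sup>+y. \<phi> y \<partial>\<kappa> (R \<omega>)) \<partial>M)"
      by (rule law[symmetric]) measurable
    also have "\<dots> = (\<integral>\<^sup>+r. indicator A r * (\<integral>\<^sup>+y. \<phi> y \<partial>\<kappa> r) \<partial>distr M borel R)"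
      by (subst nn_integral_distr) auto
    also have "\<dots> = (\<integral>\<^sup>+\<omega>. indicator A (R \<omega>) * \<phi> (X \<omega>) \<partial>M)"
      by (rule conditional_law_nn_integral[OF cl, symmetric]) auto
    also have "\<dots> = emeasure (density lborel ?R) A"
      unfolding eq[OF A] by (subst emeasure_density) (auto intro!: nn_integral_cong simp: mult_ac)
    finally show "emeasure (density lborel ?L) A = emeasure (density lborel ?R) A" .
  qed simp
  then have "AE x in lborel. ?L x = ?R x"
    by (intro sigma_finite_measure.density_unique_iff[OF sigma_finite_lborel, THEN iffD1]) auto
  then show ?thesis
  proof eventually_elim
    case (elim x)
    show ?case
    proof
      assume x: "0 < x"
      from elim x have "ennreal (f x) * (\<integral>\<^sup>+y. \<phi> y \<partial>\<kappa> x) = ennreal (f x) * ennreal (T x)"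
        using T f[OF x] by (simp add: ennreal_mult mult.commute)
      then show "(\<integral>\<^sup>+y. \<phi> y \<partial>\<kappa> x) = ennreal (T x)"
        using f[OF x] by (auto simp: ennreal_mult_cancel_left)
    qed
  qed
qed

lemma laplace_eqI:
  assumes "sets \<mu> = sets borel" and "(\<integral>\<^sup>+y. ennreal (exp (- s * y)) \<partial>\<mu>) = ennreal t" "0 \<le> t"
  shows "laplace \<mu> s = t"
proof -
  have "(\<lambda>y::real. exp (- s * y)) \<in> borel_measurable \<mu>"
    unfolding measurable_cong_sets[OF assms(1) refl] by measurable
  then show ?thesis unfolding laplace_def using assms by (subst integral_eq_nn_integral) auto
qed

lemma kernel_sets: "conditional_law M R X \<kappa> \<Longrightarrow> sets (\<kappa> x) = sets borel"
  and kernel_prob: "conditional_law M R X \<kappa> \<Longrightarrow> prob_space (\<kappa> x)"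
  using measurable_space[of \<kappa> borel "prob_algebra borel" x]
  by (auto simp: conditional_law_def space_prob_algebra)

lemma measurable_laplace_kernel:
  assumes cl: "conditional_law M R X \<kappa>"
  shows "(\<lambda>x. laplace (\<kappa> x) s) \<in> borel_measurable borel"
proof -
  have [measurable]: "\<kappa> \<in> measurable borel (subprob_algebra borel)"
    using cl unfolding conditional_law_def by (auto intro: measurable_prob_algebraD)
  have "laplace (\<kappa> x) s = enn2real (\<integral>\<^sup>+y. ennreal (exp (- s * y)) \<partial>\<kappa> x)" for x
  proof -
    have "(\<lambda>y::real. exp (- s * y)) \<in> borel_measurable (\<kappa> x)"
      unfolding measurable_cong_sets[OF kernel_sets[OF cl] refl] by measurable
    then show ?thesis unfolding laplace_def by (subst integral_eq_nn_integral) auto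
  qed
  moreover have "(\<lambda>x. enn2real (\<integral>\<^sup>+y. ennreal (exp (- s * y)) \<partial>\<kappa> x)) \<in> borel_measurable borel"
    by measurable
  ultimately show ?thesis by simp
qed

section \<open>Identification of the conditional transforms and the spectral efficiency\<close>

context fading_network begin

lemma serving_dist_eq: "serving_dist \<Psi> = r 0"
  by (simp add: serving_dist_def fun_eq_iff)

lemma serving_density_measurable [measurable]: "serving_density lam \<in> borel_measurable borel"
  unfolding serving_density_def[abs_def] by measurable

lemma serving_density_pos: "0 < x \<Longrightarrow> 0 < serving_density lam x"
  using lam_pos by (simp add: serving_density_def)

text \<open>The exceptional set may depend on s. That suffices for the spectral efficiency, where
  the inner integral over the distance is taken at fixed z.\<close>

lemma AE_signal_laplace:
  assumes lawS: "conditional_law M (serving_dist \<Psi>) (signal_power \<Psi> g \<eta> P) \<kappa>S" and s: "0 \<le> s"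
  shows "AE x in lborel. 0 < x \<longrightarrow> laplace (\<kappa>S x) s = power_transform 0 (s * P * x powr (-\<eta>))"
proof -
  have "AE x in lborel. 0 < x \<longrightarrow> (\<integral>\<^sup>+y. ennreal (exp (- s * y)) \<partial>\<kappa>S x) = ennreal (power_transform 0 (s * P * x powr (-\<eta>)))"
    by (rule AE_conditional_nn_integral[OF lawS[unfolded serving_dist_eq] _ _ _ serving_density_measurable])
      (use signal_transform[OF _ s] in \<open>simp_all add: serving_dist_law serving_density_pos power_transform_nonneg\<close>)
  then show ?thesis
    by eventually_elim (auto intro!: laplace_eqI kernel_sets[OF lawS] power_transform_nonneg)
qed

lemma AE_interference_laplace_fixed:
  assumes lawI: "conditional_law M (serving_dist \<Psi>) (interference \<Psi> g \<eta> P) \<kappa>I" and s: "0 < s"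
  shows "AE x in lborel. 0 < x \<longrightarrow> laplace (\<kappa>I x) s = exp (- \<Lambda> s x)"
proof -
  have eq: "(\<integral>\<^sup>+\<omega>. indicator A (r 0 \<omega>) * ennreal (exp (- s * interference \<Psi> g \<eta> P \<omega>)) \<partial>M) =
     (\<integral>\<^sup>+x\<in>{0<..}. indicator A x * ennreal (exp (- \<Lambda> s x) * serving_density lam x) \<partial>lborel)" if "A \<in> sets borel" for A
    using joint_transform[OF that s, of 0] by (simp add: mult.commute[of "exp (- \<Lambda> s _)"])
  have "AE x in lborel. 0 < x \<longrightarrow> (\<integral>\<^sup>+y. ennreal (exp (- s * y)) \<partial>\<kappa>I x) = ennreal (exp (- \<Lambda> s x))"
    by (rule AE_conditional_nn_integral[OF lawI[unfolded serving_dist_eq] _ _ _ serving_density_measurable _ _ _ _ eq])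
      (simp_all add: serving_dist_law serving_density_pos)
  then show ?thesis
    by eventually_elim (auto intro!: laplace_eqI kernel_sets[OF lawI])
qed

text \<open>Continuity in s of the transform of a kernel requires its mass to lie on the nonnegative
  reals. For an arbitrary version this holds only at almost every distance, by applying the
  uniqueness argument to the indicator of the negative reals.\<close>

lemma AE_kernel_nonneg:
  assumes lawI: "conditional_law M (serving_dist \<Psi>) (interference \<Psi> g \<eta> P) \<kappa>I"
  shows "AE x in lborel. 0 < x \<longrightarrow> (AE y in \<kappa>I x. 0 \<le> y)"
proof -
  have eq: "(\<integral>\<^sup>+\<omega>. indicator A (r 0 \<omega>) * indicator {..<0} (interference \<Psi> g \<eta> P \<omega>) \<partial>M) =
     (\<integral>\<^sup>+x\<in>{0<..}. indicator A x * ennreal (0 * serving_density lam x) \<partial>lborel)" if [measurable]: "A \<in> sets borel" for A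
  proof -
    have "AE \<omega> in M. indicator A (r 0 \<omega>) * indicator {..<0} (interference \<Psi> g \<eta> P \<omega>) = (0::ennreal)"
      using AE_interference_nonneg by eventually_elim (auto simp: indicator_def)
    then have "(\<integral>\<^sup>+\<omega>. indicator A (r 0 \<omega>) * indicator {..<0} (interference \<Psi> g \<eta> P \<omega>) \<partial>M) = 0"
      by (subst nn_integral_0_iff_AE) auto
    then show ?thesis by simp
  qed
  have "AE x in lborel. 0 < x \<longrightarrow> (\<integral>\<^sup>+y. indicator {..<0} y \<partial>\<kappa>I x) = ennreal 0"
    by (rule AE_conditional_nn_integral[OF lawI[unfolded serving_dist_eq] _ _ _ serving_density_measurable _ _ _ _ eq])
      (simp_all add: serving_dist_law serving_density_pos)
  then show ?thesis
  proof eventually_elim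
    case (elim x)
    have sets: "sets (\<kappa>I x) = sets borel" by (rule kernel_sets[OF lawI])
    show ?case
    proof
      assume "0 < x"
      with elim have "(\<integral>\<^sup>+y. indicator {..<0} y \<partial>\<kappa>I x) = 0" by simp
      then have "emeasure (\<kappa>I x) {..<0} = 0" by (subst (asm) nn_integral_indicator) (simp_all add: sets)
      then show "AE y in \<kappa>I x. 0 \<le> y"
        by (intro AE_I[of _ _ "{..<0}"]) (auto simp: sets)
    qed
  qed
qed

text \<open>A convergent sequence of rates has a bound B, and the defect of the weight is at most
  linear in the rate, so one multiple of v^(1 - eta) dominates all integrands.\<close>

lemma exponent_continuous:
  assumes x: "0 < x"
  shows "continuous_on {0<..} (\<lambda>s. \<Lambda> s x)"
proof (rule continuous_on_sequentiallyI)
  fix u :: "nat \<Rightarrow> real" and a assume u: "\<forall>n. u n \<in> {0<..}" "a \<in> {0<..}" "u \<longlonglongrightarrow> a"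
  obtain B where B: "\<And>n. u n \<le> B"
    using convergent_imp_bounded[OF u(3)] by (auto simp: bounded_iff) (meson abs_le_D1)
  have B0: "0 \<le> B" using B[of 0] u(1) by (metis greaterThan_iff less_eq_real_def order_trans)
  have lim: "(\<lambda>n. weight (u n) v) \<longlonglongrightarrow> weight a v" for v
  proof -
    have "continuous_on {0..} (power_transform 1)"
      unfolding power_transform_def[abs_def] by (rule laplace_transform_continuous) auto
    moreover have "(\<lambda>n. u n * P * v powr (-\<eta>)) \<longlonglongrightarrow> a * P * v powr (-\<eta>)" by (intro tendsto_intros u)
    ultimately show ?thesis unfolding weight_def
      by (rule continuous_on_tendsto_compose) (use u P_pos in \<open>auto simp: less_imp_le intro!: always_eventually mult_nonneg_nonneg\<close>)
  qed
  show "(\<lambda>n. \<Lambda> (u n) x) \<longlonglongrightarrow> \<Lambda> a x"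
    unfolding interference_exponent_def set_lebesgue_integral_def
  proof (rule integral_dominated_convergence[where w="\<lambda>v. indicator {x..} v *\<^sub>R (B * (2 * pi * lam * C * P) * (v * v powr (-\<eta>)))"])
    show "integrable lborel (\<lambda>v. indicator {x..} v *\<^sub>R (B * (2 * pi * lam * C * P) * (v * v powr (-\<eta>))))"
      using ring_weight_integrable[OF x] unfolding set_integrable_def .
    show "AE v in lborel. (\<lambda>n. indicator {x..} v *\<^sub>R (2 * pi * lam * v * (1 - weight (u n) v))) \<longlonglongrightarrow>
       indicator {x..} v *\<^sub>R (2 * pi * lam * v * (1 - weight a v))"
      by (intro AE_I2 tendsto_intros lim)
    fix n
    show "AE v in lborel. norm (indicat_real {x..} v *\<^sub>R (2 * pi * lam * v * (1 - weight (u n) v)))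
      \<le> indicator {x..} v *\<^sub>R (B * (2 * pi * lam * C * P) * (v * v powr (-\<eta>)))"
    proof (intro AE_I2)
      fix v
      have un: "0 \<le> u n" using u(1) by (simp add: less_imp_le)
      interpret W: point_weight lam "weight (u n)" by (rule point_weight[OF un])
      have "2 * pi * lam * v * (1 - weight (u n) v) \<le> B * (2 * pi * lam * C * P) * (v * v powr (-\<eta>))" if "x \<le> v"
      proof -
        have "2 * pi * lam * v * (1 - weight (u n) v) \<le> 2 * pi * lam * v * (u n * (C * P * v powr (-\<eta>)))"
          using that x lam_pos un by (intro mult_left_mono weight_defect) auto
        also have "\<dots> \<le> 2 * pi * lam * v * (B * (C * P * v powr (-\<eta>)))"
          using that x lam_pos C_nonneg P_pos B by (intro mult_left_mono mult_right_mono) auto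
        finally show ?thesis by (simp add: mult_ac)
      qed
      then have "x \<le> v \<Longrightarrow> \<bar>2 * pi * lam * v * (1 - weight (u n) v)\<bar> \<le> B * (2 * pi * lam * C * P) * (v * v powr (-\<eta>))"
        using W.ring_rate_nonneg[of v] x by (simp only: abs_of_nonneg)
      then show "norm (indicat_real {x..} v *\<^sub>R (2 * pi * lam * v * (1 - weight (u n) v)))
        \<le> indicator {x..} v *\<^sub>R (B * (2 * pi * lam * C * P) * (v * v powr (-\<eta>)))"
        by (simp only: indicator_def atLeast_iff real_norm_def) simp
    qed
  qed auto
qed

text \<open>The null sets of the countably many positive rational s are united. At a remaining
  distance both sides are continuous in s > 0 and agree on a dense set.\<close>

theorem AE_interference_laplace:
  assumes lawI: "conditional_law M (serving_dist \<Psi>) (interference \<Psi> g \<eta> P) \<kappa>I"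
  shows "AE x in lborel. 0 < x \<longrightarrow> (\<forall>s>0. laplace (\<kappa>I x) s = exp (- \<Lambda> s x))"
proof -
  have "AE x in lborel. \<forall>s\<in>\<rat> \<inter> {0<..}. 0 < x \<longrightarrow> laplace (\<kappa>I x) s = exp (- \<Lambda> s x)"
    using AE_interference_laplace_fixed[OF lawI]
    by (subst AE_ball_countable) (auto simp: countable_rat)
  then show ?thesis using AE_kernel_nonneg[OF lawI]
  proof eventually_elim
    case (elim x)
    show ?case
    proof (intro impI allI)
      fix s :: real assume x: "0 < x" and s: "0 < s"
      interpret K: prob_space "\<kappa>I x" by (rule kernel_prob[OF lawI])
      have "(\<lambda>y. y) \<in> borel_measurable (\<kappa>I x)"
        unfolding measurable_cong_sets[OF kernel_sets[OF lawI] refl] by simp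
      from K.laplace_transform_continuous[OF this] elim(2) x
      have "continuous_on {0..} (laplace (\<kappa>I x))" by (simp add: laplace_def[abs_def])
      then have c1: "continuous_on {0<..} (laplace (\<kappa>I x))" by (rule continuous_on_subset) auto
      have c2: "continuous_on {0<..} (\<lambda>s. exp (- \<Lambda> s x))"
        by (intro continuous_intros exponent_continuous x)
      have "s \<in> {0<..} \<inter> closure \<rat>" using s by (simp add: Rats_closure_real)
      then have "s \<in> closure ({0<..} \<inter> \<rat>)" using open_Int_closure_subset[of "{0::real<..}" \<rat>] by auto
      then obtain u where u: "\<And>n. u n \<in> {0<..} \<inter> \<rat>" "u \<longlonglongrightarrow> s" unfolding closure_sequential by blast
      have l1: "(\<lambda>n. laplace (\<kappa>I x) (u n)) \<longlonglongrightarrow> laplace (\<kappa>I x) s"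
        by (rule continuous_on_tendsto_compose[OF c1 u(2)]) (use u s in auto)
      have l2: "(\<lambda>n. exp (- \<Lambda> (u n) x)) \<longlonglongrightarrow> exp (- \<Lambda> s x)"
        by (rule continuous_on_tendsto_compose[OF c2 u(2)]) (use u s in auto)
      have "laplace (\<kappa>I x) (u n) = exp (- \<Lambda> (u n) x)" for n using elim(1) u(1)[of n] x by auto
      then show "laplace (\<kappa>I x) s = exp (- \<Lambda> s x)" using LIMSEQ_unique[OF l1] l2 by simp
    qed
  qed
qed


text \<open>A real-valued form with integrability, because the transforms at s0 = 0 and s0 = s are
  going to be subtracted.\<close>

lemma joint_transform_Bochner:
  assumes s: "0 < s" and s0: "0 \<le> s0"
  shows "has_bochner_integral lborel
      (\<lambda>x. indicator {0<..} x *\<^sub>R (power_transform 0 (s0 * P * x powr (-\<eta>)) * (serving_density lam x * exp (- \<Lambda> s x))))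
      (expectation (\<lambda>\<omega>. exp (- s0 * signal_power \<Psi> g \<eta> P \<omega>) * exp (- s * interference \<Psi> g \<eta> P \<omega>)))"
    and "integrable M (\<lambda>\<omega>. exp (- s0 * signal_power \<Psi> g \<eta> P \<omega>) * exp (- s * interference \<Psi> g \<eta> P \<omega>))"
proof -
  let ?J = "\<lambda>\<omega>. exp (- s0 * signal_power \<Psi> g \<eta> P \<omega>) * exp (- s * interference \<Psi> g \<eta> P \<omega>)"
  have "AE \<omega> in M. norm (?J \<omega>) \<le> 1"
    using AE_interference_nonneg
  proof eventually_elim
    case (elim \<omega>)
    have "?J \<omega> \<le> 1 * 1" using elim s s0 signal_power_nonneg[of \<omega>] by (intro mult_mono) auto
    then show ?case by simp
  qed
  then show i: "integrable M ?J" by (intro integrable_const_bound[where B=1]) auto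
  have "(\<integral>\<^sup>+x. ennreal (indicator {0<..} x *\<^sub>R (power_transform 0 (s0 * P * x powr (-\<eta>)) * (serving_density lam x * exp (- \<Lambda> s x)))) \<partial>lborel)
    = (\<integral>\<^sup>+x\<in>{0<..}. indicator UNIV x * ennreal (power_transform 0 (s0 * P * x powr (-\<eta>)) * (serving_density lam x * exp (- \<Lambda> s x))) \<partial>lborel)"
    by (intro nn_integral_cong) (auto simp: indicator_def)
  also have "\<dots> = (\<integral>\<^sup>+\<omega>. ennreal (?J \<omega>) \<partial>M)"
    by (subst joint_transform[OF _ s s0, symmetric]) auto
  also have "\<dots> = ennreal (expectation ?J)"
    by (rule nn_integral_eq_integral[OF i]) auto
  finally show "has_bochner_integral lborel
      (\<lambda>x. indicator {0<..} x *\<^sub>R (power_transform 0 (s0 * P * x powr (-\<eta>)) * (serving_density lam x * exp (- \<Lambda> s x))))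
      (expectation ?J)"
    by (intro has_bochner_integral_nn_integral)
       (auto simp: indicator_def less_imp_le[OF serving_density_pos] power_transform_nonneg)
qed

theorem avg_spectral_efficiency_eq:
  assumes lawS: "conditional_law M (serving_dist \<Psi>) (signal_power \<Psi> g \<eta> P) \<kappa>S"
    and lawI: "conditional_law M (serving_dist \<Psi>) (interference \<Psi> g \<eta> P) \<kappa>I" and N: "0 < N"
  shows "avg_spectral_efficiency M \<Psi> g \<eta> P N =
       (LBINT z:{0<..}. (LBINT x:{0<..}.
          laplace (\<kappa>I x) (z / N) * (1 - laplace (\<kappa>S x) (z / N)) * (exp (-z) / z) * serving_density lam x))"
proof -
  let ?S = "signal_power \<Psi> g \<eta> P" and ?I = "interference \<Psi> g \<eta> P"
  let ?F = "\<lambda>z. LBINT x:{0<..}. laplace (\<kappa>I x) (z / N) * (1 - laplace (\<kappa>S x) (z / N)) * (exp (-z) / z) * serving_density lam x"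
  \<comment> \<open>The Frullani integrand with a = 1 + I/N and b = a + S/N, for which b/a = 1 +
    SINR.\<close>
  let ?G = "\<lambda>z \<omega>. (exp (- (1 + ?I \<omega> / N) * z) - exp (- (1 + ?I \<omega> / N + ?S \<omega> / N) * z)) / z"
  have G0: "0 \<le> ?G z \<omega>" if "0 < z" for z \<omega>
    using that signal_power_nonneg[of \<omega>] N by (intro divide_nonneg_nonneg) (auto simp: algebra_simps)
  have F: "?F z = expectation (?G z) \<and> integrable M (?G z)" if z: "0 < z" for z
  proof -
    define s where "s = z / N"
    have s: "0 < s" "0 \<le> s" using z N by (auto simp: s_def)
    let ?J = "\<lambda>s0 \<omega>. exp (- s0 * ?S \<omega>) * exp (- s * ?I \<omega>)"
    let ?T = "\<lambda>s0 x. power_transform 0 (s0 * P * x powr (-\<eta>)) * (serving_density lam x * exp (- \<Lambda> s x))"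
    note b0 = joint_transform_Bochner[OF s(1) order_refl] and b1 = joint_transform_Bochner[OF s]
    have d: "integrable lborel (\<lambda>x. indicator {0<..} x *\<^sub>R ?T 0 x)" "integrable lborel (\<lambda>x. indicator {0<..} x *\<^sub>R ?T s x)"
      "(LINT x|lborel. indicator {0<..} x *\<^sub>R ?T 0 x) = expectation (?J 0)"
      "(LINT x|lborel. indicator {0<..} x *\<^sub>R ?T s x) = expectation (?J s)"
      using b0(1) b1(1) by (simp_all only: has_bochner_integral_iff)
    \<comment> \<open>In \<open>?T\<close> the transform of the signal and that of the interference
      are separate factors, which is their conditional independence given the distance. The factor
      \<open>1 - laplace\<close> becomes the difference between s0 = 0 and s0 = s.\<close>
    have "?F z = (LINT x|lborel. (exp (-z) / z) * (indicator {0<..} x *\<^sub>R ?T 0 x - indicator {0<..} x *\<^sub>R ?T s x))"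
      unfolding set_lebesgue_integral_def
    proof (rule integral_cong_AE)
      note [measurable] = measurable_laplace_kernel[OF lawS] measurable_laplace_kernel[OF lawI]
      show "(\<lambda>x. indicat_real {0<..} x *\<^sub>R (laplace (\<kappa>I x) (z / N) * (1 - laplace (\<kappa>S x) (z / N)) * (exp (-z) / z) * serving_density lam x)) \<in> borel_measurable lborel"
        "(\<lambda>x. (exp (-z) / z) * (indicator {0<..} x *\<^sub>R ?T 0 x - indicator {0<..} x *\<^sub>R ?T s x)) \<in> borel_measurable lborel"
        by measurable
      show "AE x in lborel. indicat_real {0<..} x *\<^sub>R (laplace (\<kappa>I x) (z / N) * (1 - laplace (\<kappa>S x) (z / N)) * (exp (-z) / z) * serving_density lam x)
        = (exp (-z) / z) * (indicator {0<..} x *\<^sub>R ?T 0 x - indicator {0<..} x *\<^sub>R ?T s x)"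
        using AE_signal_laplace[OF lawS s(2)] AE_interference_laplace_fixed[OF lawI s(1)]
        by eventually_elim (auto simp: indicator_def algebra_simps s_def[symmetric])
    qed
    also have "\<dots> = (exp (-z) / z) * (expectation (?J 0) - expectation (?J s))"
      using d by (simp only: Bochner_Integration.integral_diff integral_mult_right_zero)
    also have "\<dots> = expectation (\<lambda>\<omega>. (exp (-z) / z) * (?J 0 \<omega> - ?J s \<omega>))"
      by (simp only: Bochner_Integration.integral_diff[OF b0(2) b1(2)] integral_mult_right_zero)
    also have eq: "(\<lambda>\<omega>. (exp (-z) / z) * (?J 0 \<omega> - ?J s \<omega>)) = ?G z"
      by (auto simp: fun_eq_iff s_def exp_add[symmetric] field_simps simp flip: exp_add)
    finally have "?F z = expectation (?G z)" .
    moreover have "integrable M (\<lambda>\<omega>. (exp (-z) / z) * (?J 0 \<omega> - ?J s \<omega>))"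
      by (intro integrable_mult_right Bochner_Integration.integrable_diff b0(2) b1(2))
    ultimately show ?thesis unfolding eq by blast
  qed
  have "(\<integral>\<^sup>+\<omega>. ennreal (ln (1 + sinr \<Psi> g \<eta> P N \<omega>)) \<partial>M) = (\<integral>\<^sup>+\<omega>. (\<integral>\<^sup>+z. ennreal (?G z \<omega>) * indicator {0<..} z \<partial>lborel) \<partial>M)"
  proof (rule nn_integral_cong_AE)
    show "AE \<omega> in M. ennreal (ln (1 + sinr \<Psi> g \<eta> P N \<omega>)) = (\<integral>\<^sup>+z. ennreal (?G z \<omega>) * indicator {0<..} z \<partial>lborel)"
      using AE_interference_nonneg
    proof eventually_elim
      case (elim \<omega>)
      let ?a = "1 + ?I \<omega> / N" and ?b = "1 + ?I \<omega> / N + ?S \<omega> / N"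
      have a: "0 < ?a" "?a \<le> ?b" using elim N signal_power_nonneg[of \<omega>] by (auto simp: add_pos_nonneg)
      have "?b / ?a = 1 + sinr \<Psi> g \<eta> P N \<omega>"
      proof -
        have "0 < N + ?I \<omega>" using elim N by simp
        moreover have "?a = (N + ?I \<omega>) / N" "?b = (N + ?I \<omega> + ?S \<omega>) / N" using N by (simp_all add: add_divide_distrib)
        then have "?b / ?a = (N + ?I \<omega> + ?S \<omega>) / (N + ?I \<omega>)" using N by (simp only:) simp
        ultimately show ?thesis by (simp only: sinr_def) (simp add: field_simps)
      qed
      then show ?case using nn_integral_frullani[OF a] by simp
    qed
  qed
  also have "\<dots> = (\<integral>\<^sup>+z. (\<integral>\<^sup>+\<omega>. ennreal (?G z \<omega>) * indicator {0<..} z \<partial>M) \<partial>lborel)"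
  proof -
    interpret pair_sigma_finite M lborel by standard
    show ?thesis by (rule Fubini'[symmetric]) measurable
  qed
  also have "\<dots> = (\<integral>\<^sup>+z. ennreal (indicator {0<..} z *\<^sub>R ?F z) \<partial>lborel)"
  proof (rule nn_integral_cong)
    fix z :: real
    show "(\<integral>\<^sup>+\<omega>. ennreal (?G z \<omega>) * indicator {0<..} z \<partial>M) = ennreal (indicator {0<..} z *\<^sub>R ?F z)"
    proof (cases "0 < z")
      case True
      have "(\<integral>\<^sup>+\<omega>. ennreal (?G z \<omega>) \<partial>M) = ennreal (?F z)"
        using F[OF True] G0[OF True] by (subst nn_integral_eq_integral) auto
      then show ?thesis using True by simp
    qed simp
  qed
  finally have eq: "(\<integral>\<^sup>+\<omega>. ennreal (ln (1 + sinr \<Psi> g \<eta> P N \<omega>)) \<partial>M) = (\<integral>\<^sup>+z. ennreal (indicator {0<..} z *\<^sub>R ?F z) \<partial>lborel)" .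
  \<comment> \<open>Both sides are \<open>enn2real\<close> of the same nonnegative integral, so the
    identity holds whether or not its value is finite.\<close>
  have "avg_spectral_efficiency M \<Psi> g \<eta> P N = enn2real (\<integral>\<^sup>+\<omega>. ennreal (ln (1 + sinr \<Psi> g \<eta> P N \<omega>)) \<partial>M)"
    unfolding avg_spectral_efficiency_def
  proof (rule integral_eq_nn_integral)
    show "(\<lambda>\<omega>. ln (1 + sinr \<Psi> g \<eta> P N \<omega>)) \<in> borel_measurable M" unfolding sinr_def by measurable
    show "AE \<omega> in M. 0 \<le> ln (1 + sinr \<Psi> g \<eta> P N \<omega>)"
      using AE_interference_nonneg
      by eventually_elim (use N signal_power_nonneg in \<open>auto simp: sinr_def intro!: ln_ge_zero divide_nonneg_nonneg\<close>)
  qed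
  also have "\<dots> = (LINT z|lborel. indicator {0<..} z *\<^sub>R ?F z)"
    unfolding eq
  proof (rule integral_eq_nn_integral[symmetric])
    have "(\<lambda>z. indicator {0<..} z *\<^sub>R expectation (?G z)) \<in> borel_measurable lborel"
    proof -
      have "(\<lambda>(z, \<omega>). ?G z \<omega>) \<in> borel_measurable (lborel \<Otimes>\<^sub>M M)" by measurable
      from borel_measurable_lebesgue_integral[OF this] show ?thesis by simp
    qed
    also have "(\<lambda>z. indicator {0<..} z *\<^sub>R expectation (?G z)) = (\<lambda>z. indicator {0<..} z *\<^sub>R ?F z)"
    proof
      fix z :: real
      show "indicator {0<..} z *\<^sub>R expectation (?G z) = indicator {0<..} z *\<^sub>R ?F z"
        using F[of z] by (cases "0 < z") simp_all
    qed
    finally show "(\<lambda>z. indicator {0<..} z *\<^sub>R ?F z) \<in> borel_measurable lborel" .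
    show "AE z in lborel. 0 \<le> indicator {0<..} z *\<^sub>R ?F z"
    proof (rule AE_I2)
      fix z :: real
      have "0 \<le> ?F z" if "0 < z"
      proof -
        have "0 \<le> expectation (?G z)" by (rule Bochner_Integration.integral_nonneg) (rule G0[OF that])
        then show ?thesis by (subst conjunct1[OF F[OF that]])
      qed
      then show "0 \<le> indicator {0<..} z *\<^sub>R ?F z" by (cases "0 < z") simp_all
    qed
  qed
  finally show ?thesis by (simp add: set_lebesgue_integral_def)
qed

end

section \<open>The phase average\<close>

text \<open>A mean-value estimate in the form that dominates the difference quotients in
  \<open>z_deriv\<close> by a constant.\<close>

lemma exp_minus_diff_le:
  fixes a b :: real
  shows "\<bar>exp a - exp b\<bar> \<le> \<bar>a - b\<bar> * exp (\<bar>a\<bar> + \<bar>b\<bar>)"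
proof -
  have *: "exp a - exp b \<le> \<bar>a - b\<bar> * exp (\<bar>a\<bar> + \<bar>b\<bar>)" for a b :: real
  proof -
    have "exp a - exp b = exp a * (1 - exp (b - a))" by (simp add: algebra_simps flip: exp_add)
    also have "\<dots> \<le> exp a * (a - b)"
    proof (rule mult_left_mono)
      show "1 - exp (b - a) \<le> a - b" using exp_ge_add_one_self[of "b - a"] by linarith
    qed simp
    also have "\<dots> \<le> exp a * \<bar>a - b\<bar>" by (intro mult_left_mono) auto
    also have "\<dots> \<le> exp (\<bar>a\<bar> + \<bar>b\<bar>) * \<bar>a - b\<bar>" by (intro mult_right_mono) auto
    finally show ?thesis by (simp add: mult.commute)
  qed
  show ?thesis using *[of a b] *[of b a] by (simp add: abs_le_iff abs_minus_commute add.commute)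
qed

locale phase_law = prob_space \<nu> for \<nu> :: "real measure" +
  fixes \<Delta> :: real
  assumes sets_\<nu> [measurable_cong, simp]: "sets \<nu> = sets borel" and \<Delta>: "\<bar>\<Delta>\<bar> \<le> 1"
begin

text \<open>The specular power at phase difference \<alpha> divided by V1^2 + V2^2.\<close>

definition c :: "real \<Rightarrow> real" where "c \<alpha> = 1 + \<Delta> * cos \<alpha>"

lemma c_measurable [measurable]: "c \<in> borel_measurable borel"
  unfolding c_def[abs_def] by measurable

lemma c_bounds: "0 \<le> c \<alpha>" "c \<alpha> \<le> 2"
proof -
  have "\<bar>\<Delta> * cos \<alpha>\<bar> \<le> 1 * 1" unfolding abs_mult using \<Delta> abs_cos_le_one by (intro mult_mono) auto
  then show "0 \<le> c \<alpha>" "c \<alpha> \<le> 2" unfolding c_def by auto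
qed

text \<open>\<open>z\<close> is zeta1 for the phase law \<nu>. \<open>z'\<close> is minus its
  derivative, a choice that makes it nonnegative.\<close>

definition z :: "real \<Rightarrow> real" where "z x = (LINT \<alpha>|\<nu>. exp (- x * c \<alpha>))"
definition z' :: "real \<Rightarrow> real" where "z' x = (LINT \<alpha>|\<nu>. c \<alpha> * exp (- x * c \<alpha>))"

lemma exp_c_le: "exp (- x * c \<alpha>) \<le> exp (2 * \<bar>x\<bar>)"
proof -
  have "- x * c \<alpha> \<le> \<bar>x\<bar> * c \<alpha>" using c_bounds[of \<alpha>] by (intro mult_right_mono) auto
  also have "\<dots> \<le> \<bar>x\<bar> * 2" using c_bounds[of \<alpha>] by (intro mult_left_mono) auto
  finally show ?thesis by (simp add: mult.commute)
qed

lemma z_integrable: "integrable \<nu> (\<lambda>\<alpha>. exp (- x * c \<alpha>))"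
  by (rule integrable_const_bound[where B="exp (2 * \<bar>x\<bar>)"]) (use exp_c_le in auto)

lemma z'_integrable: "integrable \<nu> (\<lambda>\<alpha>. c \<alpha> * exp (- x * c \<alpha>))"
proof (rule integrable_const_bound[where B="2 * exp (2 * \<bar>x\<bar>)"])
  show "AE \<alpha> in \<nu>. norm (c \<alpha> * exp (- x * c \<alpha>)) \<le> 2 * exp (2 * \<bar>x\<bar>)"
  proof (intro AE_I2)
    fix \<alpha>
    have "c \<alpha> * exp (- x * c \<alpha>) \<le> 2 * exp (2 * \<bar>x\<bar>)"
      using c_bounds[of \<alpha>] exp_c_le[of x \<alpha>] by (intro mult_mono) auto
    then show "norm (c \<alpha> * exp (- x * c \<alpha>)) \<le> 2 * exp (2 * \<bar>x\<bar>)" using c_bounds[of \<alpha>] by simp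
  qed
qed measurable

lemma z_deriv: "(z has_real_derivative - z' x) (at x)"
  unfolding DERIV_def tendsto_at_iff_sequentially comp_def
proof (intro allI impI)
  fix X :: "nat \<Rightarrow> real" assume X: "\<forall>i. X i \<in> UNIV - {0}" and X0: "X \<longlonglongrightarrow> 0"
  obtain B where B: "\<And>n. \<bar>X n\<bar> \<le> B"
    using convergent_imp_bounded[OF X0] by (auto simp: bounded_iff)
  let ?q = "\<lambda>n \<alpha>. (exp (- (x + X n) * c \<alpha>) - exp (- x * c \<alpha>)) / X n"
  have "(\<lambda>n. LINT \<alpha>|\<nu>. ?q n \<alpha>) \<longlonglongrightarrow> (LINT \<alpha>|\<nu>. - (c \<alpha> * exp (- x * c \<alpha>)))"
  \<comment> \<open>From \<open>exp_minus_diff_le\<close>: \<open>c\<close> is at most 2, and |x + X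
    n| + |x| is at most 2 |x| + B.\<close>
  proof (rule integral_dominated_convergence[where w="\<lambda>_. 2 * exp (2 * (2 * \<bar>x\<bar> + B))"])
    show "AE \<alpha> in \<nu>. (\<lambda>n. ?q n \<alpha>) \<longlonglongrightarrow> - (c \<alpha> * exp (- x * c \<alpha>))"
    proof (intro AE_I2)
      fix \<alpha>
      have "((\<lambda>x. exp (- x * c \<alpha>)) has_real_derivative - (c \<alpha> * exp (- x * c \<alpha>))) (at x)"
        by (auto intro!: derivative_eq_intros)
      then show "(\<lambda>n. ?q n \<alpha>) \<longlonglongrightarrow> - (c \<alpha> * exp (- x * c \<alpha>))"
        unfolding DERIV_def tendsto_at_iff_sequentially comp_def using X X0 by blast
    qed
    fix n
    show "AE \<alpha> in \<nu>. norm (?q n \<alpha>) \<le> 2 * exp (2 * (2 * \<bar>x\<bar> + B))"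
    proof (intro AE_I2)
      fix \<alpha>
      have Xn: "0 < \<bar>X n\<bar>" using X by auto
      have "\<bar>exp (- (x + X n) * c \<alpha>) - exp (- x * c \<alpha>)\<bar> \<le>
         \<bar>- (x + X n) * c \<alpha> - (- x * c \<alpha>)\<bar> * exp (\<bar>- (x + X n) * c \<alpha>\<bar> + \<bar>- x * c \<alpha>\<bar>)"
        by (rule exp_minus_diff_le)
      also have "\<bar>- (x + X n) * c \<alpha> - (- x * c \<alpha>)\<bar> = \<bar>X n\<bar> * c \<alpha>"
        using c_bounds[of \<alpha>] by (simp add: algebra_simps abs_mult)
      also have "\<dots> * exp (\<bar>- (x + X n) * c \<alpha>\<bar> + \<bar>- x * c \<alpha>\<bar>) \<le> (\<bar>X n\<bar> * 2) * exp (2 * (2 * \<bar>x\<bar> + B))"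
      proof (intro mult_mono)
        have "\<bar>- (x + X n) * c \<alpha>\<bar> + \<bar>- x * c \<alpha>\<bar> = (\<bar>x + X n\<bar> + \<bar>x\<bar>) * c \<alpha>"
          by (simp only: abs_mult abs_minus_cancel abs_of_nonneg[OF c_bounds(1)] distrib_right)
        also have "\<dots> \<le> (2 * \<bar>x\<bar> + B) * 2"
          using c_bounds[of \<alpha>] B[of n] by (intro mult_mono) auto
        finally show "exp (\<bar>- (x + X n) * c \<alpha>\<bar> + \<bar>- x * c \<alpha>\<bar>) \<le> exp (2 * (2 * \<bar>x\<bar> + B))"
          by (simp add: mult.commute)
      qed (use c_bounds in auto)
      finally show "norm (?q n \<alpha>) \<le> 2 * exp (2 * (2 * \<bar>x\<bar> + B))"
        using Xn by (simp add: abs_divide divide_le_eq mult_ac)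
    qed
  qed auto
  moreover have "(LINT \<alpha>|\<nu>. ?q n \<alpha>) = (z (x + X n) - z x) / X n" for n
    unfolding z_def by (simp only: integral_divide_zero Bochner_Integration.integral_diff[OF z_integrable z_integrable])
  moreover have "(LINT \<alpha>|\<nu>. - (c \<alpha> * exp (- x * c \<alpha>))) = - z' x"
    by (simp only: z'_def Bochner_Integration.integral_minus)
  ultimately show "(\<lambda>n. (z (x + X n) - z x) / X n) \<longlonglongrightarrow> - z' x"
    by (simp only:)
qed

lemma z_0 [simp]: "z 0 = 1" by (simp add: z_def prob_space)

lemma z_nonneg: "0 \<le> z x" unfolding z_def by simp

lemma z'_nonneg: "0 \<le> z' x" unfolding z'_def using c_bounds by (intro integral_nonneg_AE) auto

lemma z_le_1: "0 \<le> x \<Longrightarrow> z x \<le> 1"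
proof -
  assume x: "0 \<le> x"
  have "z x \<le> (LINT \<alpha>|\<nu>. 1)" unfolding z_def
    by (rule integral_mono[OF z_integrable]) (use x c_bounds in \<open>auto\<close>)
  then show ?thesis by (simp add: prob_space)
qed

lemma z_ge: "0 \<le> x \<Longrightarrow> 1 - 2 * x \<le> z x"
proof -
  assume x: "0 \<le> x"
  have "(LINT \<alpha>|\<nu>. 1 - 2 * x) \<le> z x" unfolding z_def
  proof (rule integral_mono[OF _ z_integrable])
    fix \<alpha>
    have "1 - 2 * x \<le> 1 + - x * c \<alpha>" using mult_left_mono[OF c_bounds(2) x, of \<alpha>] by simp
    also have "\<dots> \<le> exp (- x * c \<alpha>)" by (rule exp_ge_add_one_self)
    finally show "1 - 2 * x \<le> exp (- x * c \<alpha>)" .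
  qed simp
  then show ?thesis by (simp add: prob_space)
qed

lemma z_continuous: "isCont z x"
  using z_deriv by (rule DERIV_isCont)

lemma z_measurable [measurable]: "z \<in> borel_measurable borel"
proof -
  have "(\<lambda>(x, \<alpha>). exp (- x * c \<alpha>)) \<in> borel_measurable (borel \<Otimes>\<^sub>M \<nu>)" by measurable
  from borel_measurable_lebesgue_integral[OF this] show ?thesis by (simp add: z_def[abs_def])
qed

lemma z'_measurable [measurable]: "z' \<in> borel_measurable borel"
proof -
  have "(\<lambda>(x, \<alpha>). c \<alpha> * exp (- x * c \<alpha>)) \<in> borel_measurable (borel \<Otimes>\<^sub>M \<nu>)" by measurable
  from borel_measurable_lebesgue_integral[OF this] show ?thesis by (simp add: z'_def[abs_def])
qed

text \<open>The Laplace transform of the interfering power at \<open>t\<close> is \<open>1 - power_defect K y\<close> with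
  \<open>y = 2\<sigma>\<^sup>2t / (1 + 2\<sigma>\<^sup>2t)\<close>.\<close>

definition power_defect :: "real \<Rightarrow> real \<Rightarrow> real" where
  "power_defect K y = 1 - (1 - y) * z (K * y)"

definition power_defect_deriv :: "real \<Rightarrow> real \<Rightarrow> real" where
  "power_defect_deriv K y = z (K * y) + (1 - y) * (K * z' (K * y))"

lemma power_defect_has_deriv:
  "(power_defect K has_real_derivative power_defect_deriv K y) (at y)"
  unfolding power_defect_def[abs_def] power_defect_deriv_def
  by (auto intro!: derivative_eq_intros DERIV_chain2[OF z_deriv] simp: algebra_simps)

lemma deriv_z_scaled: "deriv (\<lambda>u. z (K * u)) y = - K * z' (K * y)"
proof (rule DERIV_imp_deriv)
  have "((\<lambda>u. z (K * u)) has_real_derivative - z' (K * y) * K) (at y)"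
    by (rule DERIV_chain2[OF z_deriv]) (auto intro!: derivative_eq_intros)
  then show "((\<lambda>u. z (K * u)) has_real_derivative - K * z' (K * y)) (at y)" by (simp add: mult.commute)
qed

lemma power_defect_deriv_nonneg: "0 \<le> K \<Longrightarrow> y \<le> 1 \<Longrightarrow> 0 \<le> power_defect_deriv K y"
  unfolding power_defect_deriv_def using z_nonneg z'_nonneg by simp

lemma power_defect_deriv_measurable [measurable]: "power_defect_deriv K \<in> borel_measurable borel"
  unfolding power_defect_deriv_def[abs_def] by measurable

text \<open>The defect is 1 - z + y z: the last part contributes y, and z(K y) \<ge> 1 - 2 K y
  contributes 2 K y. The 2 is the upper bound of \<open>c\<close>.\<close>

lemma power_defect_bounds:
  assumes "0 \<le> K" "0 \<le> y" "y \<le> 1"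
  shows "0 \<le> power_defect K y" "power_defect K y \<le> (1 + 2 * K) * y"
proof -
  have "(1 - y) * z (K * y) \<le> 1 * 1" using assms z_le_1[of "K * y"] z_nonneg by (intro mult_mono) auto
  then show "0 \<le> power_defect K y" by (simp add: power_defect_def)
  have "y * z (K * y) \<le> y" using assms z_le_1[of "K * y"] by (intro mult_left_le) auto
  moreover have "1 - 2 * (K * y) \<le> z (K * y)" using assms by (intro z_ge) auto
  ultimately show "power_defect K y \<le> (1 + 2 * K) * y" by (simp add: power_defect_def algebra_simps)
qed

lemma nn_integral_power_defect_deriv:
  assumes "0 \<le> K" "0 \<le> y" "y \<le> 1"
  shows "(\<integral>\<^sup>+u\<in>{0<..<y}. ennreal (power_defect_deriv K u) \<partial>lborel) = ennreal (power_defect K y)"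
proof -
  have "(\<integral>\<^sup>+u\<in>{0<..<y}. ennreal (power_defect_deriv K u) \<partial>lborel) = (\<integral>\<^sup>+u\<in>{0..y}. ennreal (power_defect_deriv K u) \<partial>lborel)"
  proof (rule nn_integral_cong_AE)
    show "AE u in lborel. ennreal (power_defect_deriv K u) * indicator {0<..<y} u = ennreal (power_defect_deriv K u) * indicator {0..y} u"
      using AE_lborel_singleton[of 0] AE_lborel_singleton[of y] by eventually_elim (auto simp: indicator_def)
  qed
  also have "\<dots> = ennreal (power_defect K y - power_defect K 0)"
    by (rule nn_integral_FTC_Icc[OF _ power_defect_has_deriv])
      (use assms in \<open>auto intro: power_defect_deriv_nonneg\<close>)
  finally show ?thesis by (simp add: power_defect_def)
qed

end

section \<open>A layer-cake formula\<close>

text \<open>Tonelli's theorem replaces the integration by parts: \<open>V\<close> is the inverse of \<open>Y\<close>.\<close>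

lemma layer_cake:
  fixes D :: "real \<Rightarrow> ennreal" and Y V :: "real \<Rightarrow> real"
  assumes [measurable]: "D \<in> borel_measurable borel" "Y \<in> borel_measurable borel"
    and r: "0 \<le> r"
    and inv: "\<And>u v. 0 < u \<Longrightarrow> r < v \<Longrightarrow> u < Y v \<longleftrightarrow> u < y0 \<and> v < V u"
    and V: "\<And>u. 0 < u \<Longrightarrow> u < y0 \<Longrightarrow> r \<le> V u"
  shows "(\<integral>\<^sup>+v\<in>{r<..}. ennreal (2 * v) * (\<integral>\<^sup>+u\<in>{0<..<Y v}. D u \<partial>lborel) \<partial>lborel) =
    (\<integral>\<^sup>+u\<in>{0<..<y0}. D u * ennreal ((V u)\<^sup>2 - r\<^sup>2) \<partial>lborel)"
proof -
  have "(\<integral>\<^sup>+v\<in>{r<..}. ennreal (2 * v) * (\<integral>\<^sup>+u\<in>{0<..<Y v}. D u \<partial>lborel) \<partial>lborel) =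
    (\<integral>\<^sup>+v. \<integral>\<^sup>+u. (if r < v \<and> 0 < u \<and> u < Y v then ennreal (2 * v) * D u else 0) \<partial>lborel \<partial>lborel)"
  proof (rule nn_integral_cong)
    fix v :: real
    have "(\<integral>\<^sup>+u. (if r < v \<and> 0 < u \<and> u < Y v then ennreal (2 * v) * D u else 0) \<partial>lborel) =
      (\<integral>\<^sup>+u. (ennreal (2 * v) * indicator {r<..} v) * (D u * indicator {0<..<Y v} u) \<partial>lborel)"
      by (rule nn_integral_cong) (auto simp: indicator_def)
    also have "\<dots> = (ennreal (2 * v) * indicator {r<..} v) * (\<integral>\<^sup>+u\<in>{0<..<Y v}. D u \<partial>lborel)"
      by (rule nn_integral_cmult) measurable
    finally show "ennreal (2 * v) * (\<integral>\<^sup>+u\<in>{0<..<Y v}. D u \<partial>lborel) * indicator {r<..} v =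
      (\<integral>\<^sup>+u. (if r < v \<and> 0 < u \<and> u < Y v then ennreal (2 * v) * D u else 0) \<partial>lborel)"
      by (simp only: mult_ac)
  qed
  also have "\<dots> = (\<integral>\<^sup>+u. \<integral>\<^sup>+v. (if r < v \<and> 0 < u \<and> u < Y v then ennreal (2 * v) * D u else 0) \<partial>lborel \<partial>lborel)"
    by (rule lborel_pair.Fubini') measurable
  also have "\<dots> = (\<integral>\<^sup>+u\<in>{0<..<y0}. D u * ennreal ((V u)\<^sup>2 - r\<^sup>2) \<partial>lborel)"
  proof (rule nn_integral_cong)
    fix u :: real
    show "(\<integral>\<^sup>+v. (if r < v \<and> 0 < u \<and> u < Y v then ennreal (2 * v) * D u else 0) \<partial>lborel) =
      D u * ennreal ((V u)\<^sup>2 - r\<^sup>2) * indicator {0<..<y0} u"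
    proof (cases "0 < u \<and> u < y0")
      case True
      \<comment> \<open>For fixed u the range of v is r < v < V(u), and integrating 2 v over it
        gives V(u)^2 - r^2.\<close>
      have "(\<integral>\<^sup>+v. (if r < v \<and> 0 < u \<and> u < Y v then ennreal (2 * v) * D u else 0) \<partial>lborel) =
        (\<integral>\<^sup>+v. D u * (ennreal (2 * v) * indicator {r..V u} v) \<partial>lborel)"
      proof (rule nn_integral_cong_AE)
        show "AE v in lborel. (if r < v \<and> 0 < u \<and> u < Y v then ennreal (2 * v) * D u else 0) =
          D u * (ennreal (2 * v) * indicator {r..V u} v)"
          using AE_lborel_singleton[of r] AE_lborel_singleton[of "V u"]
        proof eventually_elim
          case (elim v)
          show ?case
          proof (cases "r < v")
            case rv: True
            then show ?thesis using inv[of u v] True elim by (auto simp: mult.commute)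
          qed (use elim in auto)
        qed
      qed
      also have "\<dots> = D u * (\<integral>\<^sup>+v. ennreal (2 * v) * indicator {r..V u} v \<partial>lborel)"
        by (rule nn_integral_cmult) measurable
      also have "(\<integral>\<^sup>+v. ennreal (2 * v) * indicator {r..V u} v \<partial>lborel) = ennreal ((V u)\<^sup>2 - r\<^sup>2)"
        by (rule nn_integral_FTC_Icc) (use r V True in \<open>auto intro!: derivative_eq_intros\<close>)
      finally show ?thesis using True by simp
    next
      case False
      then have "(if r < v \<and> 0 < u \<and> u < Y v then ennreal (2 * v) * D u else 0) = 0" for v
        using inv[of u v] by auto
      then show ?thesis using False by simp
    qed
  qed
  finally show ?thesis .
qed

lemma less_root_powr_iff:
  fixes v x \<eta> :: real
  assumes "0 \<le> v" "0 < x" "0 < \<eta>"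
  shows "v < x powr (1 / \<eta>) \<longleftrightarrow> v powr \<eta> < x"
proof -
  have eq: "(x powr (1 / \<eta>)) powr \<eta> = x" using assms by (simp add: powr_powr)
  show ?thesis
  proof
    assume "v < x powr (1 / \<eta>)"
    then have "v powr \<eta> < (x powr (1 / \<eta>)) powr \<eta>" using assms by (intro powr_less_mono2) auto
    then show "v powr \<eta> < x" by (simp only: eq)
  next
    assume l: "v powr \<eta> < x"
    show "v < x powr (1 / \<eta>)"
    proof (rule ccontr)
      assume "\<not> v < x powr (1 / \<eta>)"
      then have "(x powr (1 / \<eta>)) powr \<eta> \<le> v powr \<eta>" using assms by (intro powr_mono2) auto
      then show False using l by (simp only: eq)
    qed
  qed
qed

lemma root_powr_square: "(x powr (1 / \<eta>))\<^sup>2 = x powr (2 / \<eta>)" for x \<eta> :: real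
  by (simp add: power2_eq_square powr_add[symmetric])

lemma nn_integral_Ici_of_has_bochner:
  fixes h :: "real \<Rightarrow> real"
  assumes "set_integrable lborel {r..} h" "\<And>v. r \<le> v \<Longrightarrow> 0 \<le> h v"
  shows "(\<integral>\<^sup>+v\<in>{r<..}. ennreal (h v) \<partial>lborel) = ennreal (LBINT v:{r..}. h v)"
proof -
  have "(\<integral>\<^sup>+v\<in>{r<..}. ennreal (h v) \<partial>lborel) = (\<integral>\<^sup>+v. ennreal (indicator {r..} v *\<^sub>R h v) \<partial>lborel)"
  proof (rule nn_integral_cong_AE)
    show "AE v in lborel. ennreal (h v) * indicator {r<..} v = ennreal (indicator {r..} v *\<^sub>R h v)"
      using AE_lborel_singleton[of r] by eventually_elim (auto simp: indicator_def)
  qed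
  also have "\<dots> = ennreal (LBINT v:{r..}. h v)"
    unfolding set_lebesgue_integral_def
    using assms by (intro nn_integral_eq_integral) (auto simp: set_integrable_def indicator_def)
  finally show ?thesis .
qed

lemma LBINT_nonneg:
  assumes "\<And>v. v \<in> A \<Longrightarrow> 0 \<le> h v"
  shows "0 \<le> (LBINT v:A. h v :: real)"
  unfolding set_lebesgue_integral_def using assms by (intro integral_nonneg_AE AE_I2) (auto simp: indicator_def)

section \<open>From the distance v to the variable y\<close>

context phase_law begin

text \<open>With C = 2 \<sigma>^2 s P this is 2 \<sigma>^2 t / (1 + 2 \<sigma>^2 t) at t = s P
  v^(-eta). Its value at the serving distance is \<open>y_zero\<close>.\<close>

definition path_y :: "real \<Rightarrow> real \<Rightarrow> real \<Rightarrow> real" where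
  "path_y \<eta> C v = C / (v powr \<eta> + C)"

lemma path_y_measurable [measurable]: "path_y \<eta> C \<in> borel_measurable borel"
  unfolding path_y_def[abs_def] by measurable

lemma path_y_bounds: "0 < C \<Longrightarrow> 0 < path_y \<eta> C v" "0 < C \<Longrightarrow> path_y \<eta> C v \<le> 1"
  "0 < C \<Longrightarrow> 0 < v \<Longrightarrow> path_y \<eta> C v < 1"
  unfolding path_y_def by (auto simp: divide_le_eq add_nonneg_pos intro!: divide_pos_pos)

text \<open>\<open>path_y\<close> decreases in v and has inverse (C (1 - u)/u)^(1/eta); the square
  of this inverse in \<open>layer_cake\<close> is the source of the exponents 2/eta.\<close>

lemma nn_integral_power_defect_path:
  assumes \<eta>: "0 < \<eta>" and K: "0 \<le> K" and C: "0 < C" and r: "0 < r"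
  shows "(\<integral>\<^sup>+v\<in>{r<..}. ennreal (2 * v * power_defect K (path_y \<eta> C v)) \<partial>lborel) =
    (\<integral>\<^sup>+u\<in>{0<..<path_y \<eta> C r}. ennreal (power_defect_deriv K u * ((C * (1 - u) / u) powr (2 / \<eta>) - r\<^sup>2)) \<partial>lborel)"
proof -
  let ?Y = "path_y \<eta> C" and ?V = "\<lambda>u. (C * (1 - u) / u) powr (1 / \<eta>)"
  have less: "u < ?Y v \<longleftrightarrow> v powr \<eta> < C * (1 - u) / u" if "0 < u" "0 < v" for u v
    using that C by (simp add: path_y_def less_divide_eq add_nonneg_pos algebra_simps)
  have mono: "?Y v < ?Y r" if "r < v" for v
    using that C r \<eta> powr_less_mono2[of \<eta> r v] unfolding path_y_def
    by (intro divide_strict_left_mono) (auto intro!: mult_pos_pos add_nonneg_pos)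
  \<comment> \<open>Since \<open>path_y\<close> is decreasing, u below its value at v > r is also
    below its value at r; this is the condition u < y0 of \<open>layer_cake\<close>.\<close>
  have inv: "u < ?Y v \<longleftrightarrow> u < ?Y r \<and> v < ?V u" if uv: "0 < u" "r < v" for u v
  proof
    assume u: "u < ?Y v"
    then have "u < 1" using path_y_bounds(2)[OF C, of \<eta> v] by simp
    then show "u < ?Y r \<and> v < ?V u"
      using u mono[OF uv(2)] less[of u v] uv r C \<eta> by (subst less_root_powr_iff) auto
  next
    assume u: "u < ?Y r \<and> v < ?V u"
    then have "u < 1" using path_y_bounds(2)[OF C, of \<eta> r] by simp
    then show "u < ?Y v"
      using u less[of u v] uv r C \<eta> less_root_powr_iff[of v "C * (1 - u) / u" \<eta>] by auto
  qed
  have V: "r \<le> ?V u" if u: "0 < u" "u < ?Y r" for u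
  proof -
    have "u < 1" using u path_y_bounds(2)[OF C, of \<eta> r] by simp
    then have "r < ?V u"
      using less[of u r] u r C \<eta> less_root_powr_iff[of r "C * (1 - u) / u" \<eta>] by auto
    then show ?thesis by simp
  qed
  have "(\<integral>\<^sup>+v\<in>{r<..}. ennreal (2 * v * power_defect K (?Y v)) \<partial>lborel) =
    (\<integral>\<^sup>+v\<in>{r<..}. ennreal (2 * v) * (\<integral>\<^sup>+u\<in>{0<..<?Y v}. ennreal (power_defect_deriv K u) \<partial>lborel) \<partial>lborel)"
  proof (rule nn_integral_cong)
    fix v :: real
    show "ennreal (2 * v * power_defect K (?Y v)) * indicator {r<..} v =
      ennreal (2 * v) * (\<integral>\<^sup>+u\<in>{0<..<?Y v}. ennreal (power_defect_deriv K u) \<partial>lborel) * indicator {r<..} v"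
      using path_y_bounds[OF C, of \<eta> v] K r
      by (cases "r < v") (simp_all add: nn_integral_power_defect_deriv ennreal_mult power_defect_bounds)
  qed
  also have "\<dots> = (\<integral>\<^sup>+u\<in>{0<..<?Y r}. ennreal (power_defect_deriv K u) * ennreal ((?V u)\<^sup>2 - r\<^sup>2) \<partial>lborel)"
    by (rule layer_cake[OF _ _ _ inv V]) (use r in auto)
  also have "\<dots> = (\<integral>\<^sup>+u\<in>{0<..<?Y r}. ennreal (power_defect_deriv K u * ((C * (1 - u) / u) powr (2 / \<eta>) - r\<^sup>2)) \<partial>lborel)"
  proof (rule nn_integral_cong)
    fix u :: real
    show "ennreal (power_defect_deriv K u) * ennreal ((?V u)\<^sup>2 - r\<^sup>2) * indicator {0<..<?Y r} u =
      ennreal (power_defect_deriv K u * ((C * (1 - u) / u) powr (2 / \<eta>) - r\<^sup>2)) * indicator {0<..<?Y r} u"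
    proof (cases "u \<in> {0<..<?Y r}")
      case True
      then have "0 \<le> power_defect_deriv K u"
        using K path_y_bounds(2)[OF C, of \<eta> r] by (intro power_defect_deriv_nonneg) auto
      then show ?thesis unfolding root_powr_square by (simp add: ennreal_mult')
    qed simp
  qed
  finally show ?thesis .
qed

text \<open>The integrands of (i); the second one carries the sign of \<open>\<zeta>\<^sub>1' \<le> 0\<close>.\<close>

definition specular_term :: "real \<Rightarrow> real \<Rightarrow> real \<Rightarrow> real" where
  "specular_term \<delta> K y = (1 - y) powr \<delta> * z (K * y) / y powr \<delta>"

definition derivative_term :: "real \<Rightarrow> real \<Rightarrow> real \<Rightarrow> real" where
  "derivative_term \<delta> K y = (1 - y) powr (\<delta> + 1) / y powr \<delta> * deriv (\<lambda>u. z (K * u)) y"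

lemma measurable_terms [measurable]:
  "specular_term \<delta> K \<in> borel_measurable borel" "derivative_term \<delta> K \<in> borel_measurable borel"
  unfolding specular_term_def[abs_def] derivative_term_def[abs_def] deriv_z_scaled by measurable

lemma specular_term_nonneg: "0 \<le> specular_term \<delta> K y"
  unfolding specular_term_def using z_nonneg by simp

lemma derivative_term_nonpos: "0 \<le> K \<Longrightarrow> derivative_term \<delta> K y \<le> 0"
  unfolding derivative_term_def deriv_z_scaled using z'_nonneg[of "K * y"] by (simp add: mult_nonneg_nonpos)

text \<open>The defect has derivative z(K y) + (1 - y) K z'(K y), and K z'(K y) is minus the
  derivative of z(K y). This is where the derivative integral of (i) gets its minus sign.\<close>

lemma weighted_defect_deriv_eq:
  assumes "0 < y" "y < 1" "0 < C"
  shows "power_defect_deriv K y * (C * (1 - y) / y) powr \<delta> =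
    C powr \<delta> * (specular_term \<delta> K y - derivative_term \<delta> K y)"
proof -
  have "(C * (1 - y) / y) powr \<delta> = C powr \<delta> * ((1 - y) powr \<delta> / y powr \<delta>)"
    using assms by (simp add: powr_divide powr_mult)
  moreover have "(1 - y) powr (\<delta> + 1) = (1 - y) powr \<delta> * (1 - y)" using assms by (simp add: powr_add)
  ultimately show ?thesis
    unfolding power_defect_deriv_def specular_term_def derivative_term_def deriv_z_scaled
    by (simp only: divide_inverse) (simp add: algebra_simps)
qed

text \<open>The change of variables controls only the combined integrand with the weight W - r^2.
  Its r^2 part integrates to r^2 times the defect at y0, the boundary term of (i); what remains
  splits into the two integrals of (i).\<close>

lemma power_defect_path_integral:
  assumes \<eta>: "0 < \<eta>" and K: "0 \<le> K" and C: "0 < C" and r: "0 < r"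
    and int: "set_integrable lborel {r..} (\<lambda>v. 2 * v * power_defect K (path_y \<eta> C v))"
  defines "y0 \<equiv> path_y \<eta> C r"
  shows "(LBINT v:{r..}. 2 * v * power_defect K (path_y \<eta> C v)) =
      C powr (2 / \<eta>) * (- (LBINT y:{0..y0}. derivative_term (2 / \<eta>) K y) + (LBINT y:{0..y0}. specular_term (2 / \<eta>) K y))
      - r\<^sup>2 * power_defect K y0"
    and "set_integrable lborel {0..y0} (specular_term (2 / \<eta>) K)"
    and "set_integrable lborel {0..y0} (derivative_term (2 / \<eta>) K)"
proof -
  let ?\<delta> = "2 / \<eta>" and ?Y = "path_y \<eta> C"
  let ?A = "LBINT v:{r..}. 2 * v * power_defect K (?Y v)"
  let ?W = "\<lambda>u. (C * (1 - u) / u) powr ?\<delta>"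
  have Yb: "0 \<le> ?Y v" "?Y v \<le> 1" for v using path_y_bounds[OF C, of \<eta> v] by auto
  have y0: "0 < y0" "y0 < 1" using path_y_bounds[OF C] r by (auto simp: y0_def)
  have pos: "0 \<le> 2 * v * power_defect K (?Y v)" if "r \<le> v" for v
    using that r power_defect_bounds(1)[OF K Yb] by simp
  have A0: "0 \<le> ?A" by (rule LBINT_nonneg) (use pos in auto)
  have nn: "(\<integral>\<^sup>+u\<in>{0<..<y0}. ennreal (power_defect_deriv K u * (?W u - r\<^sup>2)) \<partial>lborel) = ennreal ?A"
    using nn_integral_power_defect_path[OF \<eta> K C r] nn_integral_Ici_of_has_bochner[OF int pos]
    by (simp add: y0_def)
  have W: "0 \<le> ?W u - r\<^sup>2" if u: "0 < u" "u < y0" for u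
  proof -
    have "r powr \<eta> \<le> C * (1 - u) / u"
    proof -
      have "u * (r powr \<eta> + C) < C"
        using u C by (simp add: y0_def path_y_def less_divide_eq add_nonneg_pos)
      then show ?thesis using u by (simp add: le_divide_eq algebra_simps)
    qed
    then have "(r powr \<eta>) powr ?\<delta> \<le> ?W u" using \<eta> by (intro powr_mono2) auto
    moreover have "(r powr \<eta>) powr ?\<delta> = r\<^sup>2" using r \<eta> by (simp add: powr_powr)
    ultimately show ?thesis by simp
  qed
  have D: "0 \<le> power_defect_deriv K u" if "u < y0" for u
    using that y0 K by (intro power_defect_deriv_nonneg) auto
  have b1: "has_bochner_integral lborel (\<lambda>u. indicator {0<..<y0} u * (power_defect_deriv K u * (?W u - r\<^sup>2))) ?A"
  proof (rule has_bochner_integral_nn_integral)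
    show "(\<integral>\<^sup>+u. ennreal (indicator {0<..<y0} u * (power_defect_deriv K u * (?W u - r\<^sup>2))) \<partial>lborel) = ennreal ?A"
      unfolding nn[symmetric] by (rule nn_integral_cong) (auto simp: indicator_def)
    show "AE u in lborel. 0 \<le> indicator {0<..<y0} u * (power_defect_deriv K u * (?W u - r\<^sup>2))"
      using W D by (auto simp: indicator_def)
  qed (use A0 in auto)
  have b2: "has_bochner_integral lborel (\<lambda>u. indicator {0<..<y0} u * power_defect_deriv K u) (power_defect K y0)"
  proof (rule has_bochner_integral_nn_integral)
    have "(\<integral>\<^sup>+u. ennreal (indicator {0<..<y0} u * power_defect_deriv K u) \<partial>lborel) =
      (\<integral>\<^sup>+u\<in>{0<..<y0}. ennreal (power_defect_deriv K u) \<partial>lborel)"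
      by (rule nn_integral_cong) (auto simp: indicator_def)
    then show "(\<integral>\<^sup>+u. ennreal (indicator {0<..<y0} u * power_defect_deriv K u) \<partial>lborel) = ennreal (power_defect K y0)"
      using nn_integral_power_defect_deriv[OF K, of y0] y0 by simp
    show "AE u in lborel. 0 \<le> indicator {0<..<y0} u * power_defect_deriv K u"
      using D by (auto simp: indicator_def)
    show "0 \<le> power_defect K y0" using y0 K by (intro power_defect_bounds) auto
  qed auto
  \<comment> \<open>Adding the r^2 part back removes the subtraction in the weight; the endpoints of
    the closed interval are null.\<close>
  have b3: "has_bochner_integral lborel (\<lambda>u. indicator {0..y0} u * (C powr ?\<delta> * (specular_term ?\<delta> K u - derivative_term ?\<delta> K u)))
      (?A + r\<^sup>2 * power_defect K y0)"
  proof (rule has_bochner_integral_cong_AE[THEN iffD1, OF _ _ _ has_bochner_integral_add[OF b1 has_bochner_integral_mult_right[OF b2, of "r\<^sup>2"]]])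
    show "AE u in lborel. indicator {0<..<y0} u * (power_defect_deriv K u * (?W u - r\<^sup>2)) + r\<^sup>2 * (indicator {0<..<y0} u * power_defect_deriv K u)
       = indicator {0..y0} u * (C powr ?\<delta> * (specular_term ?\<delta> K u - derivative_term ?\<delta> K u))"
      using AE_lborel_singleton[of 0] AE_lborel_singleton[of y0]
    proof eventually_elim
      case (elim u)
      show ?case
      proof (cases "0 < u \<and> u < y0")
        case True
        then have "indicator {0<..<y0} u = (1::real)" "indicator {0..y0} u = (1::real)" by auto
        then show ?thesis
          using weighted_defect_deriv_eq[of u C K ?\<delta>] True y0 C by (simp add: algebra_simps)
      next
        case False
        then have "indicator {0<..<y0} u = (0::real)" "indicator {0..y0} u = (0::real)" using elim by auto
        then show ?thesis by simp
      qed
    qed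
  qed auto
  have b4: "has_bochner_integral lborel (\<lambda>u. indicator {0..y0} u * (specular_term ?\<delta> K u - derivative_term ?\<delta> K u))
      ((?A + r\<^sup>2 * power_defect K y0) / C powr ?\<delta>)"
    using has_bochner_integral_mult_right[OF b3, of "1 / C powr ?\<delta>"] C by (simp add: mult_ac)
  have i: "integrable lborel (\<lambda>u. indicator {0..y0} u * (specular_term ?\<delta> K u - derivative_term ?\<delta> K u))"
    using b4 by (simp add: has_bochner_integral_iff)
  \<comment> \<open>\<open>specular_term\<close> and minus \<open>derivative_term\<close> are both
    nonnegative, so each is dominated by their sum, which is integrable.\<close>
  show s1: "set_integrable lborel {0..y0} (specular_term ?\<delta> K)"
    unfolding set_integrable_def
  proof (rule Bochner_Integration.integrable_bound[OF i])
    show "AE u in lborel. norm (indicat_real {0..y0} u *\<^sub>R specular_term ?\<delta> K u) \<le>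
      norm (indicator {0..y0} u * (specular_term ?\<delta> K u - derivative_term ?\<delta> K u))"
    proof (intro AE_I2)
      fix u
      show "norm (indicat_real {0..y0} u *\<^sub>R specular_term ?\<delta> K u) \<le>
        norm (indicator {0..y0} u * (specular_term ?\<delta> K u - derivative_term ?\<delta> K u))"
        using specular_term_nonneg[of ?\<delta> K u] derivative_term_nonpos[OF K, of ?\<delta> u] by (auto simp: indicator_def)
    qed
  qed auto
  show s2: "set_integrable lborel {0..y0} (derivative_term ?\<delta> K)"
    unfolding set_integrable_def
  proof (rule Bochner_Integration.integrable_bound[OF i])
    show "AE u in lborel. norm (indicat_real {0..y0} u *\<^sub>R derivative_term ?\<delta> K u) \<le>
      norm (indicator {0..y0} u * (specular_term ?\<delta> K u - derivative_term ?\<delta> K u))"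
    proof (intro AE_I2)
      fix u
      show "norm (indicat_real {0..y0} u *\<^sub>R derivative_term ?\<delta> K u) \<le>
        norm (indicator {0..y0} u * (specular_term ?\<delta> K u - derivative_term ?\<delta> K u))"
        using specular_term_nonneg[of ?\<delta> K u] derivative_term_nonpos[OF K, of ?\<delta> u] by (auto simp: indicator_def)
    qed
  qed auto
  have "(LBINT y:{0..y0}. specular_term ?\<delta> K y) - (LBINT y:{0..y0}. derivative_term ?\<delta> K y) =
      (LINT u|lborel. indicator {0..y0} u * (specular_term ?\<delta> K u - derivative_term ?\<delta> K u))"
    using s1 s2 unfolding set_lebesgue_integral_def set_integrable_def
    by (subst Bochner_Integration.integral_diff[symmetric]) (auto simp: right_diff_distrib)
  also have "\<dots> = (?A + r\<^sup>2 * power_defect K y0) / C powr ?\<delta>"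
    using b4 by (simp add: has_bochner_integral_iff)
  finally show "?A = C powr ?\<delta> * (- (LBINT y:{0..y0}. derivative_term ?\<delta> K y) + (LBINT y:{0..y0}. specular_term ?\<delta> K y))
      - r\<^sup>2 * power_defect K y0"
    using C by (simp add: field_simps)
qed

end

section \<open>Beta integrals and the confluent hypergeometric function\<close>

text \<open>The moments of the beta weight, which become the coefficients of \<open>hyp1F1\<close>
  once the exponential is expanded.\<close>

lemma Beta_shift_left:
  fixes a b :: real
  assumes "0 < a" "0 < b"
  shows "Beta (a + real n) b = Beta a b * (pochhammer a n / pochhammer (a + b) n)"
proof -
  have 1: "pochhammer a n = Gamma (a + real n) / Gamma a"
    using assms by (intro pochhammer_Gamma) (auto elim!: nonpos_Ints_cases)
  have 2: "pochhammer (a + b) n = Gamma (a + b + real n) / Gamma (a + b)"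
    using assms by (intro pochhammer_Gamma) (auto elim!: nonpos_Ints_cases)
  have "0 < Gamma a" "0 < Gamma (a + b)" "0 < Gamma (a + b + real n)"
    using assms by (auto intro!: Gamma_real_pos)
  moreover have "a + real n + b = a + b + real n" by simp
  ultimately show ?thesis unfolding Beta_def 1 2 by (simp add: field_simps)
qed

lemma has_bochner_integral_Beta:
  fixes a b :: real
  assumes "0 < a" "0 < b"
  shows "has_bochner_integral lborel (\<lambda>t. indicator {0<..<1} t * (t powr (a - 1) * (1 - t) powr (b - 1))) (Beta a b)"
proof (rule has_bochner_integral_nn_integral)
  have "((\<lambda>t. t powr (a - 1) * (1 - t) powr (b - 1)) has_integral Beta a b) {0..1}"
    by (rule has_integral_Beta_real[OF assms])
  then have "((\<lambda>t. if t \<in> {0..1} then t powr (a - 1) * (1 - t) powr (b - 1) else 0) has_integral Beta a b) UNIV"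
    by (simp only: has_integral_restrict_UNIV)
  then have "(\<integral>\<^sup>+t. ennreal (if t \<in> {0..1} then t powr (a - 1) * (1 - t) powr (b - 1) else 0) \<partial>lborel) = ennreal (Beta a b)"
    by (intro nn_integral_has_integral_lborel) auto
  also have "(\<integral>\<^sup>+t. ennreal (if t \<in> {0..1} then t powr (a - 1) * (1 - t) powr (b - 1) else 0) \<partial>lborel) =
    (\<integral>\<^sup>+t. ennreal (indicator {0<..<1} t * (t powr (a - 1) * (1 - t) powr (b - 1))) \<partial>lborel)"
  proof (rule nn_integral_cong_AE)
    show "AE t in lborel. ennreal (if t \<in> {0..1} then t powr (a - 1) * (1 - t) powr (b - 1) else 0) =
      ennreal (indicator {0<..<1} t * (t powr (a - 1) * (1 - t) powr (b - 1)))"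
      using AE_lborel_singleton[of 0] AE_lborel_singleton[of 1] by eventually_elim (auto simp: indicator_def)
  qed
  finally show "(\<integral>\<^sup>+t. ennreal (indicator {0<..<1} t * (t powr (a - 1) * (1 - t) powr (b - 1))) \<partial>lborel) = ennreal (Beta a b)" .
  show "0 \<le> Beta a b" unfolding Beta_def using assms
    by (auto intro!: divide_nonneg_nonneg mult_nonneg_nonneg less_imp_le[OF Gamma_real_pos])
qed auto

text \<open>Kummer's integral, by expanding the exponential into its power series.\<close>

lemma has_bochner_integral_hyp1F1:
  fixes a b x :: real
  assumes a: "0 < a" and b: "0 < b"
  shows "has_bochner_integral lborel
    (\<lambda>t. indicator {0<..<1} t * (t powr (a - 1) * (1 - t) powr (b - 1) * exp (x * t))) (Beta a b * hyp1F1 a (a + b) x)"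
proof -
  let ?w = "\<lambda>t. indicator {0<..<1} t * (t powr (a - 1) * (1 - t) powr (b - 1))"
  let ?f = "\<lambda>n t. ?w t * ((x * t) ^ n /\<^sub>R fact n)"
  have f: "has_bochner_integral lborel (?f n) (x ^ n / fact n * Beta (a + real n) b)" for n
  proof -
    have an: "0 < a + real n" using a by (simp add: add_pos_nonneg)
    have "has_bochner_integral lborel (\<lambda>t. (x ^ n / fact n) * (indicator {0<..<1} t * (t powr (a + real n - 1) * (1 - t) powr (b - 1))))
       (x ^ n / fact n * Beta (a + real n) b)"
      by (intro has_bochner_integral_mult_right has_bochner_integral_Beta an b)
    moreover have "(x ^ n / fact n) * (indicator {0<..<1} t * (t powr (a + real n - 1) * (1 - t) powr (b - 1))) = ?f n t" for t
    proof (cases "0 < t \<and> t < 1")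
      case True
      have "t powr (a + real n - 1) = t powr (a - 1) * t ^ n"
        using True by (simp add: powr_realpow[symmetric] powr_add[symmetric] algebra_simps)
      then show ?thesis using True by (simp add: power_mult_distrib field_simps)
    qed (auto simp: indicator_def)
    ultimately show ?thesis by simp
  qed
  have wB: "has_bochner_integral lborel ?w (Beta a b)" by (rule has_bochner_integral_Beta[OF a b])
  have w0: "0 \<le> ?w t" for t by (auto simp: indicator_def)
  \<comment> \<open>Since |x t| \<le> |x| on the unit interval, the integrals of the absolute values
    are dominated by the exponential series of |x|; this permits termwise integration.\<close>
  have bound: "(LINT t|lborel. norm (?f n t)) \<le> \<bar>x\<bar> ^ n /\<^sub>R fact n * Beta a b" for n
  proof -
    have "(LINT t|lborel. norm (?f n t)) \<le> (LINT t|lborel. (\<bar>x\<bar> ^ n /\<^sub>R fact n) * ?w t)"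
    proof (rule integral_mono)
      show "integrable lborel (\<lambda>t. norm (?f n t))" using f[of n] by (simp add: has_bochner_integral_iff)
      show "integrable lborel (\<lambda>t. (\<bar>x\<bar> ^ n /\<^sub>R fact n) * ?w t)"
        using wB by (intro integrable_mult_right) (simp add: has_bochner_integral_iff)
      fix t :: real
      have "\<bar>x * t\<bar> ^ n \<le> \<bar>x\<bar> ^ n" if "0 < t" "t < 1"
        using that by (intro power_mono) (auto simp: abs_mult intro!: mult_left_le)
      then have "?w t * (\<bar>x * t\<bar> ^ n /\<^sub>R fact n) \<le> ?w t * (\<bar>x\<bar> ^ n /\<^sub>R fact n)"
        using w0[of t] by (cases "0 < t \<and> t < 1") (auto intro!: mult_left_mono simp: indicator_def)
      then show "norm (?f n t) \<le> (\<bar>x\<bar> ^ n /\<^sub>R fact n) * ?w t"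
        using w0[of t] by (simp add: abs_mult power_abs mult.commute)
    qed
    then show ?thesis using wB by (simp add: has_bochner_integral_iff)
  qed
  have sm: "summable (\<lambda>n. LINT t|lborel. norm (?f n t))"
  proof (rule summable_comparison_test_ev)
    show "\<forall>\<^sub>F n in sequentially. norm (LINT t|lborel. norm (?f n t)) \<le> \<bar>x\<bar> ^ n /\<^sub>R fact n * Beta a b"
      using bound by (intro always_eventually allI) (simp add: abs_of_nonneg integral_nonneg_AE)
    show "summable (\<lambda>n. \<bar>x\<bar> ^ n /\<^sub>R fact n * Beta a b)"
      by (intro summable_mult2 summable_exp_generic)
  qed
  have ae: "AE t in lborel. summable (\<lambda>n. norm (?f n t))"
  proof (intro AE_I2)
    fix t
    have "summable (\<lambda>n. \<bar>?w t\<bar> * norm ((x * t) ^ n /\<^sub>R fact n))"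
      by (intro summable_mult summable_norm_exp)
    then show "summable (\<lambda>n. norm (?f n t))" by (simp add: abs_mult)
  qed
  have fi: "integrable lborel (?f n)" and fI: "integral\<^sup>L lborel (?f n) = x ^ n / fact n * Beta (a + real n) b" for n
    using f[of n] by (simp_all add: has_bochner_integral_iff)
  have sum: "(\<Sum>n. ?f n t) = ?w t * exp (x * t)" for t
    using exp_converges[of "x * t"] by (intro sums_unique[symmetric] sums_mult)
  have "integrable lborel (\<lambda>t. \<Sum>n. ?f n t)" by (rule integrable_suminf[OF fi ae sm])
  moreover have S: "(\<lambda>n. integral\<^sup>L lborel (?f n)) sums (LINT t|lborel. (\<Sum>n. ?f n t))" by (rule sums_integral[OF fi ae sm])
  have "(LINT t|lborel. (\<Sum>n. ?f n t)) = Beta a b * hyp1F1 a (a + b) x"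
  proof -
    have eq: "integral\<^sup>L lborel (?f n) = Beta a b * (pochhammer a n / pochhammer (a + b) n * x ^ n / fact n)" for n
      unfolding fI Beta_shift_left[OF a b] by (simp add: mult_ac)
    have "0 < Beta a b"
      unfolding Beta_def using a b by (intro divide_pos_pos mult_pos_pos Gamma_real_pos) auto
    then have B: "Beta a b \<noteq> 0" by simp
    have "(\<lambda>n. pochhammer a n / pochhammer (a + b) n * x ^ n / fact n) sums ((LINT t|lborel. (\<Sum>n. ?f n t)) / Beta a b)"
      using sums_divide[OF S[unfolded eq], of "Beta a b"] B by simp
    then have "hyp1F1 a (a + b) x = (LINT t|lborel. (\<Sum>n. ?f n t)) / Beta a b"
      unfolding hyp1F1_def by (rule sums_unique[symmetric])
    then show ?thesis using B by simp
  qed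
  ultimately show ?thesis unfolding sum by (simp add: has_bochner_integral_iff mult.assoc)
qed

lemma Gamma_reflection_real: "Gamma d * Gamma (1 - d) = pi / sin (pi * d)" for d :: real
proof -
  have "complex_of_real (Gamma d * Gamma (1 - d)) = complex_of_real (pi / sin (pi * d))"
    using Gamma_reflection_complex[of "complex_of_real d"]
    by (simp flip: Gamma_complex_of_real sin_of_real)
  then show ?thesis by (simp only: of_real_eq_iff)
qed

text \<open>The gamma functions in the denominators are at 2 and 3, with values 1 and 2. With d =
  2/eta, the reflection formula gives the cosecant of (ii), and (1 + d)/2 is the coefficient (eta +
  2)/(2 eta) in zeta2.\<close>

lemma Beta_reflection:
  fixes d :: real
  assumes "0 < d" "d < 1"
  shows "Beta (1 - d) (1 + d) = d * pi / sin (pi * d)"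
    and "Beta (1 - d) (2 + d) = d * pi / sin (pi * d) * ((1 + d) / 2)"
proof -
  have n: "d \<notin> \<int>\<^sub>\<le>\<^sub>0" "1 + d \<notin> \<int>\<^sub>\<le>\<^sub>0" using assms by (auto dest: nonpos_Ints_nonpos)
  have 1: "Gamma (1 + d) = d * Gamma d" using Gamma_plus1[OF n(1)] by (simp add: add.commute)
  have 2: "Gamma (2 + d) = (1 + d) * Gamma (1 + d)"
    using Gamma_plus1[OF n(2)] by (simp add: add.commute add.left_commute)
  have g: "Gamma 2 = (1::real)" "Gamma 3 = (2::real)"
    using Gamma_fact[of 1, where 'a=real] Gamma_fact[of 2, where 'a=real] by (simp_all add: numeral_2_eq_2)
  show "Beta (1 - d) (1 + d) = d * pi / sin (pi * d)"
    using Gamma_reflection_real[of d] by (simp add: Beta_def 1 g mult_ac)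
  show "Beta (1 - d) (2 + d) = d * pi / sin (pi * d) * ((1 + d) / 2)"
  proof -
    have "Beta (1 - d) (2 + d) = d * (Gamma d * Gamma (1 - d)) * ((1 + d) / 2)"
      by (simp add: Beta_def 1 2 g)
    then show ?thesis by (simp add: Gamma_reflection_real)
  qed
qed

section \<open>The full-range integral behind zeta2\<close>

context phase_law begin

text \<open>The integrand of (i) at a fixed phase, with k = K c(\<alpha>): the weight ((1 -
  u)/u)^\<delta> times the derivative of 1 - (1 - u) exp(-k u).\<close>

definition beta_kernel :: "real \<Rightarrow> real \<Rightarrow> real \<Rightarrow> real" where
  "beta_kernel \<delta> k u = (1 - u) powr \<delta> / u powr \<delta> * exp (- k * u) * (1 + (1 - u) * k)"

definition zeta2_integrand :: "real \<Rightarrow> real \<Rightarrow> real" where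
  "zeta2_integrand \<delta> k = hyp1F1 (1 - \<delta>) 2 (- k) + k * ((1 + \<delta>) / 2) * hyp1F1 (1 - \<delta>) 3 (- k)"

text \<open>The two summands 1 and (1 - u) k give Kummer integrals with parameters (1 - \<delta>, 1
  + \<delta>) and (1 - \<delta>, 2 + \<delta>), whose sums are the 2 and 3 in zeta2.\<close>

lemma has_bochner_integral_beta_kernel:
  assumes \<delta>: "0 < \<delta>" "\<delta> < 1"
  shows "has_bochner_integral lborel (\<lambda>u. indicator {0<..<1} u * beta_kernel \<delta> k u)
    (\<delta> * pi / sin (pi * \<delta>) * zeta2_integrand \<delta> k)"
proof -
  have 1: "has_bochner_integral lborel
      (\<lambda>t. indicator {0<..<1} t * (t powr (1 - \<delta> - 1) * (1 - t) powr (1 + \<delta> - 1) * exp (- k * t))) (Beta (1 - \<delta>) (1 + \<delta>) * hyp1F1 (1 - \<delta>) ((1 - \<delta>) + (1 + \<delta>)) (- k))"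
    by (rule has_bochner_integral_hyp1F1) (use \<delta> in auto)
  have 2: "has_bochner_integral lborel
      (\<lambda>t. indicator {0<..<1} t * (t powr (1 - \<delta> - 1) * (1 - t) powr (2 + \<delta> - 1) * exp (- k * t))) (Beta (1 - \<delta>) (2 + \<delta>) * hyp1F1 (1 - \<delta>) ((1 - \<delta>) + (2 + \<delta>)) (- k))"
    by (rule has_bochner_integral_hyp1F1) (use \<delta> in auto)
  have "has_bochner_integral lborel (\<lambda>u. indicator {0<..<1} u * beta_kernel \<delta> k u)
    (Beta (1 - \<delta>) (1 + \<delta>) * hyp1F1 (1 - \<delta>) ((1 - \<delta>) + (1 + \<delta>)) (- k) +
     k * (Beta (1 - \<delta>) (2 + \<delta>) * hyp1F1 (1 - \<delta>) ((1 - \<delta>) + (2 + \<delta>)) (- k)))"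
  proof (rule has_bochner_integral_cong[THEN iffD1, OF refl _ refl has_bochner_integral_add[OF 1 has_bochner_integral_mult_right[OF 2, of k]]])
    fix u :: real
    show "indicator {0<..<1} u * (u powr (1 - \<delta> - 1) * (1 - u) powr (1 + \<delta> - 1) * exp (- k * u)) +
       k * (indicator {0<..<1} u * (u powr (1 - \<delta> - 1) * (1 - u) powr (2 + \<delta> - 1) * exp (- k * u))) =
       indicator {0<..<1} u * beta_kernel \<delta> k u"
    proof (cases "0 < u \<and> u < 1")
      case True
      have "(1 - u) powr (2 + \<delta> - 1) = (1 - u) powr \<delta> * (1 - u)"
        using True powr_add[of "1 - u" \<delta> 1] by (simp add: add.commute)
      moreover have "u powr (1 - \<delta> - 1) = inverse (u powr \<delta>)" by (simp add: powr_minus)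
      moreover have "indicator {0<..<1} u = (1::real)" using True by simp
      ultimately show ?thesis
        by (simp only: beta_kernel_def divide_inverse mult_1_left add_diff_cancel_left') (simp add: algebra_simps)
    qed (auto simp: indicator_def)
  qed
  moreover have "(1 - \<delta>) + (1 + \<delta>) = 2" "(1 - \<delta>) + (2 + \<delta>) = 3" by simp_all
  ultimately show ?thesis
    by (simp only: Beta_reflection[OF \<delta>] zeta2_integrand_def distrib_left mult_ac)
qed

lemma measurable_zeta2_integrand [measurable]: "zeta2_integrand \<delta> \<in> borel_measurable borel"
  unfolding zeta2_integrand_def[abs_def] hyp1F1_def by measurable

lemma zeta2_bound:
  assumes \<delta>: "0 < \<delta>" "\<delta> < 1" and K: "0 \<le> K" and y0: "0 \<le> y0" "y0 < 1"
    and s1: "set_integrable lborel {0..y0} (specular_term \<delta> K)"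
    and s2: "set_integrable lborel {0..y0} (derivative_term \<delta> K)"
  shows "- (LBINT y:{0..y0}. derivative_term \<delta> K y) + (LBINT y:{0..y0}. specular_term \<delta> K y) \<le>
    \<delta> * pi / sin (pi * \<delta>) * (LINT \<alpha>|\<nu>. zeta2_integrand \<delta> (K * c \<alpha>))"
proof -
  define B where "B = \<delta> * pi / sin (pi * \<delta>)"
  let ?H = "\<lambda>\<alpha>. B * zeta2_integrand \<delta> (K * c \<alpha>)"
  let ?T = "\<lambda>y. specular_term \<delta> K y - derivative_term \<delta> K y"
  have T0: "0 \<le> ?T y" for y using specular_term_nonneg[of \<delta> K y] derivative_term_nonpos[OF K, of \<delta> y] by simp
  have ker0: "0 \<le> beta_kernel \<delta> k u" if "0 \<le> k" "u < 1" for k u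
    using that by (simp add: beta_kernel_def)
  have Kc: "0 \<le> K * c \<alpha>" "K * c \<alpha> \<le> 2 * K" for \<alpha>
    using K c_bounds[of \<alpha>] mult_left_mono[OF c_bounds(2) K, of \<alpha>] by (auto simp: mult.commute)
  have bk: "has_bochner_integral lborel (\<lambda>u. indicator {0<..<1} u * beta_kernel \<delta> (K * c \<alpha>) u) (?H \<alpha>)" for \<alpha>
    unfolding B_def by (rule has_bochner_integral_beta_kernel[OF \<delta>])
  have H: "(\<integral>\<^sup>+u\<in>{0<..<1}. ennreal (beta_kernel \<delta> (K * c \<alpha>) u) \<partial>lborel) = ennreal (?H \<alpha>)" for \<alpha>
  proof -
    have "(\<integral>\<^sup>+u\<in>{0<..<1}. ennreal (beta_kernel \<delta> (K * c \<alpha>) u) \<partial>lborel) =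
      (\<integral>\<^sup>+u. ennreal (indicator {0<..<1} u * beta_kernel \<delta> (K * c \<alpha>) u) \<partial>lborel)"
      by (rule nn_integral_cong) (auto simp: indicator_def)
    also have "\<dots> = ennreal (?H \<alpha>)"
      using bk[of \<alpha>] ker0[OF Kc(1)[of \<alpha>]]
      by (subst nn_integral_eq_integral) (auto simp: has_bochner_integral_iff indicator_def)
    finally show ?thesis .
  qed
  have H0: "0 \<le> ?H \<alpha>" for \<alpha>
  proof -
    have "0 \<le> (LINT u|lborel. indicator {0<..<1} u * beta_kernel \<delta> (K * c \<alpha>) u)"
      using ker0[OF Kc(1)[of \<alpha>]] by (intro integral_nonneg_AE AE_I2) (auto simp: indicator_def)
    then show ?thesis using bk[of \<alpha>] by (simp add: has_bochner_integral_iff)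
  qed
  \<comment> \<open>A bound uniform in the phase: exp(-k u) \<le> 1 and 1 + (1 - u) k \<le> 1 + 2 K.
    It gives integrability over \<nu>, without which the integral on the right would be the default
    0.\<close>
  have HB: "?H \<alpha> \<le> (1 + 2 * K) * B" for \<alpha>
  proof -
    have w: "has_bochner_integral lborel (\<lambda>t. (1 + 2 * K) * (indicator {0<..<1} t * (t powr (1 - \<delta> - 1) * (1 - t) powr (1 + \<delta> - 1)))) ((1 + 2 * K) * Beta (1 - \<delta>) (1 + \<delta>))"
      by (intro has_bochner_integral_mult_right has_bochner_integral_Beta) (use \<delta> in auto)
    have "(LINT u|lborel. indicator {0<..<1} u * beta_kernel \<delta> (K * c \<alpha>) u) \<le>
       (LINT t|lborel. (1 + 2 * K) * (indicator {0<..<1} t * (t powr (1 - \<delta> - 1) * (1 - t) powr (1 + \<delta> - 1))))"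
    proof (rule integral_mono)
      fix u :: real
      show "indicator {0<..<1} u * beta_kernel \<delta> (K * c \<alpha>) u \<le>
        (1 + 2 * K) * (indicator {0<..<1} u * (u powr (1 - \<delta> - 1) * (1 - u) powr (1 + \<delta> - 1)))"
      proof (cases "0 < u \<and> u < 1")
        case True
        have "(1 - u) * (K * c \<alpha>) \<le> K * c \<alpha>" using True Kc[of \<alpha>] by (intro mult_left_le_one_le) auto
        then have "exp (- (K * c \<alpha>) * u) * (1 + (1 - u) * (K * c \<alpha>)) \<le> 1 * (1 + 2 * K)"
          using True Kc[of \<alpha>] K by (intro mult_mono) auto
        then have "(1 - u) powr \<delta> / u powr \<delta> * (exp (- (K * c \<alpha>) * u) * (1 + (1 - u) * (K * c \<alpha>))) \<le>
          (1 - u) powr \<delta> / u powr \<delta> * (1 + 2 * K)"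
          by (intro mult_left_mono) auto
        moreover have "indicator {0<..<1} u = (1::real)" using True by simp
        moreover have "u powr (1 - \<delta> - 1) = inverse (u powr \<delta>)" by (simp add: powr_minus)
        ultimately show ?thesis by (simp add: beta_kernel_def divide_inverse mult_ac)
      qed (auto simp: indicator_def)
    qed (use bk[of \<alpha>] w in \<open>auto simp: has_bochner_integral_iff\<close>)
    then show ?thesis using bk[of \<alpha>] w Beta_reflection(1)[OF \<delta>] by (simp add: has_bochner_integral_iff B_def)
  qed
  have Hint: "integrable \<nu> ?H"
    by (rule integrable_const_bound[where B="(1 + 2 * K) * B"]) (use H0 HB in \<open>auto simp: abs_of_nonneg\<close>)
  \<comment> \<open>For fixed u, averaging the kernel over the phase recovers the bracketed
    integrand of (i).\<close>
  have T: "ennreal (?T u) = (\<integral>\<^sup>+\<alpha>. ennreal (beta_kernel \<delta> (K * c \<alpha>) u) \<partial>\<nu>)" if u: "0 < u" "u < 1" for u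
  proof -
    let ?a = "(1 - u) powr \<delta> / u powr \<delta>"
    have eq: "beta_kernel \<delta> (K * c \<alpha>) u = ?a * exp (- (K * u) * c \<alpha>) + ?a * (1 - u) * K * (c \<alpha> * exp (- (K * u) * c \<alpha>))" for \<alpha>
      by (simp only: beta_kernel_def divide_inverse) (simp add: algebra_simps)
    have "integrable \<nu> (\<lambda>\<alpha>. beta_kernel \<delta> (K * c \<alpha>) u)"
      unfolding eq by (intro Bochner_Integration.integrable_add integrable_mult_right z_integrable z'_integrable)
    then have "(\<integral>\<^sup>+\<alpha>. ennreal (beta_kernel \<delta> (K * c \<alpha>) u) \<partial>\<nu>) = ennreal (LINT \<alpha>|\<nu>. beta_kernel \<delta> (K * c \<alpha>) u)"
      by (rule nn_integral_eq_integral) (use ker0[OF Kc(1)] u in auto)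
    also have "(LINT \<alpha>|\<nu>. beta_kernel \<delta> (K * c \<alpha>) u) = ?a * z (K * u) + ?a * (1 - u) * K * z' (K * u)"
    proof -
      have "integrable \<nu> (\<lambda>\<alpha>. ?a * exp (- (K * u) * c \<alpha>))"
        "integrable \<nu> (\<lambda>\<alpha>. ?a * (1 - u) * K * (c \<alpha> * exp (- (K * u) * c \<alpha>)))"
        by (intro integrable_mult_right z_integrable z'_integrable)+
      from Bochner_Integration.integral_add[OF this] show ?thesis
        by (simp only: eq z_def z'_def integral_mult_right_zero)
    qed
    also have "\<dots> = ?T u"
    proof -
      have "(1 - u) powr (\<delta> + 1) = (1 - u) powr \<delta> * (1 - u)" using u by (simp add: powr_add)
      then show ?thesis
        by (simp only: specular_term_def derivative_term_def deriv_z_scaled divide_inverse) (simp add: algebra_simps)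
    qed
    finally show ?thesis by simp
  qed
  have "ennreal (LBINT y:{0..y0}. ?T y) = (\<integral>\<^sup>+y. ennreal (indicator {0..y0} y *\<^sub>R ?T y) \<partial>lborel)"
    unfolding set_lebesgue_integral_def
  proof (rule nn_integral_eq_integral[symmetric])
    show "integrable lborel (\<lambda>y. indicat_real {0..y0} y *\<^sub>R ?T y)"
      using set_integral_diff(1)[OF s1 s2] by (simp only: set_integrable_def)
    show "AE y in lborel. 0 \<le> indicat_real {0..y0} y *\<^sub>R ?T y"
      using T0 by (intro AE_I2 scaleR_nonneg_nonneg) auto
  qed
  \<comment> \<open>The only inequality: the nonnegative integrand is extended from [0, y0] to the
    unit interval.\<close>
  also have "\<dots> \<le> (\<integral>\<^sup>+y\<in>{0<..<1}. ennreal (?T y) \<partial>lborel)"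
  proof (rule nn_integral_mono_AE)
    show "AE y in lborel. ennreal (indicator {0..y0} y *\<^sub>R ?T y) \<le> ennreal (?T y) * indicator {0<..<1} y"
      using AE_lborel_singleton[of 0] by eventually_elim (use y0 in \<open>auto simp: indicator_def\<close>)
  qed
  also have "\<dots> = (\<integral>\<^sup>+y. \<integral>\<^sup>+\<alpha>. ennreal (beta_kernel \<delta> (K * c \<alpha>) y) * indicator {0<..<1} y \<partial>\<nu> \<partial>lborel)"
    by (rule nn_integral_cong) (simp add: T indicator_def)
  also have "\<dots> = (\<integral>\<^sup>+\<alpha>. \<integral>\<^sup>+y. ennreal (beta_kernel \<delta> (K * c \<alpha>) y) * indicator {0<..<1} y \<partial>lborel \<partial>\<nu>)"
  proof -
    interpret pair_sigma_finite \<nu> lborel by standard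
    show ?thesis unfolding beta_kernel_def by (rule Fubini') measurable
  qed
  also have "\<dots> = ennreal (integral\<^sup>L \<nu> ?H)"
    unfolding H by (rule nn_integral_eq_integral[OF Hint]) (use H0 in auto)
  finally have le: "ennreal (LBINT y:{0..y0}. ?T y) \<le> ennreal (integral\<^sup>L \<nu> ?H)" .
  have "0 \<le> integral\<^sup>L \<nu> ?H" by (rule Bochner_Integration.integral_nonneg) (rule H0)
  from le have "(LBINT y:{0..y0}. ?T y) \<le> integral\<^sup>L \<nu> ?H"
    unfolding ennreal_le_iff[OF \<open>0 \<le> integral\<^sup>L \<nu> ?H\<close>] .
  also have "(LBINT y:{0..y0}. ?T y) = (LBINT y:{0..y0}. specular_term \<delta> K y) - (LBINT y:{0..y0}. derivative_term \<delta> K y)"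
    by (rule set_integral_diff(2)[OF s1 s2])
  finally show ?thesis by (simp add: B_def)
qed

end

section \<open>Generalized two-ray fading\<close>

text \<open>Completing the square with w = 1 + 2 \<sigma>^2 t: the product is a multiple of the
  normal density with variance \<sigma>^2/w and mean -2 t \<sigma>^2 m/w. The change of variance
  yields 1/sqrt w, the leftover of the square the exponential.\<close>

lemma nn_integral_normal_shift:
  fixes m t \<sigma> :: real
  assumes \<sigma>: "0 < \<sigma>" and t: "0 \<le> t"
  shows "(\<integral>\<^sup>+x. ennreal (normal_density 0 \<sigma> x) * ennreal (exp (- t * (x + m)\<^sup>2)) \<partial>lborel) =
    ennreal (1 / sqrt (1 + 2 * \<sigma>\<^sup>2 * t) * exp (- t * m\<^sup>2 / (1 + 2 * \<sigma>\<^sup>2 * t)))"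
proof -
  define w where "w = 1 + 2 * \<sigma>\<^sup>2 * t"
  have w: "0 < w" using \<sigma> t by (simp add: w_def add_pos_nonneg)
  define \<tau> where "\<tau> = \<sigma> / sqrt w"
  define \<mu> where "\<mu> = - 2 * t * \<sigma>\<^sup>2 * m / w"
  have \<tau>: "0 < \<tau>" "\<tau>\<^sup>2 = \<sigma>\<^sup>2 / w" using \<sigma> w by (simp_all add: \<tau>_def power_divide)
  have eq: "normal_density 0 \<sigma> x * exp (- t * (x + m)\<^sup>2) = 1 / sqrt w * exp (- t * m\<^sup>2 / w) * normal_density \<mu> \<tau> x" for x
  proof -
    have e: "- x\<^sup>2 / (2 * \<sigma>\<^sup>2) - t * (x + m)\<^sup>2 = - t * m\<^sup>2 / w - (x - \<mu>)\<^sup>2 / (2 * \<tau>\<^sup>2)"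
    proof -
      have "(x - \<mu>)\<^sup>2 / (2 * \<tau>\<^sup>2) = (w * x + 2 * t * \<sigma>\<^sup>2 * m)\<^sup>2 / (2 * \<sigma>\<^sup>2 * w)"
      proof -
        have "x - \<mu> = (w * x + 2 * t * \<sigma>\<^sup>2 * m) / w" using w by (simp add: \<mu>_def field_simps)
        moreover have "(n / w)\<^sup>2 / (2 * (\<sigma>\<^sup>2 / w)) = n\<^sup>2 / (2 * \<sigma>\<^sup>2 * w)" for n
          using w \<sigma> by (simp add: power_divide power2_eq_square[of w])
        ultimately show ?thesis by (simp only: \<tau>(2))
      qed
      moreover have "- x\<^sup>2 / (2 * \<sigma>\<^sup>2) - t * (x + m)\<^sup>2 = - t * m\<^sup>2 / w - (w * x + 2 * t * \<sigma>\<^sup>2 * m)\<^sup>2 / (2 * \<sigma>\<^sup>2 * w)"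
      proof -
        have "(- x\<^sup>2 / (2 * \<sigma>\<^sup>2) - t * (x + m)\<^sup>2) * (2 * \<sigma>\<^sup>2 * w) = - x\<^sup>2 * w - t * (x + m)\<^sup>2 * (2 * \<sigma>\<^sup>2 * w)"
          using \<sigma> w by (simp add: field_simps)
        also have "\<dots> = - t * m\<^sup>2 * (2 * \<sigma>\<^sup>2) - (w * x + 2 * t * \<sigma>\<^sup>2 * m)\<^sup>2"
          unfolding w_def by (simp add: power2_eq_square algebra_simps)
        also have "\<dots> = (- t * m\<^sup>2 / w - (w * x + 2 * t * \<sigma>\<^sup>2 * m)\<^sup>2 / (2 * \<sigma>\<^sup>2 * w)) * (2 * \<sigma>\<^sup>2 * w)"
          using \<sigma> w by (simp add: field_simps)
        finally show ?thesis using \<sigma> w by simp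
      qed
      ultimately show ?thesis by simp
    qed
    have r: "sqrt (2 * pi * \<tau>\<^sup>2) = sqrt (2 * pi * \<sigma>\<^sup>2) / sqrt w"
      using w by (simp add: \<tau>(2) real_sqrt_divide)
    have e': "- x\<^sup>2 / (2 * \<sigma>\<^sup>2) + - t * (x + m)\<^sup>2 = - t * m\<^sup>2 / w + - (x - \<mu>)\<^sup>2 / (2 * \<tau>\<^sup>2)"
      using e by simp
    have "normal_density 0 \<sigma> x * exp (- t * (x + m)\<^sup>2) = 1 / sqrt (2 * pi * \<sigma>\<^sup>2) * exp (- x\<^sup>2 / (2 * \<sigma>\<^sup>2) + - t * (x + m)\<^sup>2)"
      by (simp only: normal_density_def diff_0_right exp_add mult.assoc)
    also have "\<dots> = 1 / sqrt (2 * pi * \<sigma>\<^sup>2) * (exp (- t * m\<^sup>2 / w) * exp (- (x - \<mu>)\<^sup>2 / (2 * \<tau>\<^sup>2)))"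
      by (simp only: e' exp_add)
    also have "\<dots> = 1 / sqrt w * exp (- t * m\<^sup>2 / w) * normal_density \<mu> \<tau> x"
    proof -
      have "1 / sqrt (2 * pi * \<tau>\<^sup>2) = sqrt w * (1 / sqrt (2 * pi * \<sigma>\<^sup>2))" by (simp only: r) simp
      then have "1 / sqrt (2 * pi * \<sigma>\<^sup>2) = 1 / sqrt w * (1 / sqrt (2 * pi * \<tau>\<^sup>2))" using w by simp
      then show ?thesis by (simp only: normal_density_def mult_ac)
    qed
    finally show ?thesis .
  qed
  have one: "(\<integral>\<^sup>+x. ennreal (normal_density \<mu> \<tau> x) \<partial>lborel) = 1"
    using prob_space.emeasure_space_1[OF prob_space_normal_density[OF \<tau>(1), of \<mu>]]
    by (simp add: emeasure_density)
  have "(\<integral>\<^sup>+x. ennreal (normal_density 0 \<sigma> x) * ennreal (exp (- t * (x + m)\<^sup>2)) \<partial>lborel) =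
    (\<integral>\<^sup>+x. ennreal (1 / sqrt w * exp (- t * m\<^sup>2 / w)) * ennreal (normal_density \<mu> \<tau> x) \<partial>lborel)"
  proof (rule nn_integral_cong)
    fix x
    have "ennreal (normal_density 0 \<sigma> x) * ennreal (exp (- t * (x + m)\<^sup>2)) = ennreal (normal_density 0 \<sigma> x * exp (- t * (x + m)\<^sup>2))"
      by (rule ennreal_mult[symmetric]) auto
    also have "\<dots> = ennreal (1 / sqrt w * exp (- t * m\<^sup>2 / w)) * ennreal (normal_density \<mu> \<tau> x)"
      unfolding eq using w by (intro ennreal_mult) auto
    finally show "ennreal (normal_density 0 \<sigma> x) * ennreal (exp (- t * (x + m)\<^sup>2)) =
      ennreal (1 / sqrt w * exp (- t * m\<^sup>2 / w)) * ennreal (normal_density \<mu> \<tau> x)" .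
  qed
  also have "\<dots> = ennreal (1 / sqrt w * exp (- t * m\<^sup>2 / w))"
    by (simp add: nn_integral_cmult one)
  finally show ?thesis unfolding w_def .
qed

lemma (in prob_space) indep_var_nn_integral_Fubini:
  assumes ind: "indep_var S A T B" and [measurable]: "H \<in> borel_measurable (S \<Otimes>\<^sub>M T)"
  shows "(\<integral>\<^sup>+\<omega>. H (A \<omega>, B \<omega>) \<partial>M) = (\<integral>\<^sup>+\<omega>'. \<integral>\<^sup>+\<omega>. H (A \<omega>, B \<omega>') \<partial>M \<partial>M)"
proof -
  have [measurable]: "A \<in> measurable M S" "B \<in> measurable M T"
    using ind by (auto dest: indep_var_rv1 indep_var_rv2)
  interpret A: prob_space "distr M S A" by (rule prob_space_distr) measurable
  interpret B: prob_space "distr M T B" by (rule prob_space_distr) measurable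
  interpret AB: pair_sigma_finite "distr M S A" "distr M T B" by standard
  have "(\<integral>\<^sup>+\<omega>. H (A \<omega>, B \<omega>) \<partial>M) = integral\<^sup>N (distr M (S \<Otimes>\<^sub>M T) (\<lambda>\<omega>. (A \<omega>, B \<omega>))) H"
    by (subst nn_integral_distr) auto
  also have "distr M (S \<Otimes>\<^sub>M T) (\<lambda>\<omega>. (A \<omega>, B \<omega>)) = distr M S A \<Otimes>\<^sub>M distr M T B"
    using ind unfolding indep_var_distribution_eq by simp
  also have "integral\<^sup>N (distr M S A \<Otimes>\<^sub>M distr M T B) H = (\<integral>\<^sup>+b. \<integral>\<^sup>+a. H (a, b) \<partial>distr M S A \<partial>distr M T B)"
    by (rule AB.nn_integral_snd[symmetric]) simp
  also have "\<dots> = (\<integral>\<^sup>+\<omega>'. \<integral>\<^sup>+a. H (a, B \<omega>') \<partial>distr M S A \<partial>M)"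
  proof (rule nn_integral_distr)
    have "(\<lambda>(b, a). H (a, b)) \<in> borel_measurable (T \<Otimes>\<^sub>M distr M S A)" by measurable
    from A.borel_measurable_nn_integral_fst[OF this]
    show "(\<lambda>b. \<integral>\<^sup>+a. H (a, b) \<partial>distr M S A) \<in> borel_measurable (distr M T B)" by simp
  qed measurable
  also have "\<dots> = (\<integral>\<^sup>+\<omega>'. \<integral>\<^sup>+\<omega>. H (A \<omega>, B \<omega>') \<partial>M \<partial>M)"
  proof (rule nn_integral_cong)
    fix \<omega>' assume "\<omega>' \<in> space M"
    then have [measurable]: "B \<omega>' \<in> space T" by (rule measurable_space[rotated]) measurable
    show "(\<integral>\<^sup>+a. H (a, B \<omega>') \<partial>distr M S A) = (\<integral>\<^sup>+\<omega>. H (A \<omega>, B \<omega>') \<partial>M)"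
      by (rule nn_integral_distr; measurable)
  qed
  finally show ?thesis .
qed

lemma cos_rmod: "cos (x rmod (2 * pi)) = cos x"
proof -
  define n where "n = \<lfloor>x / (2 * pi)\<rfloor>"
  have "x rmod (2 * pi) = x - 2 * pi * of_int n" by (simp add: rmod_def n_def mult_ac)
  then show ?thesis by (simp add: cos_diff)
qed

lemma norm_two_ray:
  "(cmod (of_real V1 * exp (\<i> * of_real a) + of_real V2 * exp (\<i> * of_real b) + Complex x y))\<^sup>2 =
    (x + (V1 * cos a + V2 * cos b))\<^sup>2 + (y + (V1 * sin a + V2 * sin b))\<^sup>2"
  unfolding cmod_power2 by (simp add: cis_conv_exp[symmetric] algebra_simps)

lemma two_ray_power:
  fixes V1 V2 a b :: real
  shows "(V1 * cos a + V2 * cos b)\<^sup>2 + (V1 * sin a + V2 * sin b)\<^sup>2 = V1\<^sup>2 + V2\<^sup>2 + 2 * V1 * V2 * cos (a - b)"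
proof -
  have "(V1 * cos a + V2 * cos b)\<^sup>2 + (V1 * sin a + V2 * sin b)\<^sup>2 =
    V1\<^sup>2 * ((cos a)\<^sup>2 + (sin a)\<^sup>2) + V2\<^sup>2 * ((cos b)\<^sup>2 + (sin b)\<^sup>2) + 2 * V1 * V2 * (cos a * cos b + sin a * sin b)"
  proof -
    have "(V1 * c1 + V2 * c2)\<^sup>2 + (V1 * s1 + V2 * s2)\<^sup>2 =
      V1\<^sup>2 * (c1\<^sup>2 + s1\<^sup>2) + V2\<^sup>2 * (c2\<^sup>2 + s2\<^sup>2) + 2 * V1 * V2 * (c1 * c2 + s1 * s2)" for c1 c2 s1 s2 :: real
      by (simp add: power2_eq_square algebra_simps)
    then show ?thesis .
  qed
  then show ?thesis by (simp add: cos_diff)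
qed

text \<open>Total mass 1 is not built in; it follows from the identification with the law of the
  phase difference.\<close>

definition phase_measure :: "(real \<Rightarrow> real) \<Rightarrow> real measure" where
  "phase_measure f = density lborel (\<lambda>a. ennreal (f a) * indicator {0..2*pi} a)"

text \<open>The phase difference is independent of the diffuse part, which integrates out to two
  Gaussian factors.\<close>

lemma (in prob_space) gtr_nn_transform:
  assumes gtr: "gtr_fading M K \<Delta> \<sigma> f g" and t: "0 \<le> t"
  defines "y \<equiv> 2 * \<sigma>\<^sup>2 * t / (1 + 2 * \<sigma>\<^sup>2 * t)"
  shows "(\<integral>\<^sup>+\<omega>. ennreal (exp (- t * (cmod (g \<omega>))\<^sup>2)) \<partial>M) =
      (\<integral>\<^sup>+\<alpha>. ennreal ((1 - y) * exp (- (K * y) * (1 + \<Delta> * cos \<alpha>))) \<partial>phase_measure f)"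
    and "prob_space (phase_measure f)" and "(\<lambda>a. ennreal (f a) * indicator {0..2*pi} a) \<in> borel_measurable borel"
    and "0 \<le> K" and "\<bar>\<Delta>\<bar> \<le> 1" and "0 < \<sigma>"
proof -
  from gtr obtain V1 V2 \<phi>1 \<phi>2 X Y where \<sigma>: "0 < \<sigma>" and V: "0 \<le> V1" "0 \<le> V2"
    and K: "K = (V1\<^sup>2 + V2\<^sup>2) / (2 * \<sigma>\<^sup>2)" and \<Delta>: "\<Delta> = 2 * V1 * V2 / (V1\<^sup>2 + V2\<^sup>2)"
    and ph [measurable]: "\<phi>1 \<in> borel_measurable M" "\<phi>2 \<in> borel_measurable M"
    and X: "distributed M lborel X (\<lambda>x. ennreal (normal_density 0 \<sigma> x))"
    and Y: "distributed M lborel Y (\<lambda>x. ennreal (normal_density 0 \<sigma> x))"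
    and XY: "indep_var borel X borel Y"
    and XYp: "indep_var borel (\<lambda>\<omega>. (X \<omega>, Y \<omega>)) borel (\<lambda>\<omega>. (\<phi>1 \<omega>, \<phi>2 \<omega>))"
    and al: "distributed M lborel (\<lambda>\<omega>. (\<phi>1 \<omega> - \<phi>2 \<omega>) rmod (2*pi)) (\<lambda>a. ennreal (f a) * indicator {0..2*pi} a)"
    and g: "AE \<omega> in M. g \<omega> = of_real V1 * exp (\<i> * of_real (\<phi>1 \<omega>))
           + of_real V2 * exp (\<i> * of_real (\<phi>2 \<omega>)) + Complex (X \<omega>) (Y \<omega>)"
    unfolding gtr_fading_def by blast
  show "0 < \<sigma>" by fact
  show "0 \<le> K" unfolding K by simp
  show "\<bar>\<Delta>\<bar> \<le> 1"
  proof (cases "V1 = 0 \<and> V2 = 0")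
    case False
    then have "0 < V1\<^sup>2 + V2\<^sup>2" by (auto simp: sum_power2_gt_zero_iff)
    then show ?thesis unfolding \<Delta> using V sum_squares_bound[of V1 V2] by (simp add: abs_mult)
  qed (auto simp: \<Delta>)
  have [measurable]: "X \<in> borel_measurable M" "Y \<in> borel_measurable M"
    using distributed_measurable[OF X] distributed_measurable[OF Y] by simp_all
  show m: "(\<lambda>a. ennreal (f a) * indicator {0..2*pi} a) \<in> borel_measurable borel"
    using distributed_borel_measurable[OF al] by simp
  have d: "distr M lborel (\<lambda>\<omega>. (\<phi>1 \<omega> - \<phi>2 \<omega>) rmod (2*pi)) = phase_measure f"
    using distributed_distr_eq_density[OF al] by (simp add: phase_measure_def)
  show "prob_space (phase_measure f)"
    unfolding d[symmetric] by (rule prob_space_distr[OF distributed_measurable[OF al]])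
  define w where "w = 1 + 2 * \<sigma>\<^sup>2 * t"
  have w: "0 < w" using \<sigma> t by (simp add: w_def add_pos_nonneg)
  \<comment> \<open>The real and imaginary Gaussian parts each contribute 1/sqrt w; together they
    give 1/w, which is 1 - y.\<close>
  have y: "1 - y = 1 / w" "y = 2 * \<sigma>\<^sup>2 * t / w" using w by (simp_all add: y_def w_def field_simps)
  define m1 where "m1 p = V1 * cos (fst p) + V2 * cos (snd p)" for p
  define m2 where "m2 p = V1 * sin (fst p) + V2 * sin (snd p)" for p
  have [measurable]: "m1 \<in> borel_measurable (borel \<Otimes>\<^sub>M borel)" "m2 \<in> borel_measurable (borel \<Otimes>\<^sub>M borel)"
    unfolding m1_def[abs_def] m2_def[abs_def] by measurable
  define E where "E x m = ennreal (exp (- t * (x + m)\<^sup>2))" for x m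
  have [measurable (raw)]: "(\<lambda>x. E (a x) (b x)) \<in> borel_measurable N"
    if [measurable]: "a \<in> borel_measurable N" "b \<in> borel_measurable N" for N :: "(real \<times> real) measure" and a b
    unfolding E_def by measurable
  have gaussX: "(\<integral>\<^sup>+\<omega>. E (Z \<omega>) m \<partial>M) = ennreal (1 / sqrt w * exp (- t * m\<^sup>2 / w))"
    if Z: "distributed M lborel Z (\<lambda>x. ennreal (normal_density 0 \<sigma> x))" for Z m
    unfolding E_def w_def nn_integral_normal_shift[OF \<sigma> t, symmetric]
    by (rule distributed_nn_integral[OF Z, symmetric]) measurable
  have inner: "(\<integral>\<^sup>+\<omega>. E (X \<omega>) a * E (Y \<omega>) b \<partial>M) = ennreal (1 / w * exp (- t * (a\<^sup>2 + b\<^sup>2) / w))" for a b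
  proof -
    have "(\<integral>\<^sup>+\<omega>. E (X \<omega>) a * E (Y \<omega>) b \<partial>M) = (\<integral>\<^sup>+\<omega>. (\<lambda>(x, y). E x a * E y b) (X \<omega>, Y \<omega>) \<partial>M)" by simp
    also have "\<dots> = (\<integral>\<^sup>+\<omega>'. \<integral>\<^sup>+\<omega>. (\<lambda>(x, y). E x a * E y b) (X \<omega>, Y \<omega>') \<partial>M \<partial>M)"
      by (rule indep_var_nn_integral_Fubini[OF XY]) (unfold E_def, measurable)
    also have "\<dots> = ennreal (1 / sqrt w * exp (- t * a\<^sup>2 / w)) * ennreal (1 / sqrt w * exp (- t * b\<^sup>2 / w))"
    proof -
      have [measurable]: "(\<lambda>\<omega>. E (X \<omega>) a) \<in> borel_measurable M" "(\<lambda>\<omega>. E (Y \<omega>) b) \<in> borel_measurable M"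
        unfolding E_def by measurable
      show ?thesis by (simp only: prod.case nn_integral_multc nn_integral_cmult gaussX[OF X] gaussX[OF Y] \<open>(\<lambda>\<omega>. E (X \<omega>) a) \<in> borel_measurable M\<close> \<open>(\<lambda>\<omega>. E (Y \<omega>) b) \<in> borel_measurable M\<close>)
    qed
    also have "\<dots> = ennreal ((1 / sqrt w * (1 / sqrt w)) * (exp (- t * a\<^sup>2 / w) * exp (- t * b\<^sup>2 / w)))"
      using w by (subst ennreal_mult[symmetric]) (auto simp: mult_ac)
    also have "1 / sqrt w * (1 / sqrt w) = 1 / w" using w by simp
    also have "exp (- t * a\<^sup>2 / w) * exp (- t * b\<^sup>2 / w) = exp (- t * (a\<^sup>2 + b\<^sup>2) / w)"
      by (simp add: exp_add[symmetric] add_divide_distrib[symmetric] algebra_simps)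
    finally show ?thesis .
  qed
  have "(\<integral>\<^sup>+\<omega>. ennreal (exp (- t * (cmod (g \<omega>))\<^sup>2)) \<partial>M) =
    (\<integral>\<^sup>+\<omega>. (\<lambda>(xy, p). E (fst xy) (m1 p) * E (snd xy) (m2 p)) ((X \<omega>, Y \<omega>), (\<phi>1 \<omega>, \<phi>2 \<omega>)) \<partial>M)"
  proof (rule nn_integral_cong_AE)
    show "AE \<omega> in M. ennreal (exp (- t * (cmod (g \<omega>))\<^sup>2)) =
      (\<lambda>(xy, p). E (fst xy) (m1 p) * E (snd xy) (m2 p)) ((X \<omega>, Y \<omega>), (\<phi>1 \<omega>, \<phi>2 \<omega>))"
      using g
    proof eventually_elim
      case (elim \<omega>)
      show ?case
        unfolding elim norm_two_ray E_def
        by (simp add: m1_def m2_def ennreal_mult[symmetric] exp_add[symmetric] algebra_simps)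
    qed
  qed
  also have "\<dots> = (\<integral>\<^sup>+\<omega>'. \<integral>\<^sup>+\<omega>. (\<lambda>(xy, p). E (fst xy) (m1 p) * E (snd xy) (m2 p)) ((X \<omega>, Y \<omega>), (\<phi>1 \<omega>', \<phi>2 \<omega>')) \<partial>M \<partial>M)"
    by (rule indep_var_nn_integral_Fubini[OF XYp]) (unfold E_def borel_prod[symmetric], measurable)
  also have "\<dots> = (\<integral>\<^sup>+\<omega>'. ennreal ((1 - y) * exp (- (K * y) * (1 + \<Delta> * cos ((\<phi>1 \<omega>' - \<phi>2 \<omega>') rmod (2*pi))))) \<partial>M)"
  proof (rule nn_integral_cong)
    fix \<omega>'
    \<comment> \<open>If both amplitudes vanish then \<Delta> is 0 by the convention for division,
      and the second identity reads 0 = 0.\<close>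
    have KD: "2 * \<sigma>\<^sup>2 * K = V1\<^sup>2 + V2\<^sup>2" "(V1\<^sup>2 + V2\<^sup>2) * \<Delta> = 2 * V1 * V2"
      using \<sigma> by (auto simp: K \<Delta>)
    have "(m1 (\<phi>1 \<omega>', \<phi>2 \<omega>'))\<^sup>2 + (m2 (\<phi>1 \<omega>', \<phi>2 \<omega>'))\<^sup>2 = (V1\<^sup>2 + V2\<^sup>2) + (V1\<^sup>2 + V2\<^sup>2) * \<Delta> * cos (\<phi>1 \<omega>' - \<phi>2 \<omega>')"
      by (simp only: m1_def m2_def fst_conv snd_conv two_ray_power KD(2))
    also have "\<dots> = 2 * \<sigma>\<^sup>2 * K * (1 + \<Delta> * cos (\<phi>1 \<omega>' - \<phi>2 \<omega>'))"
      unfolding KD(1)[symmetric] by (simp add: algebra_simps)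
    finally have "- t * ((m1 (\<phi>1 \<omega>', \<phi>2 \<omega>'))\<^sup>2 + (m2 (\<phi>1 \<omega>', \<phi>2 \<omega>'))\<^sup>2) / w = - (K * y) * (1 + \<Delta> * cos (\<phi>1 \<omega>' - \<phi>2 \<omega>'))"
      by (simp add: y(2))
    then show "(\<integral>\<^sup>+\<omega>. (\<lambda>(xy, p). E (fst xy) (m1 p) * E (snd xy) (m2 p)) ((X \<omega>, Y \<omega>), (\<phi>1 \<omega>', \<phi>2 \<omega>')) \<partial>M) =
      ennreal ((1 - y) * exp (- (K * y) * (1 + \<Delta> * cos ((\<phi>1 \<omega>' - \<phi>2 \<omega>') rmod (2*pi)))))"
      by (simp only: prod.case fst_conv snd_conv inner cos_rmod y(1))
  qed
  also have "\<dots> = (\<integral>\<^sup>+\<alpha>. ennreal ((1 - y) * exp (- (K * y) * (1 + \<Delta> * cos \<alpha>))) \<partial>phase_measure f)"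
    unfolding d[symmetric] by (subst nn_integral_distr[OF distributed_measurable[OF al]]) auto
  finally show "(\<integral>\<^sup>+\<omega>. ennreal (exp (- t * (cmod (g \<omega>))\<^sup>2)) \<partial>M) =
      (\<integral>\<^sup>+\<alpha>. ennreal ((1 - y) * exp (- (K * y) * (1 + \<Delta> * cos \<alpha>))) \<partial>phase_measure f)" .
qed

text \<open>Measurability is available only for the truncated \<open>ennreal\<close> version of
  \<open>f\<close>. Nonnegativity on [0, 2 pi] lets \<open>enn2real\<close> recover the truncated
  real function from it.\<close>

lemma LINT_phase_measure:
  assumes m: "(\<lambda>a. ennreal (f a) * indicator {0..2*pi} a) \<in> borel_measurable borel"
    and f: "\<forall>a\<in>{0..2*pi}. 0 \<le> f a" and [measurable]: "F \<in> borel_measurable borel"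
  shows "(LINT \<alpha>|phase_measure f. F \<alpha>) = (LBINT \<alpha>:{0..2*pi}. F \<alpha> * f \<alpha>)"
proof -
  let ?f = "\<lambda>a. indicator {0..2*pi} a * f a"
  have eq: "(\<lambda>a. ennreal (f a) * indicator {0..2*pi} a) = (\<lambda>a. ennreal (?f a))"
    by (auto simp: indicator_def fun_eq_iff)
  have "(\<lambda>a. enn2real (ennreal (?f a))) = ?f" using f by (auto simp: indicator_def fun_eq_iff)
  moreover have "(\<lambda>a. enn2real (ennreal (?f a))) \<in> borel_measurable borel"
    using m unfolding eq by (rule measurable_compose) simp
  ultimately have fm [measurable]: "?f \<in> borel_measurable borel" by (simp only:)
  have "(LINT \<alpha>|phase_measure f. F \<alpha>) = (LINT \<alpha>|lborel. ?f \<alpha> *\<^sub>R F \<alpha>)"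
    unfolding phase_measure_def eq using f fm by (intro integral_density) (auto split: split_indicator)
  then show ?thesis by (simp add: set_lebesgue_integral_def mult_ac)
qed

section \<open>The lower incomplete gamma function\<close>

lemma measurable_lower_gamma [measurable]: "lower_gamma a \<in> borel_measurable borel"
proof -
  have "(\<lambda>(x, t). (if 0 \<le> t \<and> t \<le> x then t powr (a - 1) * exp (- t) else 0)) \<in> borel_measurable (borel \<Otimes>\<^sub>M lborel)"
    by measurable
  from lborel.borel_measurable_lebesgue_integral[OF this]
  have "(\<lambda>x. LBINT t. (if 0 \<le> t \<and> t \<le> x then t powr (a - 1) * exp (- t) else 0)) \<in> borel_measurable borel"
    by simp
  also have "(\<lambda>x. LBINT t. (if 0 \<le> t \<and> t \<le> x then t powr (a - 1) * exp (- t) else 0)) = lower_gamma a"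
    by (auto simp: lower_gamma_def set_lebesgue_integral_def fun_eq_iff intro!: Bochner_Integration.integral_cong split: split_indicator)
  finally show ?thesis .
qed

lemma has_bochner_integral_lower_gamma:
  fixes a x :: real
  assumes a: "0 < a" and x: "0 \<le> x"
  shows "has_bochner_integral lborel (\<lambda>t. indicator {0<..<x} t * (t powr (a - 1) * exp (- t))) (lower_gamma a x)"
proof -
  have "((\<lambda>t. t powr (a - 1)) has_integral (x powr (a - 1 + 1) / (a - 1 + 1))) {0..x}"
    using a x by (intro has_integral_powr_from_0) auto
  then have "((\<lambda>t. if t \<in> {0..x} then t powr (a - 1) else 0) has_integral (x powr (a - 1 + 1) / (a - 1 + 1))) UNIV"
    by (simp only: has_integral_restrict_UNIV)
  then have nn: "(\<integral>\<^sup>+t. ennreal (if t \<in> {0..x} then t powr (a - 1) else 0) \<partial>lborel) = ennreal (x powr (a - 1 + 1) / (a - 1 + 1))"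
    by (intro nn_integral_has_integral_lborel) auto
  have "integrable lborel (\<lambda>t. if t \<in> {0..x} then t powr (a - 1) else 0)"
  proof (rule integrableI_nonneg)
    show "(\<integral>\<^sup>+t. ennreal (if t \<in> {0..x} then t powr (a - 1) else 0) \<partial>lborel) < \<infinity>"
      unfolding nn by simp
  qed auto
  then have i: "integrable lborel (\<lambda>t. indicator {0<..<x} t * (t powr (a - 1) * exp (- t)))"
    by (rule Bochner_Integration.integrable_bound) (auto simp: indicator_def intro!: mult_left_le)
  have "(LINT t|lborel. indicator {0<..<x} t * (t powr (a - 1) * exp (- t))) = lower_gamma a x"
    unfolding lower_gamma_def set_lebesgue_integral_def
  proof (rule integral_cong_AE)
    show "AE t in lborel. indicator {0<..<x} t * (t powr (a - 1) * exp (- t)) = indicat_real {0..x} t *\<^sub>R (t powr (a - 1) * exp (- t))"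
      using AE_lborel_singleton[of 0] AE_lborel_singleton[of x] by eventually_elim (auto simp: indicator_def)
  qed auto
  with i show ?thesis by (simp add: has_bochner_integral_iff)
qed

text \<open>\<open>layer_cake\<close> for Y(v) = k v^(-eta), density exp(-u) and inverse
  (k/u)^(1/eta): the part (k/u)^(2/eta) gives the incomplete gamma function and the part r^2 gives 1
  - exp. The second claim says that \<open>ennreal\<close> does not truncate the difference.\<close>

lemma nn_integral_one_minus_exp_path:
  fixes \<eta> k r :: real
  assumes \<eta>: "2 < \<eta>" and k: "0 \<le> k" and r: "0 < r"
  shows "(\<integral>\<^sup>+v\<in>{r<..}. ennreal (2 * v * (1 - exp (- k * v powr (-\<eta>)))) \<partial>lborel) =
    ennreal (k powr (2 / \<eta>) * lower_gamma (1 - 2 / \<eta>) (k * r powr (-\<eta>)) - r\<^sup>2 * (1 - exp (- k * r powr (-\<eta>))))"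
    and "r\<^sup>2 * (1 - exp (- k * r powr (-\<eta>))) \<le> k powr (2 / \<eta>) * lower_gamma (1 - 2 / \<eta>) (k * r powr (-\<eta>))"
proof -
  let ?Y = "\<lambda>v. k * v powr (-\<eta>)" and ?V = "\<lambda>u. (k / u) powr (1 / \<eta>)"
  let ?x = "k * r powr (-\<eta>)" and ?\<delta> = "2 / \<eta>"
  have \<delta>: "0 < ?\<delta>" "?\<delta> < 1" using \<eta> by auto
  have x: "0 \<le> ?x" using k by simp
  \<comment> \<open>The case k = 0 is real: k will be a multiple of c(\<alpha>), which can vanish
    when |\<Delta>| = 1. Both sides are then false.\<close>
  have less: "u < ?Y v \<longleftrightarrow> v < ?V u" if "0 < u" "0 < v" for u v
  proof (cases "k = 0")
    case False
    then have "v < ?V u \<longleftrightarrow> v powr \<eta> < k / u"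
      using k that \<eta> by (intro less_root_powr_iff) auto
    also have "\<dots> \<longleftrightarrow> u < ?Y v" using that by (simp add: powr_minus field_simps)
    finally show ?thesis by simp
  qed (use that in auto)
  have mono: "?Y v \<le> ?x" if "r < v" for v
    using that k r \<eta> by (intro mult_left_mono) (auto simp: powr_minus intro!: le_imp_inverse_le powr_mono2)
  have inv: "u < ?Y v \<longleftrightarrow> u < ?x \<and> v < ?V u" if uv: "0 < u" "r < v" for u v
    using less[of u v] mono[of v] uv r by auto
  have V: "r \<le> ?V u" if "0 < u" "u < ?x" for u using less[of u r] that r by simp
  have E: "(\<integral>\<^sup>+u\<in>{0<..<y}. ennreal (exp (- u)) \<partial>lborel) = ennreal (1 - exp (- y))" if y: "0 \<le> y" for y
  proof -
    have "(\<integral>\<^sup>+u\<in>{0<..<y}. ennreal (exp (- u)) \<partial>lborel) = (\<integral>\<^sup>+u\<in>{0..y}. ennreal (exp (- u)) \<partial>lborel)"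
    proof (rule nn_integral_cong_AE)
      show "AE u in lborel. ennreal (exp (- u)) * indicator {0<..<y} u = ennreal (exp (- u)) * indicator {0..y} u"
        using AE_lborel_singleton[of 0] AE_lborel_singleton[of y] by eventually_elim (auto simp: indicator_def)
    qed
    also have "\<dots> = ennreal (- exp (- y) - (- exp (- 0)))"
      by (rule nn_integral_FTC_Icc) (use y in \<open>auto intro!: derivative_eq_intros\<close>)
    finally show ?thesis by simp
  qed
  have g: "has_bochner_integral lborel (\<lambda>u. k powr ?\<delta> * (indicator {0<..<?x} u * (u powr (1 - ?\<delta> - 1) * exp (- u))))
      (k powr ?\<delta> * lower_gamma (1 - ?\<delta>) ?x)"
    by (intro has_bochner_integral_mult_right has_bochner_integral_lower_gamma) (use \<delta> x in auto)
  have e: "has_bochner_integral lborel (\<lambda>u. r\<^sup>2 * (indicator {0<..<?x} u * exp (- u))) (r\<^sup>2 * (1 - exp (- ?x)))"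
  proof (intro has_bochner_integral_mult_right has_bochner_integral_nn_integral)
    have "(\<integral>\<^sup>+u. ennreal (indicator {0<..<?x} u * exp (- u)) \<partial>lborel) = (\<integral>\<^sup>+u\<in>{0<..<?x}. ennreal (exp (- u)) \<partial>lborel)"
      by (rule nn_integral_cong) (auto simp: indicator_def)
    then show "(\<integral>\<^sup>+u. ennreal (indicator {0<..<?x} u * exp (- u)) \<partial>lborel) = ennreal (1 - exp (- ?x))"
      using E[OF x] by simp
  qed (use x in auto)
  let ?G = "\<lambda>u. k powr ?\<delta> * (indicator {0<..<?x} u * (u powr (1 - ?\<delta> - 1) * exp (- u))) - r\<^sup>2 * (indicator {0<..<?x} u * exp (- u))"
  have G: "?G u = indicator {0<..<?x} u * (exp (- u) * ((?V u)\<^sup>2 - r\<^sup>2))" for u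
  proof (cases "u \<in> {0<..<?x}")
    case True
    have "(k / u) powr ?\<delta> = k powr ?\<delta> * u powr (1 - ?\<delta> - 1)"
      using True k by (simp add: powr_divide powr_minus_divide)
    then show ?thesis using True unfolding root_powr_square by (simp add: algebra_simps)
  qed (auto simp: indicator_def)
  have G0: "0 \<le> ?G u" for u
  proof -
    have "r\<^sup>2 \<le> (?V u)\<^sup>2" if "0 < u" "u < ?x" using V[OF that] r by (intro power_mono) auto
    then show ?thesis unfolding G by (auto simp: indicator_def)
  qed
  have b: "has_bochner_integral lborel ?G (k powr ?\<delta> * lower_gamma (1 - ?\<delta>) ?x - r\<^sup>2 * (1 - exp (- ?x)))"
    by (rule has_bochner_integral_diff[OF g e])
  have "0 \<le> integral\<^sup>L lborel ?G" by (rule Bochner_Integration.integral_nonneg) (rule G0)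
  then show "r\<^sup>2 * (1 - exp (- k * r powr (-\<eta>))) \<le> k powr (2 / \<eta>) * lower_gamma (1 - 2 / \<eta>) (k * r powr (-\<eta>))"
    using b by (simp add: has_bochner_integral_iff)
  have "(\<integral>\<^sup>+v\<in>{r<..}. ennreal (2 * v * (1 - exp (- k * v powr (-\<eta>)))) \<partial>lborel) =
    (\<integral>\<^sup>+v\<in>{r<..}. ennreal (2 * v) * (\<integral>\<^sup>+u\<in>{0<..<?Y v}. ennreal (exp (- u)) \<partial>lborel) \<partial>lborel)"
  proof (rule nn_integral_cong)
    fix v :: real
    show "ennreal (2 * v * (1 - exp (- k * v powr (-\<eta>)))) * indicator {r<..} v =
      ennreal (2 * v) * (\<integral>\<^sup>+u\<in>{0<..<?Y v}. ennreal (exp (- u)) \<partial>lborel) * indicator {r<..} v"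
      using E[of "?Y v"] k r by (cases "r < v") (simp_all add: ennreal_mult)
  qed
  also have "\<dots> = (\<integral>\<^sup>+u\<in>{0<..<?x}. ennreal (exp (- u)) * ennreal ((?V u)\<^sup>2 - r\<^sup>2) \<partial>lborel)"
    by (rule layer_cake[OF _ _ _ inv V]) (use r in auto)
  also have "\<dots> = (\<integral>\<^sup>+u. ennreal (?G u) \<partial>lborel)"
    unfolding G by (rule nn_integral_cong) (auto simp: indicator_def ennreal_mult')
  also have "\<dots> = ennreal (k powr ?\<delta> * lower_gamma (1 - ?\<delta>) ?x - r\<^sup>2 * (1 - exp (- ?x)))"
    using b G0 by (subst nn_integral_eq_integral) (auto simp: has_bochner_integral_iff)
  finally show "(\<integral>\<^sup>+v\<in>{r<..}. ennreal (2 * v * (1 - exp (- k * v powr (-\<eta>)))) \<partial>lborel) =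
    ennreal (k powr (2 / \<eta>) * lower_gamma (1 - 2 / \<eta>) (k * r powr (-\<eta>)) - r\<^sup>2 * (1 - exp (- k * r powr (-\<eta>))))"
    by simp
qed

text \<open>For each phase, k is replaced by k c(\<alpha>), and Tonelli exchanges phase and
  distance; the power (k c)^(2/eta) leaves c^(2/eta) under the phase average. Only the difference is
  integrable at first, and adding back the bounded part makes the gamma part integrable too.\<close>

lemma (in phase_law) phase_average_path_integral:
  assumes \<eta>: "2 < \<eta>" and k: "0 < k" and r: "0 < r"
    and int: "set_integrable lborel {r..} (\<lambda>v. 2 * v * (1 - z (k * v powr (-\<eta>))))"
  shows "(LBINT v:{r..}. 2 * v * (1 - z (k * v powr (-\<eta>)))) =
    k powr (2 / \<eta>) * (LINT \<alpha>|\<nu>. c \<alpha> powr (2 / \<eta>) * lower_gamma (1 - 2 / \<eta>) (k * r powr (-\<eta>) * c \<alpha>))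
      - r\<^sup>2 * (1 - z (k * r powr (-\<eta>)))"
proof -
  let ?A = "LBINT v:{r..}. 2 * v * (1 - z (k * v powr (-\<eta>)))"
  let ?g = "\<lambda>\<alpha>. k powr (2 / \<eta>) * (c \<alpha> powr (2 / \<eta>) * lower_gamma (1 - 2 / \<eta>) (k * r powr (-\<eta>) * c \<alpha>))"
  let ?e = "\<lambda>\<alpha>. r\<^sup>2 * (1 - exp (- (k * r powr (-\<eta>)) * c \<alpha>))"
  have kc: "0 \<le> k * c \<alpha>" for \<alpha> using k c_bounds by simp
  have one: "1 - z x = (LINT \<alpha>|\<nu>. 1 - exp (- x * c \<alpha>))" for x
    unfolding z_def by (subst Bochner_Integration.integral_diff[OF _ z_integrable]) (simp_all add: prob_space)
  have pos: "0 \<le> 2 * v * (1 - z (k * v powr (-\<eta>)))" if "r \<le> v" for v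
    using that r k z_le_1[of "k * v powr (-\<eta>)"] by simp
  have A0: "0 \<le> ?A" by (rule LBINT_nonneg) (use pos in auto)
  have "ennreal ?A = (\<integral>\<^sup>+v\<in>{r<..}. ennreal (2 * v * (1 - z (k * v powr (-\<eta>)))) \<partial>lborel)"
    by (rule nn_integral_Ici_of_has_bochner[OF int pos, symmetric])
  also have "\<dots> = (\<integral>\<^sup>+v. \<integral>\<^sup>+\<alpha>. ennreal (2 * v * (1 - exp (- (k * c \<alpha>) * v powr (-\<eta>)))) * indicator {r<..} v \<partial>\<nu> \<partial>lborel)"
  proof (rule nn_integral_cong)
    fix v :: real
    show "ennreal (2 * v * (1 - z (k * v powr (-\<eta>)))) * indicator {r<..} v =
      (\<integral>\<^sup>+\<alpha>. ennreal (2 * v * (1 - exp (- (k * c \<alpha>) * v powr (-\<eta>)))) * indicator {r<..} v \<partial>\<nu>)"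
    proof (cases "r < v")
      case True
      have eq: "2 * v * (1 - exp (- (k * c \<alpha>) * v powr (-\<eta>))) = 2 * v * (1 - exp (- (k * v powr (-\<eta>)) * c \<alpha>))" for \<alpha>
        by (simp add: mult_ac)
      have "(\<integral>\<^sup>+\<alpha>. ennreal (2 * v * (1 - exp (- (k * c \<alpha>) * v powr (-\<eta>)))) \<partial>\<nu>) =
        ennreal (LINT \<alpha>|\<nu>. 2 * v * (1 - exp (- (k * v powr (-\<eta>)) * c \<alpha>)))"
        unfolding eq
      proof (rule nn_integral_eq_integral)
        show "integrable \<nu> (\<lambda>\<alpha>. 2 * v * (1 - exp (- (k * v powr (-\<eta>)) * c \<alpha>)))"
          by (intro integrable_mult_right Bochner_Integration.integrable_diff z_integrable) simp
        show "AE \<alpha> in \<nu>. 0 \<le> 2 * v * (1 - exp (- (k * v powr (-\<eta>)) * c \<alpha>))"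
          using True r k c_bounds by (intro AE_I2 mult_nonneg_nonneg) auto
      qed
      then show ?thesis using True by (simp only: one integral_mult_right_zero) simp
    qed simp
  qed
  also have "\<dots> = (\<integral>\<^sup>+\<alpha>. \<integral>\<^sup>+v. ennreal (2 * v * (1 - exp (- (k * c \<alpha>) * v powr (-\<eta>)))) * indicator {r<..} v \<partial>lborel \<partial>\<nu>)"
  proof -
    interpret pair_sigma_finite \<nu> lborel by standard
    show ?thesis by (rule Fubini') measurable
  qed
  also have "\<dots> = (\<integral>\<^sup>+\<alpha>. ennreal (?g \<alpha> - ?e \<alpha>) \<partial>\<nu>)"
  proof (rule nn_integral_cong)
    fix \<alpha>
    have "(k * c \<alpha>) powr (2 / \<eta>) = k powr (2 / \<eta>) * c \<alpha> powr (2 / \<eta>)" using k c_bounds by (simp add: powr_mult)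
    then show "(\<integral>\<^sup>+v. ennreal (2 * v * (1 - exp (- (k * c \<alpha>) * v powr (-\<eta>)))) * indicator {r<..} v \<partial>lborel) = ennreal (?g \<alpha> - ?e \<alpha>)"
      unfolding nn_integral_one_minus_exp_path(1)[OF \<eta> kc r] by (simp add: mult_ac)
  qed
  finally have nn: "(\<integral>\<^sup>+\<alpha>. ennreal (?g \<alpha> - ?e \<alpha>) \<partial>\<nu>) = ennreal ?A" by simp
  have "has_bochner_integral \<nu> (\<lambda>\<alpha>. ?g \<alpha> - ?e \<alpha>) ?A"
  proof (rule has_bochner_integral_nn_integral[OF _ _ A0 nn])
    show "(\<lambda>\<alpha>. ?g \<alpha> - ?e \<alpha>) \<in> borel_measurable \<nu>" by measurable
    show "AE \<alpha> in \<nu>. 0 \<le> ?g \<alpha> - ?e \<alpha>"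
    proof (rule AE_I2)
      fix \<alpha>
      have "(k * c \<alpha>) powr (2 / \<eta>) = k powr (2 / \<eta>) * c \<alpha> powr (2 / \<eta>)" using k c_bounds by (simp add: powr_mult)
      then show "0 \<le> ?g \<alpha> - ?e \<alpha>"
        using nn_integral_one_minus_exp_path(2)[OF \<eta> kc r, of \<alpha>] by (simp add: mult_ac)
    qed
  qed
  moreover have "has_bochner_integral \<nu> ?e (r\<^sup>2 * (1 - z (k * r powr (-\<eta>))))"
  proof -
    have "integrable \<nu> ?e"
      by (intro integrable_mult_right Bochner_Integration.integrable_diff z_integrable) simp
    then show ?thesis by (simp only: one has_bochner_integral_iff integral_mult_right_zero simp_thms)
  qed
  ultimately have "has_bochner_integral \<nu> (\<lambda>\<alpha>. (?g \<alpha> - ?e \<alpha>) + ?e \<alpha>) (?A + r\<^sup>2 * (1 - z (k * r powr (-\<eta>))))"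
    by (rule has_bochner_integral_add)
  then have "integral\<^sup>L \<nu> ?g = ?A + r\<^sup>2 * (1 - z (k * r powr (-\<eta>)))"
    by (simp only: diff_add_cancel has_bochner_integral_iff)
  then show ?thesis by (simp only: integral_mult_right_zero)
qed

section \<open>Spectral efficiency under generalized two-ray fading\<close>

lemma phase_law_gtr:
  assumes "prob_space M" "gtr_fading M K \<Delta> \<sigma> f g"
  shows "phase_law (phase_measure f) \<Delta>"
proof -
  interpret prob_space M by fact
  interpret p: prob_space "phase_measure f" using gtr_nn_transform(2)[OF assms(2) order_refl] .
  show ?thesis
    by standard (use gtr_nn_transform(5)[OF assms(2) order_refl] in \<open>auto simp: phase_measure_def\<close>)
qed

lemma (in prob_space) gtr_transform:
  assumes gtr: "gtr_fading M K \<Delta> \<sigma> f g" and t: "0 \<le> t"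
  shows "expectation (\<lambda>\<omega>. exp (- t * (cmod (g \<omega>))\<^sup>2)) =
    1 - phase_law.power_defect (phase_measure f) \<Delta> K (2 * \<sigma>\<^sup>2 * t / (1 + 2 * \<sigma>\<^sup>2 * t))"
proof -
  define y where "y = 2 * \<sigma>\<^sup>2 * t / (1 + 2 * \<sigma>\<^sup>2 * t)"
  interpret p: phase_law "phase_measure f" \<Delta> by (rule phase_law_gtr[OF prob_space_axioms gtr])
  have [measurable]: "g \<in> borel_measurable M" using gtr by (simp add: gtr_fading_def)
  have w: "0 < 1 + 2 * \<sigma>\<^sup>2 * t" using t by (simp add: add_pos_nonneg)
  have y: "y \<le> 1" using w by (simp add: y_def divide_le_eq)
  have "ennreal (expectation (\<lambda>\<omega>. exp (- t * (cmod (g \<omega>))\<^sup>2))) = (\<integral>\<^sup>+\<omega>. ennreal (exp (- t * (cmod (g \<omega>))\<^sup>2)) \<partial>M)"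
    by (rule laplace_transform_nn_integral[symmetric]) (use t in auto)
  also have "\<dots> = (\<integral>\<^sup>+\<alpha>. ennreal ((1 - y) * exp (- (K * y) * p.c \<alpha>)) \<partial>phase_measure f)"
    unfolding y_def p.c_def by (rule gtr_nn_transform(1)[OF gtr t])
  also have "\<dots> = ennreal (LINT \<alpha>|phase_measure f. (1 - y) * exp (- (K * y) * p.c \<alpha>))"
    by (rule nn_integral_eq_integral[OF integrable_mult_right[OF p.z_integrable]]) (use y in auto)
  also have "(LINT \<alpha>|phase_measure f. (1 - y) * exp (- (K * y) * p.c \<alpha>)) = (1 - y) * p.z (K * y)"
    by (simp only: p.z_def integral_mult_right_zero)
  finally have "expectation (\<lambda>\<omega>. exp (- t * (cmod (g \<omega>))\<^sup>2)) = (1 - y) * p.z (K * y)"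
    by (rule ennreal_inj[THEN iffD1, rotated 2]) (use y p.z_nonneg in auto)
  then show ?thesis unfolding y_def[symmetric] by (simp add: p.power_defect_def)
qed

section \<open>Instantiation for the downlink network\<close>

context downlink_network begin

lemma gtr: "gtr_fading M K \<Delta> \<sigma> f (g 1)"
  using interferer_gtr by simp

lemma phase_law: "phase_law (phase_measure f) \<Delta>"
  by (rule phase_law_gtr[OF prob_space_axioms gtr])

lemma gtr_parameters: "0 \<le> K" "0 < \<sigma>"
  using gtr_nn_transform(4,6)[OF gtr order_refl] .

lemma LINT_phase:
  "F \<in> borel_measurable borel \<Longrightarrow> (LINT \<alpha>|phase_measure f. F \<alpha>) = (LBINT \<alpha>:{0..2*pi}. F \<alpha> * f \<alpha>)"
  by (rule LINT_phase_measure[OF gtr_nn_transform(3)[OF gtr order_refl]])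
    (use gtr in \<open>auto simp: gtr_fading_def\<close>)

text \<open>The constant is the product of two linear bounds: the defect is at most (1 + 2 K) y, and
  y is at most 2 \<sigma>^2 t.\<close>

lemma fading_network: "fading_network M \<Psi> lam g \<eta> P ((1 + 2 * K) * (2 * \<sigma>\<^sup>2))"
proof -
  interpret p: phase_law "phase_measure f" \<Delta> by (rule phase_law)
  show ?thesis
  proof
    fix t :: real assume t: "0 \<le> t"
    let ?y = "2 * \<sigma>\<^sup>2 * t / (1 + 2 * \<sigma>\<^sup>2 * t)"
    have "0 \<le> u / (1 + u) \<and> u / (1 + u) \<le> 1 \<and> u / (1 + u) \<le> u" if "0 \<le> u" for u :: real
      using that by (simp add: divide_le_eq algebra_simps)
    from this[of "2 * \<sigma>\<^sup>2 * t"] have y: "0 \<le> ?y" "?y \<le> 1" "?y \<le> 2 * \<sigma>\<^sup>2 * t" using t by auto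
    have "1 - expectation (\<lambda>\<omega>. exp (- t * (cmod (g 1 \<omega>))\<^sup>2)) = p.power_defect K ?y"
      by (simp only: gtr_transform[OF gtr t])
    also have "\<dots> \<le> (1 + 2 * K) * ?y" by (rule p.power_defect_bounds) (use y gtr_parameters in auto)
    also have "\<dots> \<le> (1 + 2 * K) * (2 * \<sigma>\<^sup>2 * t)" using y gtr_parameters by (intro mult_left_mono) auto
    finally show "1 - expectation (\<lambda>\<omega>. exp (- t * (cmod (g 1 \<omega>))\<^sup>2)) \<le> (1 + 2 * K) * (2 * \<sigma>\<^sup>2) * t"
      by (simp add: mult_ac)
  qed (fact lam_pos path_loss P_pos ppp interferer_ident fading_indep fading_indep_locations)+
qed

lemma zeta1_eq: "zeta1 \<Delta> f = phase_law.z (phase_measure f) \<Delta>"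
proof
  fix x
  interpret p: phase_law "phase_measure f" \<Delta> by (rule phase_law)
  show "zeta1 \<Delta> f x = p.z x"
    unfolding zeta1_def p.z_def p.c_def by (rule LINT_phase[symmetric]) measurable
qed

lemma zeta2_eq:
  "zeta2 \<eta> K \<Delta> f = (LINT \<alpha>|phase_measure f. phase_law.zeta2_integrand (2 / \<eta>) (K * phase_law.c \<Delta> \<alpha>))"
proof -
  interpret p: phase_law "phase_measure f" \<Delta> by (rule phase_law)
  have e: "(1 + 2 / \<eta>) / 2 = (\<eta> + 2) / (2 * \<eta>)" using path_loss by (simp add: field_simps)
  have "(LINT \<alpha>|phase_measure f. p.zeta2_integrand (2 / \<eta>) (K * p.c \<alpha>)) = (LBINT \<alpha>:{0..2*pi}. p.zeta2_integrand (2 / \<eta>) (K * p.c \<alpha>) * f \<alpha>)"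
    by (rule LINT_phase) measurable
  then show ?thesis by (simp add: zeta2_def p.zeta2_integrand_def p.c_def e mult.commute[of _ "f _"])
qed

lemma zeta3_eq:
  "zeta3 \<eta> \<Delta> f x = (LINT \<alpha>|phase_measure f. phase_law.c \<Delta> \<alpha> powr (2 / \<eta>) * lower_gamma (1 - 2 / \<eta>) (x * phase_law.c \<Delta> \<alpha>))"
proof -
  interpret p: phase_law "phase_measure f" \<Delta> by (rule phase_law)
  show ?thesis unfolding zeta3_def p.c_def by (rule LINT_phase[symmetric]) measurable
qed

text \<open>Extending 2 \<sigma>^2 t / (1 + 2 \<sigma>^2 t) at t = s P v^(-eta) by v^eta gives
  \<open>path_y\<close>. Integrability is stated together with the formula because the evaluation of
  the integral relies on it.\<close>

lemma AE_interference_laplace_gtr: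
  assumes lawI: "conditional_law M (serving_dist \<Psi>) (interference \<Psi> g \<eta> P) \<kappa>I"
  shows "AE r in lborel. 0 < r \<longrightarrow> (\<forall>s>0.
    set_integrable lborel {r..} (\<lambda>v. 2 * v * phase_law.power_defect (phase_measure f) \<Delta> K (phase_law.path_y \<eta> (2 * \<sigma>\<^sup>2 * s * P) v)) \<and>
    laplace (\<kappa>I r) s = exp (- (pi * lam * (LBINT v:{r..}. 2 * v * phase_law.power_defect (phase_measure f) \<Delta> K (phase_law.path_y \<eta> (2 * \<sigma>\<^sup>2 * s * P) v)))))"
proof -
  interpret p: phase_law "phase_measure f" \<Delta> by (rule phase_law)
  interpret n: fading_network M \<Psi> lam g \<eta> P "(1 + 2 * K) * (2 * \<sigma>\<^sup>2)" by (rule fading_network)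
  have w: "1 - n.weight s v = p.power_defect K (p.path_y \<eta> (2 * \<sigma>\<^sup>2 * s * P) v)" if "0 < s" "0 < v" for s v
  proof -
    let ?t = "s * P * v powr (-\<eta>)"
    have t: "0 \<le> ?t" using that P_pos by simp
    have "0 < v powr \<eta>" using that by simp
    then have "2 * \<sigma>\<^sup>2 * ?t / (1 + 2 * \<sigma>\<^sup>2 * ?t) = p.path_y \<eta> (2 * \<sigma>\<^sup>2 * s * P) v"
      unfolding p.path_y_def powr_minus using that P_pos by (simp add: divide_simps)
    then show ?thesis
      unfolding n.weight_def n.power_transform_def gtr_transform[OF gtr t] by simp
  qed
  show ?thesis
    using n.AE_interference_laplace[OF lawI]
  proof eventually_elim
    case (elim r)
    show ?case
    proof (intro impI allI)
      fix s :: real assume r: "0 < r" and s: "0 < s"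
      let ?h = "\<lambda>v. 2 * v * p.power_defect K (p.path_y \<eta> (2 * \<sigma>\<^sup>2 * s * P) v)"
      have i: "set_integrable lborel {r..} ?h"
        using set_integrable_mult_right[of 2, OF point_weight.q_tail[OF n.point_weight[OF less_imp_le[OF s]] r]]
        by (rule set_integrable_cong[OF refl refl, THEN iffD1, rotated]) (use w[OF s] r in auto)
      have "n.\<Lambda> s r = (LBINT v:{r..}. pi * lam * ?h v)"
        unfolding interference_exponent_def
        by (rule set_lebesgue_integral_cong) (use w[OF s] r in \<open>auto simp: mult_ac\<close>)
      then have "n.\<Lambda> s r = pi * lam * (LBINT v:{r..}. ?h v)" by simp
      then show "set_integrable lborel {r..} ?h \<and> laplace (\<kappa>I r) s = exp (- (pi * lam * (LBINT v:{r..}. ?h v)))"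
        using i elim r s by simp
    qed
  qed
qed

text \<open>The bracket \<open>J\<close> enters the exponent with a negative coefficient, so the
  upper bound on it becomes the lower bound (ii) on the transform.\<close>

lemma interference_formula:
  assumes r: "0 < r" and s: "0 < s"
    and int: "set_integrable lborel {r..} (\<lambda>v. 2 * v * phase_law.power_defect (phase_measure f) \<Delta> K (phase_law.path_y \<eta> (2 * \<sigma>\<^sup>2 * s * P) v))"
  defines "y\<^sub>o \<equiv> y_zero \<eta> P \<sigma> r s"
  defines "J \<equiv> - (LBINT y:{0..y\<^sub>o}. (1 - y) powr (2/\<eta> + 1) / y powr (2/\<eta>) * deriv (\<lambda>u. zeta1 \<Delta> f (K * u)) y)
          + (LBINT y:{0..y\<^sub>o}. (1 - y) powr (2/\<eta>) * zeta1 \<Delta> f (K * y) / y powr (2/\<eta>))"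
  shows "- (pi * lam * (LBINT v:{r..}. 2 * v * phase_law.power_defect (phase_measure f) \<Delta> K (phase_law.path_y \<eta> (2 * \<sigma>\<^sup>2 * s * P) v))) =
      pi * lam * (2 * \<sigma>\<^sup>2 * s * P * (1 - y\<^sub>o) / y\<^sub>o) powr (2/\<eta>) * (1 - (1 - y\<^sub>o) * zeta1 \<Delta> f (K * y\<^sub>o))
       - pi * lam * (2 * \<sigma>\<^sup>2 * s * P) powr (2/\<eta>) * J" (is "?L = ?A - _")
    and "J \<le> 2 * pi / \<eta> * zeta2 \<eta> K \<Delta> f * (1 / sin (2 * pi / \<eta>))"
proof -
  interpret p: phase_law "phase_measure f" \<Delta> by (rule phase_law)
  let ?C = "2 * \<sigma>\<^sup>2 * s * P"
  have C: "0 < ?C" using s P_pos gtr_parameters by simp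
  have \<eta>: "0 < \<eta>" "0 < 2 / \<eta>" "2 / \<eta> < 1" using path_loss by auto
  have y: "y\<^sub>o = p.path_y \<eta> ?C r" by (simp add: y\<^sub>o_def y_zero_def p.path_y_def)
  have y01: "0 < y\<^sub>o" "y\<^sub>o < 1" using p.path_y_bounds[OF C] r by (auto simp: y)
  \<comment> \<open>Inverting \<open>path_y\<close> at the serving distance: the power in front of
    the boundary term is just r^2.\<close>
  have "?C * (1 - y\<^sub>o) / y\<^sub>o = r powr \<eta>"
  proof -
    have "0 < r powr \<eta>" using r by simp
    have "1 - b / (a + b) = a / (a + b)" if "0 < a" "0 < b" for a b :: real
      using that by (simp add: field_simps)
    from this[OF \<open>0 < r powr \<eta>\<close> C] have "1 - y\<^sub>o = r powr \<eta> / (r powr \<eta> + ?C)" by (simp only: y p.path_y_def)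
    moreover have "b * (a / (a + b)) / (b / (a + b)) = a" if "0 < a" "0 < b" for a b :: real
      using that by simp
    from this[OF \<open>0 < r powr \<eta>\<close> C]
    have "?C * (r powr \<eta> / (r powr \<eta> + ?C)) / y\<^sub>o = r powr \<eta>" by (simp only: y p.path_y_def)
    ultimately show ?thesis by (simp only:)
  qed
  then have r2: "(?C * (1 - y\<^sub>o) / y\<^sub>o) powr (2/\<eta>) = r\<^sup>2" using r \<eta> by (simp add: powr_powr)
  have I: "J = - (LBINT y:{0..y\<^sub>o}. p.derivative_term (2/\<eta>) K y) + (LBINT y:{0..y\<^sub>o}. p.specular_term (2/\<eta>) K y)"
    unfolding J_def p.derivative_term_def p.specular_term_def zeta1_eq ..
  note pd = p.power_defect_path_integral[OF \<eta>(1) gtr_parameters(1) C r int, folded y]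
  show "?L = ?A - pi * lam * ?C powr (2/\<eta>) * J"
    unfolding I r2 pd(1) zeta1_eq p.power_defect_def[of K y\<^sub>o] by (simp add: algebra_simps)
  have e: "2 / \<eta> * pi / sin (pi * (2 / \<eta>)) * zeta2 \<eta> K \<Delta> f = 2 * pi / \<eta> * zeta2 \<eta> K \<Delta> f * (1 / sin (2 * pi / \<eta>))"
    by (simp add: mult.commute)
  show "J \<le> 2 * pi / \<eta> * zeta2 \<eta> K \<Delta> f * (1 / sin (2 * pi / \<eta>))"
    unfolding I e[symmetric] unfolding zeta2_eq
    by (rule p.zeta2_bound) (use \<eta> gtr_parameters y01 pd(2,3) in auto)
qed

end

text \<open>Here q = s P. As K grows with (K + 1) 2 \<sigma>^2 fixed, y tends to 0 while K y tends
  to q \<Omega> v^(-eta), so the defect tends to 1 - z(q \<Omega> v^(-eta)).\<close>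

lemma specular_limit:
  fixes K \<sigma> :: "nat \<Rightarrow> real" and \<Delta> \<eta> r k \<Omega> :: real
  assumes "phase_law \<nu> \<Delta>" and \<eta>: "2 < \<eta>" and r: "0 < r" and q: "0 < q"
    and K: "filterlim K at_top sequentially" "\<And>n. 0 \<le> K n" and \<sigma>: "\<And>n. 0 < \<sigma> n"
    and \<Omega>: "\<And>n. \<Omega> = (K n + 1) * 2 * (\<sigma> n)\<^sup>2"
  defines "h \<equiv> (\<lambda>n v. 2 * v * phase_law.power_defect \<nu> \<Delta> (K n) (phase_law.path_y \<eta> (2 * (\<sigma> n)\<^sup>2 * q) v))"
  shows "(\<lambda>n. LBINT v:{r..}. h n v) \<longlonglongrightarrow>
    (q * \<Omega>) powr (2 / \<eta>) * (LINT \<alpha>|\<nu>. phase_law.c \<Delta> \<alpha> powr (2 / \<eta>) * lower_gamma (1 - 2 / \<eta>) (q * \<Omega> * r powr (-\<eta>) * phase_law.c \<Delta> \<alpha>))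
      - r\<^sup>2 * (1 - phase_law.z \<nu> \<Delta> (q * \<Omega> * r powr (-\<eta>)))"
proof -
  interpret p: phase_law \<nu> \<Delta> by fact
  have \<Omega>0: "0 < \<Omega>" using \<Omega>[of 0] K(2)[of 0] \<sigma>[of 0] by (simp add: add_nonneg_pos)
  have K1: "0 < K n + 1" for n using K(2)[of n] by simp
  have sg: "2 * (\<sigma> n)\<^sup>2 = \<Omega> / (K n + 1)" for n using \<Omega>[of n] K1[of n] by (simp add: field_simps)
  have inf: "filterlim (\<lambda>n. K n + 1) at_top sequentially"
    using filterlim_tendsto_add_at_top[OF tendsto_const[of 1] K(1)] by (simp add: add.commute)
  have inv0: "(\<lambda>n. inverse (K n + 1)) \<longlonglongrightarrow> 0"
    by (rule tendsto_inverse_0_at_top[OF inf])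
  have s0: "(\<lambda>n. 2 * (\<sigma> n)\<^sup>2 * q) \<longlonglongrightarrow> 0"
    using tendsto_mult[OF tendsto_mult[OF tendsto_const[of \<Omega>] inv0] tendsto_const[of q]] by (simp add: sg divide_inverse)
  have K0: "(\<lambda>n. K n * (2 * (\<sigma> n)\<^sup>2 * q)) \<longlonglongrightarrow> q * \<Omega>"
  proof -
    have "K n * (2 * (\<sigma> n)\<^sup>2 * q) = (1 - inverse (K n + 1)) * (q * \<Omega>)" for n
      using K1[of n] by (simp add: sg field_simps)
    moreover have "(\<lambda>n. (1 - inverse (K n + 1)) * (q * \<Omega>)) \<longlonglongrightarrow> (1 - 0) * (q * \<Omega>)"
      by (intro tendsto_intros inv0)
    ultimately show ?thesis by (simp only: diff_zero mult_1_left)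
  qed
  let ?l = "\<lambda>v. 2 * v * (1 - p.z (q * \<Omega> * v powr (-\<eta>)))"
  let ?w = "\<lambda>v. indicator {r..} v *\<^sub>R (4 * \<Omega> * q * v powr (1 - \<eta>))"
  have C: "0 < 2 * (\<sigma> n)\<^sup>2 * q" for n using \<sigma>[of n] q by simp
  have hm: "h n \<in> borel_measurable borel" for n unfolding h_def p.power_defect_def by measurable
  have wi: "integrable lborel ?w"
    using set_integrable_mult_right[of "4 * \<Omega> * q", OF powr_tail_integrable[OF r, of "1 - \<eta>"]] \<eta>
    by (simp add: set_integrable_def)
  have lim: "(\<lambda>n. indicator {r..} v *\<^sub>R h n v) \<longlonglongrightarrow> indicator {r..} v *\<^sub>R ?l v" for v
  proof (cases "r \<le> v")
    case True
    then have v: "v powr \<eta> \<noteq> 0" using r by simp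
    have y0: "(\<lambda>n. p.path_y \<eta> (2 * (\<sigma> n)\<^sup>2 * q) v) \<longlonglongrightarrow> 0 / (v powr \<eta> + 0)"
      unfolding p.path_y_def by (intro tendsto_intros s0) (use v in simp)
    have "(\<lambda>n. K n * (2 * (\<sigma> n)\<^sup>2 * q) / (v powr \<eta> + 2 * (\<sigma> n)\<^sup>2 * q)) \<longlonglongrightarrow> q * \<Omega> / (v powr \<eta> + 0)"
      by (intro tendsto_intros s0 K0) (use v in simp)
    then have "(\<lambda>n. K n * p.path_y \<eta> (2 * (\<sigma> n)\<^sup>2 * q) v) \<longlonglongrightarrow> q * \<Omega> * v powr (-\<eta>)"
      by (simp add: p.path_y_def powr_minus divide_inverse mult.assoc)
    then have "(\<lambda>n. p.z (K n * p.path_y \<eta> (2 * (\<sigma> n)\<^sup>2 * q) v)) \<longlonglongrightarrow> p.z (q * \<Omega> * v powr (-\<eta>))"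
      by (rule isCont_tendsto_compose[OF p.z_continuous])
    then have "(\<lambda>n. h n v) \<longlonglongrightarrow> 2 * v * (1 - (1 - 0 / (v powr \<eta> + 0)) * p.z (q * \<Omega> * v powr (-\<eta>)))"
      unfolding h_def p.power_defect_def by (intro tendsto_intros y0)
    then show ?thesis using True by simp
  qed simp
  have bound: "norm (indicator {r..} v *\<^sub>R h n v) \<le> ?w v" for n v
  proof (cases "r \<le> v")
    case True
    let ?y = "p.path_y \<eta> (2 * (\<sigma> n)\<^sup>2 * q) v"
    have v: "0 < v" using True r by simp
    have yb: "0 \<le> ?y" "?y \<le> 1" using p.path_y_bounds[OF C[of n], of \<eta> v] by auto
    have y1: "?y \<le> 2 * (\<sigma> n)\<^sup>2 * q * v powr (-\<eta>)"
      unfolding p.path_y_def powr_minus divide_inverse using v C[of n]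
      by (intro mult_left_mono le_imp_inverse_le) auto
    \<comment> \<open>Replacing 1 + 2 K by 2 (K + 1) brings in \<Omega> and makes the bound on the
      defect uniform in n.\<close>
    have "(1 + 2 * K n) * ?y \<le> (2 * (K n + 1)) * (2 * (\<sigma> n)\<^sup>2 * q * v powr (-\<eta>))"
      using K(2)[of n] y1 yb by (intro mult_mono) auto
    also have "\<dots> = 2 * \<Omega> * q * v powr (-\<eta>)" using \<Omega>[of n] by (simp add: mult_ac)
    finally have "p.power_defect (K n) ?y \<le> 2 * \<Omega> * q * v powr (-\<eta>)"
      using p.power_defect_bounds(2)[OF K(2)[of n] yb] by linarith
    then have "2 * v * p.power_defect (K n) ?y \<le> 2 * v * (2 * \<Omega> * q * v powr (-\<eta>))"
      using v by (intro mult_left_mono) auto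
    also have "\<dots> = 4 * \<Omega> * q * v powr (1 - \<eta>)"
      using v powr_add[of v 1 "- \<eta>"] by simp
    finally show ?thesis
      using True v p.power_defect_bounds(1)[OF K(2)[of n] yb] by (simp add: h_def)
  qed simp
  have lm: "(\<lambda>v. indicator {r..} v *\<^sub>R ?l v) \<in> borel_measurable lborel" by measurable
  have hm': "(\<lambda>v. indicator {r..} v *\<^sub>R h n v) \<in> borel_measurable lborel" for n using hm[of n] by measurable
  have int: "set_integrable lborel {r..} ?l"
    unfolding set_integrable_def
    by (rule integrable_dominated_convergence[where s="\<lambda>n v. indicator {r..} v *\<^sub>R h n v" and w="?w"])
      (use lm hm' wi lim bound in auto)
  have "(\<lambda>n. LBINT v:{r..}. h n v) \<longlonglongrightarrow> (LBINT v:{r..}. ?l v)"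
    unfolding set_lebesgue_integral_def
    by (rule integral_dominated_convergence[where w="?w"]) (use lm hm' wi lim bound in auto)
  also have "(LBINT v:{r..}. ?l v) = (q * \<Omega>) powr (2 / \<eta>) * (LINT \<alpha>|\<nu>. p.c \<alpha> powr (2 / \<eta>) * lower_gamma (1 - 2 / \<eta>) (q * \<Omega> * r powr (-\<eta>) * p.c \<alpha>))
      - r\<^sup>2 * (1 - p.z (q * \<Omega> * r powr (-\<eta>)))"
    by (rule p.phase_average_path_integral[OF \<eta> _ r int]) (use q \<Omega>0 in simp)
  finally show ?thesis .
qed

text \<open>The kernels are arbitrary versions of the conditional laws, hence the almost everywhere
  quantifiers, each with one null set for all s. The limit in (iii) concerns a sequence of networks,
  possibly on different measures, that share \<Delta> and \<open>f\<close>.\<close>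

theorem theorem1:
  fixes M :: "'w measure"
    and \<Psi> :: "'w \<Rightarrow> (real^2) set"
    and g :: "nat \<Rightarrow> 'w \<Rightarrow> complex"
    and lam \<eta> P N\<^sub>o K\<^sub>o \<Delta>\<^sub>o \<sigma>\<^sub>o K \<Delta> \<sigma> :: real
    and f\<^sub>o f :: "real \<Rightarrow> real"
    and \<kappa>S \<kappa>I :: "real \<Rightarrow> real measure"
  assumes network: "downlink_network M \<Psi> g lam \<eta> P N\<^sub>o K\<^sub>o \<Delta>\<^sub>o \<sigma>\<^sub>o f\<^sub>o K \<Delta> \<sigma> f"
    and lawS: "conditional_law M (serving_dist \<Psi>) (signal_power \<Psi> g \<eta> P) \<kappa>S"
    and lawI: "conditional_law M (serving_dist \<Psi>) (interference \<Psi> g \<eta> P) \<kappa>I"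
  shows
    "avg_spectral_efficiency M \<Psi> g \<eta> P N\<^sub>o =
       (LBINT z:{0<..}. (LBINT r:{0<..}.
          laplace (\<kappa>I r) (z / N\<^sub>o) * (1 - laplace (\<kappa>S r) (z / N\<^sub>o)) * (exp (-z) / z)
          * serving_density lam r))
     \<and>
     (AE r in lborel. 0 < r \<longrightarrow> (\<forall>s>0. let y\<^sub>o = y_zero \<eta> P \<sigma> r s in
        laplace (\<kappa>I r) s =
          exp (pi * lam * (2 * \<sigma>\<^sup>2 * s * P * (1 - y\<^sub>o) / y\<^sub>o) powr (2/\<eta>)
                 * (1 - (1 - y\<^sub>o) * zeta1 \<Delta> f (K * y\<^sub>o))
               - pi * lam * (2 * \<sigma>\<^sup>2 * s * P) powr (2/\<eta>)
                 * (- (LBINT y:{0..y\<^sub>o}. (1 - y) powr (2/\<eta> + 1) / y powr (2/\<eta>)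
                         * deriv (\<lambda>u. zeta1 \<Delta> f (K * u)) y)
                    + (LBINT y:{0..y\<^sub>o}. (1 - y) powr (2/\<eta>) * zeta1 \<Delta> f (K * y)
                         / y powr (2/\<eta>))))))
     \<and>
     (AE r in lborel. 0 < r \<longrightarrow> (\<forall>s>0. let y\<^sub>o = y_zero \<eta> P \<sigma> r s in
        laplace (\<kappa>I r) s \<ge>
          exp (pi * lam * (2 * \<sigma>\<^sup>2 * s * P * (1 - y\<^sub>o) / y\<^sub>o) powr (2/\<eta>)
                 * (1 - (1 - y\<^sub>o) * zeta1 \<Delta> f (K * y\<^sub>o))
               - 2 * pi\<^sup>2 / \<eta> * zeta2 \<eta> K \<Delta> f * lam * (1 / sin (2 * pi / \<eta>))
                 * (2 * \<sigma>\<^sup>2 * s * P) powr (2/\<eta>))))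
     \<and>
     (\<forall>(M' :: nat \<Rightarrow> 'w measure) \<Psi>' g' K\<^sub>o' \<Delta>\<^sub>o' \<sigma>\<^sub>o' f\<^sub>o' K' \<sigma>' \<kappa>I' \<Omega>.
        (\<forall>n. downlink_network (M' n) (\<Psi>' n) (g' n) lam \<eta> P N\<^sub>o
               (K\<^sub>o' n) (\<Delta>\<^sub>o' n) (\<sigma>\<^sub>o' n) (f\<^sub>o' n) (K' n) \<Delta> (\<sigma>' n) f) \<and>
        (\<forall>n. conditional_law (M' n) (serving_dist (\<Psi>' n))
               (interference (\<Psi>' n) (g' n) \<eta> P) (\<kappa>I' n)) \<and>
        filterlim K' at_top sequentially \<and>
        (\<forall>n. \<Omega> = (K' n + 1) * 2 * (\<sigma>' n)\<^sup>2) \<longrightarrow>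
        (AE r in lborel. 0 < r \<longrightarrow> (\<forall>s>0.
           (\<lambda>n. laplace (\<kappa>I' n r) s) \<longlonglongrightarrow>
             exp (pi * lam *
               (r\<^sup>2 * (1 - zeta1 \<Delta> f (s * P * \<Omega> * r powr (-\<eta>)))
                - (s * P * \<Omega>) powr (2/\<eta>) * zeta3 \<eta> \<Delta> f (s * P * \<Omega> * r powr (-\<eta>)))))))"
proof -
  interpret N: downlink_network M \<Psi> g lam \<eta> P N\<^sub>o K\<^sub>o \<Delta>\<^sub>o \<sigma>\<^sub>o f\<^sub>o K \<Delta> \<sigma> f by (rule network)
  show ?thesis
  proof (intro conjI allI impI, goal_cases)
    case 1
    show ?case by (rule fading_network.avg_spectral_efficiency_eq[OF N.fading_network lawS lawI N.noise_pos])
  next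
    case 2
    show ?case using N.AE_interference_laplace_gtr[OF lawI]
    proof eventually_elim
      case (elim r)
      show ?case unfolding Let_def
      proof (intro impI allI, goal_cases)
        case (1 s)
        with elim show ?case by (simp only: N.interference_formula(1)[OF 1, symmetric])
      qed
    qed
  next
    case 3
    show ?case using N.AE_interference_laplace_gtr[OF lawI]
    proof eventually_elim
      case (elim r)
      show ?case unfolding Let_def
      proof (intro impI allI, goal_cases)
        case (1 s)
        let ?h = "\<lambda>v. 2 * v * phase_law.power_defect (phase_measure f) \<Delta> K (phase_law.path_y \<eta> (2 * \<sigma>\<^sup>2 * s * P) v)"
        from elim 1 have int: "set_integrable lborel {r..} ?h"
          and L: "laplace (\<kappa>I r) s = exp (- (pi * lam * (LBINT v:{r..}. ?h v)))"
          by blast+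
        have "0 \<le> pi * lam * (2 * \<sigma>\<^sup>2 * s * P) powr (2/\<eta>)" using N.lam_pos by simp
        from mult_left_mono[OF N.interference_formula(2)[OF 1 int] this]
        show ?case
          unfolding L N.interference_formula(1)[OF 1 int]
          by (simp add: power2_eq_square mult_ac)
      qed
    qed
  next
    case (4 M' \<Psi>' g' K\<^sub>o' \<Delta>\<^sub>o' \<sigma>\<^sub>o' f\<^sub>o' K' \<sigma>' \<kappa>I' \<Omega>)
    then have net: "\<And>n. downlink_network (M' n) (\<Psi>' n) (g' n) lam \<eta> P N\<^sub>o
               (K\<^sub>o' n) (\<Delta>\<^sub>o' n) (\<sigma>\<^sub>o' n) (f\<^sub>o' n) (K' n) \<Delta> (\<sigma>' n) f"
      and law: "\<And>n. conditional_law (M' n) (serving_dist (\<Psi>' n)) (interference (\<Psi>' n) (g' n) \<eta> P) (\<kappa>I' n)"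
      and K': "filterlim K' at_top sequentially" and \<Omega>: "\<And>n. \<Omega> = (K' n + 1) * 2 * (\<sigma>' n)\<^sup>2"
      by blast+
    let ?h = "\<lambda>n s v. 2 * v * phase_law.power_defect (phase_measure f) \<Delta> (K' n) (phase_law.path_y \<eta> (2 * (\<sigma>' n)\<^sup>2 * s * P) v)"
    note par = downlink_network.gtr_parameters[OF net]
    \<comment> \<open>Countably many networks still leave a single null set of distances, outside
      which the limit can be taken.\<close>
    have "AE r in lborel. \<forall>n. 0 < r \<longrightarrow> (\<forall>s>0. set_integrable lborel {r..} (?h n s) \<and>
      laplace (\<kappa>I' n r) s = exp (- (pi * lam * (LBINT v:{r..}. ?h n s v))))"
      unfolding AE_all_countable
      using downlink_network.AE_interference_laplace_gtr[OF net law] by blast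
    then show ?case
    proof eventually_elim
      case (elim r)
      show ?case
      proof (intro impI allI)
        fix s :: real assume r: "0 < r" and s: "0 < s"
        have q: "0 < s * P" using s N.P_pos by simp
        have L: "laplace (\<kappa>I' n r) s = exp (- (pi * lam * (LBINT v:{r..}. 2 * v * phase_law.power_defect (phase_measure f) \<Delta> (K' n) (phase_law.path_y \<eta> (2 * (\<sigma>' n)\<^sup>2 * (s * P)) v))))" for n
          using elim r s by (simp add: mult.assoc)
        have "(\<lambda>n. laplace (\<kappa>I' n r) s) \<longlonglongrightarrow> exp (- (pi * lam * ((s * P * \<Omega>) powr (2/\<eta>) * zeta3 \<eta> \<Delta> f (s * P * \<Omega> * r powr (-\<eta>))
            - r\<^sup>2 * (1 - zeta1 \<Delta> f (s * P * \<Omega> * r powr (-\<eta>))))))"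
          unfolding L N.zeta1_eq N.zeta3_eq
          by (intro tendsto_intros specular_limit[OF N.phase_law N.path_loss r q K' par \<Omega>])
        then show "(\<lambda>n. laplace (\<kappa>I' n r) s) \<longlonglongrightarrow>
             exp (pi * lam *
               (r\<^sup>2 * (1 - zeta1 \<Delta> f (s * P * \<Omega> * r powr (-\<eta>)))
                - (s * P * \<Omega>) powr (2/\<eta>) * zeta3 \<eta> \<Delta> f (s * P * \<Omega> * r powr (-\<eta>))))"
          by (simp add: algebra_simps)
      qed
    qed
  qed
qed

end
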